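(* Let $(X,d)$ be a hyperbolic metric space, $o\in X$, $b>1$ a parameter admitting a visual metric $D=D_{b,o}$ on $\partial X$, and let $G\le\mathrm{Isom}(X)$ be a strongly discrete group of general type with Poincaré exponent $\delta\in[0,\infty]$. Let $(\xi_k)_1^\ell$ be a countable (finite or infinite) sequence in $\partial X$. Then $$\dim_H\Big(\bigcap_{k=1}^\ell \mathrm{BA}_{\xi_k}\cap\Lambda_{ur}\Big)=\delta=\dim_H(\Lambda_r).$$ In particular $\mathrm{BA}_\xi\ne\emptyset$ for every $\xi\in\partial X$; consequently, for every $\xi\in\partial X$ there does not exist a function $\phi$ with $\phi(t)\to0$ as $t\to\infty$ such that for every $\eta\in\Lambda_r$ there is a constant $C=C_\eta>0$ with $D(g(\xi),\eta)\le C\,b^{-d(o,g(o))}\phi(b^{d(o,g(o))})$ for infinitely many $g\in G$.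
   Context: For a metric space $(X,d)$ let $\langle x|y\rangle_z=\frac12[d(x,z)+d(y,z)-d(x,y)]$. $(X,d)$ is (Gromov) hyperbolic if there is $C\ge 0$ with $\langle x|z\rangle_w\ge\min(\langle x|y\rangle_w,\langle y|z\rangle_w)-C$ for all $x,y,z,w\in X$ ($X$ need not be proper or geodesic). Fix a basepoint $o\in X$. A sequence $(x_n)$ in $X$ is a Gromov sequence if $\langle x_n|x_m\rangle_o\to\infty$ as $n,m\to\infty$; two Gromov sequences are equivalent if $\langle x_n|y_n\rangle_o\to\infty$; the Gromov boundary $\partial X$ is the set of equivalence classes, and isometries of $X$ act on it. For $\xi,\eta\in\partial X$ and $y,z\in X$: $\langle\xi|\eta\rangle_z=\inf\{\liminf_{n,m\to\infty}\langle x_n|y_m\rangle_z:(x_n)\in\xi,(y_m)\in\eta\}$ and $\langle\xi|y\rangle_z=\langle y|\xi\rangle_z=\inf\{\liminf_{n\to\infty}\langle x_n|y\rangle_z:(x_n)\in\xi\}$. A sequence $(x_n)$ in $X\cup\partial X$ converges to $\xi\in\partial X$ iff $\langle x_n|\xi\rangle_o\to\infty$. The parameter $b>1$ is close enough to $1$ that there is a complete metric $D=D_{b,o}$ on $\partial X$ (a visual metric) with $C^{-1}b^{-\langle\xi|\eta\rangle_o}\le D(\xi,\eta)\le Cb^{-\langle\xi|\eta\rangle_o}$ for some constant $C\geq 1$; such a $D$ is fixed, and Hausdorff dimension $\dim_H$ refers to $D$. $G\le\mathrm{Isom}(X)$ is strongly discrete if $\{g\in G:d(o,g(o))\le r\}$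 is finite for every $r>0$. An isometry $g$ is loxodromic if it has two fixed points $g_+,g_-\in\partial X$ such that for every neighborhood $U$ of $g_-$ the iterates $g^n$ converge to $g_+$ uniformly on $\partial X\setminus U$, and $g^{-1}$ has the same property (with $g_+$ and $g_-$ exchanged). $G$ is of general type if it contains two loxodromic isometries with disjoint fixed-point sets in $\partial X$. The Poincaré exponent is $\delta=\inf\{s\ge0:\sum_{g\in G}b^{-s\,d(o,g(o))}<\infty\}$, $\inf\emptyset=\infty$. For $\sigma>0$, $\Lambda_{r,\sigma}$ is the set of $\eta\in\partial X$ for which there is a sequence $(g_n)_1^\infty$ in $G$ with $g_n(o)\to\eta$ and $\langle o|\eta\rangle_{g_n(o)}\le\sigma$ for all $n$; the radial limit set is $\Lambda_r=\bigcup_{\sigma>0}\Lambda_{r,\sigma}$. $\Lambda_{ur,\sigma}$ is the set of $\eta$ for which such a sequence can be chosen with in addition $g_1(o)=o$ and $d(g_n(o),g_{n+1}(o))\le\sigma$ for all $n$; the uniformly radial limit set is $\Lambda_{ur}=\bigcup_{\sigma>0}\Lambda_{ur,\sigma}$. For $\xi\in\partial X$, $\mathrm{BA}_\xi$ is the set of $\eta\in\Lambda_r$ for which there exists $\varepsilon>0$ with $D(g(\xi),\eta)\ge\varepsilon b^{-d(o,g(o))}$ for all $g\in G$. *)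

theory Defs
  imports "HOL-Analysis.Analysis" "HOL-Algebra.Group"
begin

section \<open>Hyperbolic metric spaces and the Gromov boundary\<close>

definition gromov_prod :: "'x::metric_space \<Rightarrow> 'x \<Rightarrow> 'x \<Rightarrow> real" where
  "gromov_prod z x y = (dist x z + dist y z - dist x y) / 2"

definition gromov_hyperbolic :: "'x::metric_space itself \<Rightarrow> bool" where
  "gromov_hyperbolic TYPE('x) \<longleftrightarrow>
     (\<exists>C\<ge>0. \<forall>x y z w :: 'x.
        gromov_prod w x z \<ge> min (gromov_prod w x y) (gromov_prod w y z) - C)"

definition gromov_seq :: "'x::metric_space \<Rightarrow> (nat \<Rightarrow> 'x) \<Rightarrow> bool" where
  "gromov_seq p x \<longleftrightarrow>
     filterlim (\<lambda>(n, m). gromov_prod p (x n) (x m)) at_top (sequentially \<times>\<^sub>F sequentially)"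

definition gromov_seq_rel :: "'x::metric_space \<Rightarrow> ((nat \<Rightarrow> 'x) \<times> (nat \<Rightarrow> 'x)) set" where
  "gromov_seq_rel p = {(x, y). gromov_seq p x \<and> gromov_seq p y \<and>
     filterlim (\<lambda>n. gromov_prod p (x n) (y n)) at_top sequentially}"

text \<open>The relation is an equivalence relation when the space is hyperbolic; a boundary point is
  an equivalence class, i.e. a set of sequences.\<close>

type_synonym 'x bdry = "(nat \<Rightarrow> 'x) set"

definition gromov_boundary :: "'x::metric_space \<Rightarrow> 'x bdry set" where
  "gromov_boundary p = {x. gromov_seq p x} // gromov_seq_rel p"

text \<open>The extended Gromov products take values in the extended reals, since the product of a
  boundary point with itself is infinite.\<close>

definition gromov_prod_bb :: "'x::metric_space \<Rightarrow> 'x bdry \<Rightarrow> 'x bdry \<Rightarrow> ereal" where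
  "gromov_prod_bb z \<xi> \<eta> =
     (INF x\<in>\<xi>. INF y\<in>\<eta>.
        Liminf (sequentially \<times>\<^sub>F sequentially) (\<lambda>(n, m). ereal (gromov_prod z (x n) (y m))))"

definition gromov_prod_pb :: "'x::metric_space \<Rightarrow> 'x \<Rightarrow> 'x bdry \<Rightarrow> ereal" where
  "gromov_prod_pb z y \<xi> = (INF x\<in>\<xi>. liminf (\<lambda>n. ereal (gromov_prod z (x n) y)))"

text \<open>Convergence of a sequence of points of the space to a boundary point.\<close>

definition tendsto_bdry :: "'x::metric_space \<Rightarrow> (nat \<Rightarrow> 'x) \<Rightarrow> 'x bdry \<Rightarrow> bool" where
  "tendsto_bdry p x \<xi> \<longleftrightarrow> (\<lambda>n. gromov_prod_pb p (x n) \<xi>) \<longlonglongrightarrow> \<infinity>"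


section \<open>Visual metrics\<close>

text \<open>The number \<open>b\<close> to the power \<open>- t\<close>, with value 0 for infinite \<open>t\<close>; the Gromov products to
  which it is applied are never negative.\<close>

definition neg_pow :: "real \<Rightarrow> ereal \<Rightarrow> real" where
  "neg_pow b t = (if t = \<infinity> then 0 else b powr (- real_of_ereal t))"

definition visual_metric ::
    "'x::metric_space \<Rightarrow> real \<Rightarrow> ('x bdry \<Rightarrow> 'x bdry \<Rightarrow> real) \<Rightarrow> bool" where
  "visual_metric p b D \<longleftrightarrow>
     Metric_space (gromov_boundary p) D \<and>
     Metric_space.mcomplete (gromov_boundary p) D \<and>
     (\<exists>C\<ge>1. \<forall>\<xi>\<in>gromov_boundary p. \<forall>\<eta>\<in>gromov_boundary p.
        neg_pow b (gromov_prod_bb p \<xi> \<eta>) / C \<le> D \<xi> \<eta> \<and>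
        D \<xi> \<eta> \<le> C * neg_pow b (gromov_prod_bb p \<xi> \<eta>))"


section \<open>Hausdorff dimension\<close>

text \<open>Let \<open>D\<close> be a metric on the set \<open>M\<close>. The following is the \<open>s\<close>-th power of the diameter of
  \<open>U\<close>. For \<open>s = 0\<close> it is 1 unless \<open>U\<close> is empty (note that \<open>0 powr 0 = 0\<close>). It is only used for
  sets of finite diameter.\<close>

definition diam_pow :: "('a \<Rightarrow> 'a \<Rightarrow> real) \<Rightarrow> real \<Rightarrow> 'a set \<Rightarrow> ennreal" where
  "diam_pow D s U =
     (if U = {} then 0 else if s = 0 then 1
      else ennreal ((SUP (x, y)\<in>U \<times> U. D x y) powr s))"

definition hausdorff_pre ::
    "'a set \<Rightarrow> ('a \<Rightarrow> 'a \<Rightarrow> real) \<Rightarrow> real \<Rightarrow> real \<Rightarrow> 'a set \<Rightarrow> ennreal" where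
  "hausdorff_pre M D s r A =
     Inf {(\<Sum>i. diam_pow D s (U i)) | U :: nat \<Rightarrow> 'a set.
            (\<forall>i. U i \<subseteq> M \<and> (\<forall>x\<in>U i. \<forall>y\<in>U i. D x y \<le> r)) \<and> A \<subseteq> (\<Union>i. U i)}"

definition hausdorff_measure ::
    "'a set \<Rightarrow> ('a \<Rightarrow> 'a \<Rightarrow> real) \<Rightarrow> real \<Rightarrow> 'a set \<Rightarrow> ennreal" where
  "hausdorff_measure M D s A = (SUP r\<in>{0<..}. hausdorff_pre M D s r A)"

definition hausdorff_dim :: "'a set \<Rightarrow> ('a \<Rightarrow> 'a \<Rightarrow> real) \<Rightarrow> 'a set \<Rightarrow> ereal" where
  "hausdorff_dim M D A = Inf {ereal s | s. s \<ge> 0 \<and> hausdorff_measure M D s A = 0}"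


section \<open>Groups of isometries\<close>

definition isom_group :: "('x::metric_space \<Rightarrow> 'x) monoid" where
  "isom_group = \<lparr>carrier = {g. bij g \<and> (\<forall>x y. dist (g x) (g y) = dist x y)},
                 mult = (\<circ>), one = id\<rparr>"

definition bdry_act :: "('x \<Rightarrow> 'x) \<Rightarrow> 'x bdry \<Rightarrow> 'x bdry" where
  "bdry_act g \<xi> = (\<lambda>x. g \<circ> x) ` \<xi>"

definition bdry_fixed_points :: "'x::metric_space \<Rightarrow> ('x \<Rightarrow> 'x) \<Rightarrow> 'x bdry set" where
  "bdry_fixed_points p g = {\<xi>\<in>gromov_boundary p. bdry_act g \<xi> = \<xi>}"

definition strongly_discrete :: "'x::metric_space \<Rightarrow> ('x \<Rightarrow> 'x) set \<Rightarrow> bool" where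
  "strongly_discrete p G \<longleftrightarrow> (\<forall>r>0. finite {g\<in>G. dist p (g p) \<le> r})"

text \<open>For every neighbourhood \<open>U\<close> of \<open>\<beta>\<close>, the iterates of \<open>g\<close> converge to \<open>\<alpha>\<close> uniformly off \<open>U\<close>.
  Topology and uniformity of the boundary are those of the visual metric \<open>D\<close>; see
  \<open>limitin_visual_metric\<close> below.\<close>

definition iterates_attract ::
    "'x::metric_space \<Rightarrow> ('x bdry \<Rightarrow> 'x bdry \<Rightarrow> real) \<Rightarrow> ('x \<Rightarrow> 'x) \<Rightarrow> 'x bdry \<Rightarrow> 'x bdry \<Rightarrow> bool"
  where
  "iterates_attract p D g \<alpha> \<beta> \<longleftrightarrow>
     (\<forall>U V. openin (Metric_space.mtopology (gromov_boundary p) D) V \<and> \<beta> \<in> V \<and> V \<subseteq> U \<longrightarrow>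
        (\<forall>e>0. \<forall>\<^sub>F n in sequentially. \<forall>\<eta>\<in>gromov_boundary p - U.
           D (bdry_act (g ^^ n) \<eta>) \<alpha> < e))"

definition loxodromic ::
    "'x::metric_space \<Rightarrow> ('x bdry \<Rightarrow> 'x bdry \<Rightarrow> real) \<Rightarrow> ('x \<Rightarrow> 'x) \<Rightarrow> bool" where
  "loxodromic p D g \<longleftrightarrow> g \<in> carrier isom_group \<and>
     (\<exists>\<alpha>\<in>bdry_fixed_points p g. \<exists>\<beta>\<in>bdry_fixed_points p g. \<alpha> \<noteq> \<beta> \<and>
        iterates_attract p D g \<alpha> \<beta> \<and>
        iterates_attract p D (inv\<^bsub>isom_group\<^esub> g) \<beta> \<alpha>)"

definition general_type ::
    "'x::metric_space \<Rightarrow> ('x bdry \<Rightarrow> 'x bdry \<Rightarrow> real) \<Rightarrow> ('x \<Rightarrow> 'x) set \<Rightarrow> bool" where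
  "general_type p D G \<longleftrightarrow>
     (\<exists>g\<in>G. \<exists>h\<in>G. loxodromic p D g \<and> loxodromic p D h \<and>
        bdry_fixed_points p g \<inter> bdry_fixed_points p h = {})"

definition poincare_exponent :: "'x::metric_space \<Rightarrow> real \<Rightarrow> ('x \<Rightarrow> 'x) set \<Rightarrow> ereal" where
  "poincare_exponent p b G =
     Inf {ereal s | s. s \<ge> 0 \<and> (\<lambda>g. b powr (- s * dist p (g p))) summable_on G}"


section \<open>Limit sets\<close>

definition radial_limit_set_at ::
    "'x::metric_space \<Rightarrow> ('x \<Rightarrow> 'x) set \<Rightarrow> real \<Rightarrow> 'x bdry set" where
  "radial_limit_set_at p G \<sigma> = {\<eta>\<in>gromov_boundary p. \<exists>g :: nat \<Rightarrow> 'x \<Rightarrow> 'x.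
     (\<forall>n. g n \<in> G) \<and> tendsto_bdry p (\<lambda>n. g n p) \<eta> \<and>
     (\<forall>n. gromov_prod_pb (g n p) p \<eta> \<le> ereal \<sigma>)}"

definition radial_limit_set :: "'x::metric_space \<Rightarrow> ('x \<Rightarrow> 'x) set \<Rightarrow> 'x bdry set" where
  "radial_limit_set p G = (\<Union>\<sigma>\<in>{0<..}. radial_limit_set_at p G \<sigma>)"

text \<open>The sequences in \<open>G\<close> are indexed from 0.\<close>

definition uniformly_radial_limit_set_at ::
    "'x::metric_space \<Rightarrow> ('x \<Rightarrow> 'x) set \<Rightarrow> real \<Rightarrow> 'x bdry set" where
  "uniformly_radial_limit_set_at p G \<sigma> = {\<eta>\<in>gromov_boundary p. \<exists>g :: nat \<Rightarrow> 'x \<Rightarrow> 'x.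
     (\<forall>n. g n \<in> G) \<and> tendsto_bdry p (\<lambda>n. g n p) \<eta> \<and>
     (\<forall>n. gromov_prod_pb (g n p) p \<eta> \<le> ereal \<sigma>) \<and>
     g 0 p = p \<and> (\<forall>n. dist (g n p) (g (Suc n) p) \<le> \<sigma>)}"

definition uniformly_radial_limit_set :: "'x::metric_space \<Rightarrow> ('x \<Rightarrow> 'x) set \<Rightarrow> 'x bdry set" where
  "uniformly_radial_limit_set p G = (\<Union>\<sigma>\<in>{0<..}. uniformly_radial_limit_set_at p G \<sigma>)"

definition badly_approximable ::
    "'x::metric_space \<Rightarrow> real \<Rightarrow> ('x bdry \<Rightarrow> 'x bdry \<Rightarrow> real) \<Rightarrow> ('x \<Rightarrow> 'x) set \<Rightarrow> 'x bdry \<Rightarrow> 'x bdry set"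
  where
  "badly_approximable p b D G \<xi> = {\<eta>\<in>radial_limit_set p G.
     \<exists>\<epsilon>>0. \<forall>g\<in>G. D (bdry_act g \<xi>) \<eta> \<ge> \<epsilon> * b powr (- dist p (g p))}"


section \<open>Consistency of the definitions\<close>

lemma group_isom_group: "group (isom_group :: ('x::metric_space \<Rightarrow> 'x) monoid)"
proof (rule groupI)
  fix g :: "'x \<Rightarrow> 'x"
  assume g: "g \<in> carrier isom_group"
  then have b: "bij g" and d: "\<And>x y. dist (g x) (g y) = dist x y"
    by (auto simp: isom_group_def)
  have "dist (Hilbert_Choice.inv g x) (Hilbert_Choice.inv g y) = dist x y" for x y
    using d[of "Hilbert_Choice.inv g x" "Hilbert_Choice.inv g y"] b
    by (simp add: bij_is_surj surj_f_inv_f)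
  then show "\<exists>h\<in>carrier isom_group. h \<otimes>\<^bsub>isom_group\<^esub> g = \<one>\<^bsub>isom_group\<^esub>"
    using b by (intro bexI[of _ "Hilbert_Choice.inv g"])
      (auto simp: isom_group_def bij_imp_bij_inv bij_is_inj)
qed (auto simp: isom_group_def bij_comp comp_assoc)

lemma gromov_prod_nonneg: "gromov_prod z x y \<ge> 0"
  unfolding gromov_prod_def
  using dist_triangle2[of x y z] by simp

lemma gromov_prod_bb_nonneg: "gromov_prod_bb z \<xi> \<eta> \<ge> 0"
  unfolding gromov_prod_bb_def
  by (intro INF_greatest Liminf_bounded always_eventually)
     (auto simp: gromov_prod_nonneg)

text \<open>Convergence of boundary points with respect to a visual metric is convergence of the Gromov
  products to infinity.\<close>

lemma limitin_visual_metric: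
  assumes D: "visual_metric p b D" and b: "b > 1"
    and \<xi>: "\<xi> \<in> gromov_boundary p" and x: "\<And>n. x n \<in> gromov_boundary p"
  shows "limitin (Metric_space.mtopology (gromov_boundary p) D) x \<xi> sequentially
     \<longleftrightarrow> (\<lambda>n. gromov_prod_bb p (x n) \<xi>) \<longlonglongrightarrow> \<infinity>"
proof -
  interpret Metric_space "gromov_boundary p" D
    using D by (simp add: visual_metric_def)
  obtain C where C: "C \<ge> 1"
    and lo: "\<And>n. neg_pow b (gromov_prod_bb p (x n) \<xi>) / C \<le> D (x n) \<xi>"
    and hi: "\<And>n. D (x n) \<xi> \<le> C * neg_pow b (gromov_prod_bb p (x n) \<xi>)"
    using D \<xi> x unfolding visual_metric_def by metis
  have pow: "neg_pow b t < b powr (- r) \<longleftrightarrow> ereal r < t" if "t \<ge> 0" for t r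
    using that b by (cases t) (auto simp: neg_pow_def)
  define P where "P n = gromov_prod_bb p (x n) \<xi>" for n
  have P: "P n \<ge> 0" for n
    unfolding P_def by (rule gromov_prod_bb_nonneg)
  have "limitin mtopology x \<xi> sequentially \<longleftrightarrow> (\<forall>e>0. \<forall>\<^sub>F n in sequentially. D (x n) \<xi> < e)"
    using \<xi> x by (simp add: limitin_metric)
  also have "\<dots> \<longleftrightarrow> (\<forall>r. \<forall>\<^sub>F n in sequentially. ereal r < P n)"
  proof (intro iffI allI impI)
    fix r :: real
    assume L: "\<forall>e>0. \<forall>\<^sub>F n in sequentially. D (x n) \<xi> < e"
    have "\<forall>\<^sub>F n in sequentially. D (x n) \<xi> < b powr (- r) / C"
      using L b C by simp
    then show "\<forall>\<^sub>F n in sequentially. ereal r < P n"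
    proof (rule eventually_mono)
      fix n assume "D (x n) \<xi> < b powr (- r) / C"
      with lo[of n] have "neg_pow b (P n) / C < b powr (- r) / C"
        by (simp add: P_def)
      then show "ereal r < P n"
        using C pow[OF P] by (simp add: divide_less_cancel)
    qed
  next
    fix e :: real
    assume L: "\<forall>r. \<forall>\<^sub>F n in sequentially. ereal r < P n" and e: "e > 0"
    define r where "r = - log b (e / C)"
    have r: "b powr (- r) = e / C"
      using b e C by (simp add: r_def)
    have "\<forall>\<^sub>F n in sequentially. ereal r < P n"
      using L by blast
    then show "\<forall>\<^sub>F n in sequentially. D (x n) \<xi> < e"
    proof (rule eventually_mono)
      fix n assume "ereal r < P n"
      then have "neg_pow b (P n) < e / C"
        using pow[OF P] r by metis
      then have "C * neg_pow b (P n) < e"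
        using C by (simp add: field_simps)
      with hi[of n] show "D (x n) \<xi> < e"
        by (simp add: P_def)
    qed
  qed
  also have "\<dots> \<longleftrightarrow> P \<longlonglongrightarrow> \<infinity>"
    by (simp add: tendsto_PInfty)
  finally show ?thesis
    by (simp add: P_def[abs_def])
qed

end

theory Submission
  imports Defs
begin

text \<open>
  The upper bound is the usual covering argument: a radial limit point lies in infinitely many
  shadows, and the shadow of \<open>g(o)\<close> has diameter comparable to \<open>b\<close> to the power \<open>- d(o, g(o))\<close>.

  For the lower bound let \<open>s < \<delta>\<close>. Some annulus \<open>{g. n \<le> d(o, g(o)) < n + 1}\<close> contains more than
  \<open>b\<close> to the power \<open>s n\<close> elements. After multiplication on both sides by large powers of two
  independent loxodromic isometries, a fixed proportion of them generates freely a semigroup whose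
  words are uniform quasigeodesics; the endpoints of infinite words are uniformly radial and form a
  Cantor set of dimension almost \<open>s\<close>.

  If the endpoint \<open>\<eta>\<close> of a word \<open>\<omega>\<close> is very close to \<open>g(\<xi>)\<close> relative to \<open>d(o, g(o))\<close>, let \<open>w\<close> be the
  prefix of \<open>\<omega>\<close> at which the paths from \<open>o\<close> to \<open>g(o)\<close> and to \<open>g(\<xi>)\<close> branch, and put \<open>h = w\<^sup>-\<^sup>1 g\<close>.
  Then the inverse of \<open>h\<close> maps \<open>o\<close> near the ray from \<open>o\<close> to \<open>\<xi>\<close>, so that there are boundedly many
  such \<open>h\<close> of each length, independently of \<open>w\<close>, and the continuation of \<open>\<omega>\<close> after \<open>w\<close> follows the
  ray to \<open>h(\<xi>)\<close> for a time exceeding the length of \<open>h\<close> by a large constant. With weights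
  decaying exponentially in the length of \<open>h\<close> and small in the index \<open>k\<close>, the obstacles
  \<open>h(\<xi>\<^sub>k)\<close> have small total weight, and a potential argument shows that in the tree of words at least
  half of the children of each surviving vertex survive when all obstacles are avoided.
\<close>

section \<open>Gromov products and the Gromov boundary\<close>

text \<open>In a space that is neither proper nor geodesic, rays and branch points have to be
  expressed by Gromov products along representing sequences. Such products may oscillate, so
  estimates are phrased with "eventually" and "frequently" and each passage between the two costs a
  multiple of the hyperbolicity constant \<open>C\<close>. The infinite family of obstacles stays
  cheap because boundedly many of them per unit of length already make the sum of weights converge
  for every growth factor above 1 per letter. Hence the Schottky family, and with it the growth
  factor, is fixed without regard to the points \<open>\<xi> k\<close>; an additive offset
  \<open>M k\<close> then scales the total cost down to 1/2. The offset enters only the constant of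
  bad approximability of \<open>\<xi> k\<close> and leaves the dimension alone. Pruning may remove
  half of the children, which is why the families are built with \<open>2 * m\<close> elements where
  \<open>m\<close> already suffices for dimension \<open>s\<close>. Equality of dimensions would not
  exclude an empty set if \<delta> were 0, so a positive exponent of divergence is obtained
  separately from a free semigroup.\<close>

lemma gromov_prod_commute: "gromov_prod z x y = gromov_prod z y x"
  by (simp add: gromov_prod_def dist_commute)

lemma gromov_prod_le: "gromov_prod z x y \<le> dist z x" "gromov_prod z x y \<le> dist z y"
  using dist_triangle[of y z x] dist_triangle[of x z y]
  by (auto simp: gromov_prod_def dist_commute)

text \<open>An exact identity in every metric space, so moving the base point costs no additive
  constant. Estimates are therefore kept at the one point \<open>p\<close>, and products seen from
  an orbit point are rewritten through it.\<close>

lemma gromov_prod_change_base: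
  "gromov_prod z x y = dist p z - gromov_prod p x z - gromov_prod p y z + gromov_prod p x y"
  by (simp add: gromov_prod_def dist_commute field_simps)

lemma dist_gromov_prod: "dist x y = dist p x + dist p y - 2 * gromov_prod p x y"
  by (simp add: gromov_prod_def dist_commute field_simps)

lemma gromov_prod_base_le: "gromov_prod z x y \<le> gromov_prod p x y + dist p z"
  using gromov_prod_nonneg[of p x z] gromov_prod_nonneg[of p y z]
  by (simp add: gromov_prod_change_base[of z x y p])

lemma gromov_prod_base_ge: "gromov_prod z x y \<ge> gromov_prod p x y - dist p z"
  using gromov_prod_le(2)[of p x z] gromov_prod_le(2)[of p y z]
  by (simp add: gromov_prod_change_base[of z x y p])

locale hyperbolic_at =
  fixes p :: "'x::metric_space" and C :: real
  assumes C_nonneg: "C \<ge> 0"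
    and hyp: "gromov_prod p x z \<ge> min (gromov_prod p x y) (gromov_prod p y z) - C"
begin

abbreviation gp where "gp \<equiv> gromov_prod p"

lemma hyp2: "gp x w \<ge> min (gp x y) (min (gp y z) (gp z w)) - 2 * C"
  using hyp[of x y w] hyp[of y z w] C_nonneg by (auto simp: min_def split: if_splits)

lemma gromov_seq_iff: "gromov_seq p x \<longleftrightarrow> (\<forall>T. \<exists>N. \<forall>n\<ge>N. \<forall>m\<ge>N. gp (x n) (x m) \<ge> T)"
  unfolding gromov_seq_def filterlim_at_top
  by (simp add: eventually_prod_sequentially) blast

lemma seq_rel_iff:
  "(x, y) \<in> gromov_seq_rel p \<longleftrightarrow> gromov_seq p x \<and> gromov_seq p y \<and>
     (\<forall>T. \<exists>N. \<forall>n\<ge>N. gp (x n) (y n) \<ge> T)"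
  by (auto simp: gromov_seq_rel_def filterlim_at_top eventually_sequentially)

text \<open>Passing through \<open>x m\<close> frees the two indices: \<open>x n\<close> is near
  \<open>x m\<close> because \<open>x\<close> is a Gromov sequence, and \<open>x m\<close> is near
  \<open>y m\<close> by equivalence.\<close>

lemma seq_rel_double:
  assumes "(x, y) \<in> gromov_seq_rel p"
  shows "\<exists>N. \<forall>n\<ge>N. \<forall>m\<ge>N. gp (x n) (y m) \<ge> T"
proof -
  have x: "gromov_seq p x" and xy: "\<forall>T. \<exists>N. \<forall>n\<ge>N. gp (x n) (y n) \<ge> T"
    using assms by (simp_all add: seq_rel_iff)
  obtain N1 where N1: "\<And>n m. n \<ge> N1 \<Longrightarrow> m \<ge> N1 \<Longrightarrow> gp (x n) (x m) \<ge> T + C"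
    using spec[OF x[unfolded gromov_seq_iff], of "T + C"] by blast
  obtain N2 where N2: "\<And>n. n \<ge> N2 \<Longrightarrow> gp (x n) (y n) \<ge> T + C"
    using spec[OF xy, of "T + C"] by blast
  have "gp (x n) (y m) \<ge> T" if "n \<ge> max N1 N2" "m \<ge> max N1 N2" for n m
    using hyp[of "x n" "x m" "y m"] N1[of n m] N2[of m] that by auto
  then show ?thesis by blast
qed

lemma seq_rel_refl: "gromov_seq p x \<Longrightarrow> (x, x) \<in> gromov_seq_rel p"
  unfolding seq_rel_iff gromov_seq_iff by blast

lemma bdry_class_mem: "gromov_seq p x \<Longrightarrow> x \<in> gromov_seq_rel p `` {x}"
  using seq_rel_refl by blast

lemma bdry_class_in: "gromov_seq p x \<Longrightarrow> gromov_seq_rel p `` {x} \<in> gromov_boundary p"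
  unfolding gromov_boundary_def by (rule quotientI) simp

lemma bdryE:
  assumes "\<xi> \<in> gromov_boundary p"
  obtains x where "gromov_seq p x" "\<xi> = gromov_seq_rel p `` {x}" "x \<in> \<xi>"
  using assms bdry_class_mem unfolding gromov_boundary_def quotient_def by auto

lemma bdry_close:
  assumes "\<xi> \<in> gromov_boundary p" "x \<in> \<xi>" "y \<in> \<xi>"
  shows "\<exists>N. \<forall>n\<ge>N. \<forall>m\<ge>N. gp (x n) (y m) \<ge> T"
proof -
  obtain z where z: "\<xi> = gromov_seq_rel p `` {z}"
    using assms(1) by (rule bdryE)
  obtain N1 where N1: "\<And>n m. n \<ge> N1 \<Longrightarrow> m \<ge> N1 \<Longrightarrow> gp (z n) (x m) \<ge> T + C"
    using seq_rel_double[of z x "T + C"] assms z by auto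
  obtain N2 where N2: "\<And>n m. n \<ge> N2 \<Longrightarrow> m \<ge> N2 \<Longrightarrow> gp (z n) (y m) \<ge> T + C"
    using seq_rel_double[of z y "T + C"] assms z by auto
  have "gp (x n) (y m) \<ge> T" if "n \<ge> max N1 N2" "m \<ge> max N1 N2" for n m
    using hyp[of "x n" "z n" "y m"] N1[of n n] N2[of n m] that
    by (auto simp: gromov_prod_commute[of p "x n"])
  then show ?thesis by blast
qed

text \<open>A single late index \<open>k\<close> suffices: in the chain \<open>u n\<close>,
  \<open>x k\<close>, \<open>y k\<close>, \<open>v m\<close> the outer products are as large as
  desired, so only the middle one counts. A frequent bound for one pair of representatives thus
  controls the infimum over all pairs.\<close>

lemma gromov_prod_bb_ge:
  assumes "\<xi> \<in> gromov_boundary p" "\<eta> \<in> gromov_boundary p" "x \<in> \<xi>" "y \<in> \<eta>"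
    and fr: "\<exists>\<^sub>F k in sequentially. gp (x k) (y k) \<ge> T"
  shows "gromov_prod_bb p \<xi> \<eta> \<ge> ereal (T - 2 * C)"
  unfolding gromov_prod_bb_def
proof (intro INF_greatest Liminf_bounded)
  fix u v assume u: "u \<in> \<xi>" and v: "v \<in> \<eta>"
  obtain N1 where N1: "\<And>n m. n \<ge> N1 \<Longrightarrow> m \<ge> N1 \<Longrightarrow> gp (u n) (x m) \<ge> T"
    using bdry_close[OF assms(1) u assms(3)] by blast
  obtain N2 where N2: "\<And>n m. n \<ge> N2 \<Longrightarrow> m \<ge> N2 \<Longrightarrow> gp (y n) (v m) \<ge> T"
    using bdry_close[OF assms(2) assms(4) v] by blast
  obtain k where k: "k \<ge> max N1 N2" "gp (x k) (y k) \<ge> T"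
    using fr unfolding frequently_sequentially by blast
  have "gp (u n) (v m) \<ge> T - 2 * C" if "n \<ge> max N1 N2" "m \<ge> max N1 N2" for n m
    using hyp2[of "u n" "x k" "y k" "v m"] N1[of n k] N2[of k m] that k by auto
  then show "\<forall>\<^sub>F z in sequentially \<times>\<^sub>F sequentially.
      ereal (T - 2 * C) \<le> (case z of (n, m) \<Rightarrow> ereal (gp (u n) (v m)))"
    unfolding eventually_prod_sequentially case_prod_beta
    by (intro exI[of _ "max N1 N2"]) auto
qed

lemma gromov_prod_bb_gtD:
  assumes "gromov_prod_bb p \<xi> \<eta> > ereal T" "x \<in> \<xi>" "y \<in> \<eta>"
  shows "\<forall>\<^sub>F k in sequentially. gp (x k) (y k) > T"
proof -
  have "gromov_prod_bb p \<xi> \<eta> \<le>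
      Liminf (sequentially \<times>\<^sub>F sequentially) (\<lambda>(n, m). ereal (gp (x n) (y m)))"
    unfolding gromov_prod_bb_def using assms(2,3)
    by (meson INF_lower2 order_refl)
  then have "ereal T < Liminf (sequentially \<times>\<^sub>F sequentially) (\<lambda>(n, m). ereal (gp (x n) (y m)))"
    using assms(1) by order
  from less_LiminfD[OF this]
  have ev: "\<forall>\<^sub>F z in sequentially \<times>\<^sub>F sequentially. T < gp (x (fst z)) (y (snd z))"
    by (simp add: case_prod_beta)
  have "filterlim (\<lambda>n::nat. (n, n)) (sequentially \<times>\<^sub>F sequentially) sequentially"
    by (intro filterlim_Pair filterlim_ident)
  from eventually_compose_filterlim[OF ev this] show ?thesis
    by simp
qed

lemma gromov_prod_pb_ge:
  assumes "\<xi> \<in> gromov_boundary p" "x \<in> \<xi>" "\<exists>\<^sub>F k in sequentially. gp (x k) y \<ge> T"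
  shows "gromov_prod_pb p y \<xi> \<ge> ereal (T - C)"
  unfolding gromov_prod_pb_def
proof (intro INF_greatest Liminf_bounded)
  fix u assume u: "u \<in> \<xi>"
  obtain N1 where N1: "\<And>n m. n \<ge> N1 \<Longrightarrow> m \<ge> N1 \<Longrightarrow> gp (u n) (x m) \<ge> T"
    using bdry_close[OF assms(1) u assms(2)] by blast
  obtain k where k: "k \<ge> N1" "gp (x k) y \<ge> T"
    using assms(3) unfolding frequently_sequentially by blast
  have "gp (u n) y \<ge> T - C" if "n \<ge> N1" for n
    using hyp[of "u n" "x k" y] N1[of n k] that k by auto
  then show "\<forall>\<^sub>F n in sequentially. ereal (T - C) \<le> ereal (gp (u n) y)"
    unfolding eventually_sequentially by auto
qed

end

lemma gromov_prod_pb_leI: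
  assumes "x \<in> \<xi>" "\<forall>\<^sub>F k in sequentially. gromov_prod z (x k) y \<le> T"
  shows "gromov_prod_pb z y \<xi> \<le> ereal T"
  unfolding gromov_prod_pb_def
proof (rule INF_lower2[OF assms(1)])
  have "liminf (\<lambda>n. ereal (gromov_prod z (x n) y)) \<le> limsup (\<lambda>n. ereal (gromov_prod z (x n) y))"
    by (rule Liminf_le_Limsup) simp
  also have "\<dots> \<le> ereal T"
    by (rule Limsup_bounded) (use assms(2) in simp)
  finally show "liminf (\<lambda>n. ereal (gromov_prod z (x n) y)) \<le> ereal T" .
qed

text \<open>The infimum over representatives need not be attained, and a lower limit controls only a
  subsequence; hence the strict gap between \<open>T\<close> and \<open>T'\<close> and the merely
  frequent bound.\<close>

lemma gromov_prod_pb_leD: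
  assumes "gromov_prod_pb z y \<xi> \<le> ereal T" "T < T'"
  obtains x where "x \<in> \<xi>" "\<exists>\<^sub>F k in sequentially. gromov_prod z (x k) y < T'"
proof -
  have "gromov_prod_pb z y \<xi> < ereal T'"
    using assms by (meson ereal_less(3) less_ereal.simps(1) order_le_less_trans)
  then obtain x where x: "x \<in> \<xi>" "liminf (\<lambda>n. ereal (gromov_prod z (x n) y)) < ereal T'"
    unfolding gromov_prod_pb_def by (auto simp: INF_less_iff)
  have "\<exists>\<^sub>F k in sequentially. gromov_prod z (x k) y < T'"
  proof (rule ccontr)
    assume "\<not> (\<exists>\<^sub>F k in sequentially. gromov_prod z (x k) y < T')"
    then have "\<forall>\<^sub>F k in sequentially. ereal T' \<le> ereal (gromov_prod z (x k) y)"
      by (simp add: frequently_def not_less)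
    from Liminf_bounded[OF this] x show False by simp
  qed
  with x that show ?thesis by blast
qed

lemma gromov_prod_pb_le_dist:
  assumes "\<xi> \<noteq> {}" shows "gromov_prod_pb z y \<xi> \<le> ereal (dist z y)"
proof -
  obtain x where "x \<in> \<xi>" using assms by blast
  then show ?thesis
    by (rule gromov_prod_pb_leI) (simp add: gromov_prod_le)
qed

section \<open>Hausdorff dimension\<close>

lemma hausdorff_dim_nonneg: "hausdorff_dim M D A \<ge> 0"
  unfolding hausdorff_dim_def by (rule Inf_greatest) auto

lemma hausdorff_dim_le:
  assumes "s \<ge> 0" "hausdorff_measure M D s A = 0"
  shows "hausdorff_dim M D A \<le> ereal s"
  unfolding hausdorff_dim_def by (rule Inf_lower) (use assms in auto)

lemma hausdorff_pre_mono:
  assumes "A \<subseteq> B" shows "hausdorff_pre M D s r A \<le> hausdorff_pre M D s r B"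
  unfolding hausdorff_pre_def
  by (rule Inf_superset_mono, rule subsetI, elim CollectE exE, rule CollectI, rule exI,
      elim conjE, intro conjI) (assumption | erule order_trans[OF assms])+

lemma hausdorff_dim_mono:
  assumes "A \<subseteq> B" shows "hausdorff_dim M D A \<le> hausdorff_dim M D B"
proof -
  have "hausdorff_measure M D s A \<le> hausdorff_measure M D s B" for s
    unfolding hausdorff_measure_def by (rule SUP_mono) (use hausdorff_pre_mono[OF assms] in blast)
  then show ?thesis
    unfolding hausdorff_dim_def
    by (intro Inf_superset_mono) (auto, metis le_zero_eq)
qed

lemma hausdorff_pre_less_iff:
  "hausdorff_pre M D s r A < e \<longleftrightarrow> (\<exists>U :: nat \<Rightarrow> 'a set.
        (\<forall>i. U i \<subseteq> M \<and> (\<forall>x\<in>U i. \<forall>y\<in>U i. D x y \<le> r)) \<and> A \<subseteq> (\<Union>i. U i) \<and>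
        (\<Sum>i. diam_pow D s (U i)) < e)" (is "?l \<longleftrightarrow> (\<exists>U. ?P U \<and> ?Q U \<and> ?S U < e)")
proof
  assume ?l
  then obtain c where "c \<in> {?S U | U. ?P U \<and> ?Q U}" "c < e"
    unfolding hausdorff_pre_def Inf_less_iff by (elim bexE)
  then obtain U where U: "c = ?S U" "?P U" "?Q U"
    by (elim CollectE exE conjE)
  have "?S U < e" using \<open>c < e\<close> unfolding U(1) .
  then show "\<exists>U. ?P U \<and> ?Q U \<and> ?S U < e"
    by (intro exI[of _ U] conjI U(2,3))
next
  assume "\<exists>U. ?P U \<and> ?Q U \<and> ?S U < e"
  then obtain U where U: "?P U" "?Q U" "?S U < e" by (elim exE conjE)
  have "Inf {?S U | U. ?P U \<and> ?Q U} \<le> ?S U"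
    by (rule Inf_lower, rule CollectI, rule exI[of _ U]) (intro conjI refl U)
  with U(3) show ?l unfolding hausdorff_pre_def by (rule order_le_less_trans[rotated])
qed

lemma hausdorff_measure_eq_0_iff:
  "hausdorff_measure M D s A = 0 \<longleftrightarrow>
     (\<forall>r>0. \<forall>e>0. \<exists>U :: nat \<Rightarrow> 'a set.
        (\<forall>i. U i \<subseteq> M \<and> (\<forall>x\<in>U i. \<forall>y\<in>U i. D x y \<le> r)) \<and> A \<subseteq> (\<Union>i. U i) \<and>
        (\<Sum>i. diam_pow D s (U i)) < e)"
proof -
  have "hausdorff_measure M D s A = 0 \<longleftrightarrow> hausdorff_measure M D s A \<le> 0"
    by simp
  also have "\<dots> \<longleftrightarrow> (\<forall>r>0. hausdorff_pre M D s r A \<le> 0)"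
    unfolding hausdorff_measure_def SUP_le_iff by (simp add: Ball_def)
  also have "\<dots> \<longleftrightarrow> (\<forall>r>0. \<forall>e>0. hausdorff_pre M D s r A < e)"
    by (metis less_irrefl not_gr_zero le_zero_eq)
  finally show ?thesis
    unfolding hausdorff_pre_less_iff .
qed

lemma hausdorff_measure_UN_eq_0:
  fixes A :: "nat \<Rightarrow> 'a set"
  assumes "\<And>k. hausdorff_measure M D s (A k) = 0"
  shows "hausdorff_measure M D s (\<Union>k. A k) = 0"
  unfolding hausdorff_measure_eq_0_iff
proof (intro allI impI)
  fix r :: real and e :: ennreal
  assume r: "r > 0" and e: "e > 0"
  \<comment> \<open>The countably many covers together are only known to cost at most their joint
    budget, so this budget is taken strictly below \<open>e\<close>.\<close>
  obtain e' :: ennreal where e': "e' > 0" "e' < e" using dense[OF e] by blast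
  have pos: "e' * ennreal ((1/2) ^ Suc k) > 0" for k
    using e' by (simp add: ennreal_zero_less_mult_iff)
  have "\<exists>U :: nat \<Rightarrow> 'a set.
        (\<forall>i. U i \<subseteq> M \<and> (\<forall>x\<in>U i. \<forall>y\<in>U i. D x y \<le> r)) \<and> A k \<subseteq> (\<Union>i. U i) \<and>
        (\<Sum>i. diam_pow D s (U i)) < e' * ennreal ((1/2) ^ Suc k)" for k
    using assms[of k] r pos[of k] unfolding hausdorff_measure_eq_0_iff by blast
  then obtain U :: "nat \<Rightarrow> nat \<Rightarrow> 'a set" where
    U1: "\<And>k i. U k i \<subseteq> M" and U2: "\<And>k i x y. x \<in> U k i \<Longrightarrow> y \<in> U k i \<Longrightarrow> D x y \<le> r"
    and U3: "\<And>k. A k \<subseteq> (\<Union>i. U k i)"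
    and U4: "\<And>k. (\<Sum>i. diam_pow D s (U k i)) < e' * ennreal ((1/2) ^ Suc k)"
    by metis
  define V where "V n = U (fst (prod_decode n)) (snd (prod_decode n))" for n
  have "(\<Sum>n. diam_pow D s (V n)) = (\<Sum>k. \<Sum>i. diam_pow D s (U k i))"
    using suminf_ennreal_2dimen[of "\<lambda>k. \<Sum>i. diam_pow D s (U k i)"
        "\<lambda>z. diam_pow D s (U (fst z) (snd z))"]
    by (simp add: V_def)
  also have "\<dots> \<le> (\<Sum>k. e' * ennreal ((1/2) ^ Suc k))"
    using U4 by (intro suminf_le) (auto intro: less_imp_le)
  also have "\<dots> = e'"
    unfolding ennreal_suminf_cmult
    by (subst suminf_ennreal_eq[OF zero_le_power power_half_series]) auto
  finally have sum: "(\<Sum>n. diam_pow D s (V n)) < e"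
    using e' by simp
  have "x \<in> (\<Union>n. V n)" if x: "x \<in> A k" for x k
  proof -
    obtain i where "x \<in> U k i" using subsetD[OF U3 x] by blast
    then have "x \<in> V (prod_encode (k, i))" by (simp add: V_def)
    then show ?thesis by blast
  qed
  then show "\<exists>U :: nat \<Rightarrow> 'a set.
        (\<forall>i. U i \<subseteq> M \<and> (\<forall>x\<in>U i. \<forall>y\<in>U i. D x y \<le> r)) \<and> (\<Union>k. A k) \<subseteq> (\<Union>i. U i) \<and>
        (\<Sum>i. diam_pow D s (U i)) < e"
    using U1 U2 sum by (intro exI[of _ V]) (auto simp: V_def)
qed

text \<open>For \<open>s = 0\<close> the bound fails at \<open>d = 0\<close>: a nonempty set then
  has \<open>diam_pow\<close> equal to 1, while \<open>0 powr 0\<close> is 0.\<close>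

lemma diam_pow_le:
  assumes "s > 0" "d \<ge> 0" "\<And>x y. x \<in> U \<Longrightarrow> y \<in> U \<Longrightarrow> 0 \<le> D x y \<and> D x y \<le> d"
  shows "diam_pow D s U \<le> ennreal (d powr s)"
proof (cases "U = {}")
  case False
  then obtain z where z: "z \<in> U" by blast
  have "(SUP (x, y)\<in>U \<times> U. D x y) \<le> d"
    using assms False by (intro cSUP_least) auto
  moreover have "0 \<le> (SUP (x, y)\<in>U \<times> U. D x y)"
  proof -
    have "bdd_above ((\<lambda>(x, y). D x y) ` (U \<times> U))"
      using assms(3) by (intro bdd_aboveI[of _ d]) auto
    from cSUP_upper[OF _ this, of "(z, z)"] z assms(3)[OF z z] show ?thesis by auto
  qed
  ultimately show ?thesis
    using assms False by (auto simp: diam_pow_def intro!: ennreal_leI powr_mono2)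
qed (simp add: diam_pow_def)

text \<open>The convergence half of Borel-Cantelli: every tail of \<open>V\<close> still covers
  \<open>A\<close>, and tails of the series are small. Summability also sends \<open>d i\<close> to
  0, so that a late tail respects the mesh \<open>r\<close>.\<close>

lemma hausdorff_measure_limsup_eq_0:
  fixes V :: "nat \<Rightarrow> 'a set"
  assumes D: "\<And>x y. D x y \<ge> 0" and V: "\<And>i. V i \<subseteq> M" and s: "s > 0"
    and d: "\<And>i x y. x \<in> V i \<Longrightarrow> y \<in> V i \<Longrightarrow> D x y \<le> d i" and d0: "\<And>i. d i \<ge> 0"
    and summ: "summable (\<lambda>i. d i powr s)"
    and A: "\<And>x. x \<in> A \<Longrightarrow> infinite {i. x \<in> V i}"
  shows "hausdorff_measure M D s A = 0"
  unfolding hausdorff_measure_eq_0_iff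
proof (intro allI impI)
  fix r :: real and e :: ennreal
  assume r: "r > 0" and e: "e > 0"
  obtain e' where e': "e' > 0" "ennreal e' < e"
  proof -
    obtain e1 where e1: "0 < e1" "e1 < e" using dense[OF e] by blast
    moreover have "e1 < \<infinity>" using e1(2) by (rule order_less_le_trans) simp
    ultimately have "e1 = ennreal (enn2real e1)" "enn2real e1 > 0"
      by (auto simp: enn2real_positive_iff)
    then show ?thesis using e1 that by metis
  qed
  have "\<forall>\<^sub>F i in sequentially. d i powr s < r powr s"
    using summable_LIMSEQ_zero[OF summ] r by (intro order_tendstoD) auto
  then obtain N1 where N1: "\<And>i. i \<ge> N1 \<Longrightarrow> d i powr s < r powr s"
    unfolding eventually_sequentially by blast
  obtain N2 where N2: "\<And>n. n \<ge> N2 \<Longrightarrow> norm (\<Sum>i. d (i + n) powr s) < e'"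
    using suminf_exist_split[OF e'(1) summ] by blast
  define N where "N = max N1 N2"
  define U where "U i = V (i + N)" for i
  have le: "d (i + N) \<le> r" for i
  proof (rule ccontr)
    assume "\<not> d (i + N) \<le> r"
    then have "r powr s \<le> d (i + N) powr s" using r s by (intro powr_mono2) auto
    moreover have "d (i + N) powr s < r powr s" by (rule N1) (simp add: N_def)
    ultimately show False by simp
  qed
  have "(\<Sum>i. diam_pow D s (U i)) \<le> (\<Sum>i. ennreal (d (i + N) powr s))"
    using D d d0 s by (intro suminf_le diam_pow_le) (auto simp: U_def)
  also have "\<dots> = ennreal (\<Sum>i. d (i + N) powr s)"
    by (intro suminf_ennreal2 summable_ignore_initial_segment summ) auto
  also have "\<dots> \<le> ennreal e'"
    using N2[of N] by (intro ennreal_leI) (auto simp: N_def)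
  finally have sum: "(\<Sum>i. diam_pow D s (U i)) < e"
    using e' by simp
  have "x \<in> (\<Union>i. U i)" if x: "x \<in> A" for x
  proof -
    obtain i where i: "i \<ge> N" "x \<in> V i"
      using A[OF x] unfolding infinite_nat_iff_unbounded_le by blast
    then have "x \<in> U (i - N)" by (simp add: U_def)
    then show ?thesis by blast
  qed
  moreover have "D x y \<le> r" if "x \<in> U i" "y \<in> U i" for x y i
    using d[of x "i + N" y] le[of i] that by (auto simp: U_def)
  ultimately show "\<exists>U :: nat \<Rightarrow> 'a set.
        (\<forall>i. U i \<subseteq> M \<and> (\<forall>x\<in>U i. \<forall>y\<in>U i. D x y \<le> r)) \<and> A \<subseteq> (\<Union>i. U i) \<and>
        (\<Sum>i. diam_pow D s (U i)) < e"
    using V sum by (intro exI[of _ U]) (auto simp: U_def)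
qed

text \<open>Distances at most 1 have larger powers for smaller exponents. This lets one Hoelder
  estimate with exponent \<open>s\<close> refute covers that are cheap in a smaller dimension
  \<open>t\<close>.\<close>

lemma diam_pow_ge:
  assumes D: "\<And>x y. D x y \<ge> 0" and t: "0 \<le> t" "t \<le> s"
    and U: "\<And>x y. x \<in> U \<Longrightarrow> y \<in> U \<Longrightarrow> D x y \<le> 1" and xy: "x \<in> U" "y \<in> U"
  shows "ennreal (D x y powr s) \<le> diam_pow D t U"
proof -
  have le: "D x y powr s \<le> D x y powr t"
  proof (cases "D x y = 0")
    case False
    then show ?thesis
      using t U[OF xy] D[of x y] by (intro powr_mono') auto
  qed simp
  have bdd: "bdd_above ((\<lambda>(x, y). D x y) ` (U \<times> U))"
    using U by (intro bdd_aboveI[of _ 1]) auto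
  have "D x y \<le> (SUP (x, y)\<in>U \<times> U. D x y)"
    using cSUP_upper[OF _ bdd, of "(x, y)"] xy by auto
  then have *: "D x y powr t \<le> (SUP (x, y)\<in>U \<times> U. D x y) powr t"
    using D t by (intro powr_mono2)
  show ?thesis
  proof (cases "t = 0")
    case True
    have "D x y powr s \<le> 1" using le True by (auto simp: powr_def split: if_splits)
    then show ?thesis using xy True by (auto simp: diam_pow_def ennreal_le_1)
  next
    case False
    then show ?thesis using le * xy by (auto simp: diam_pow_def intro!: ennreal_leI)
  qed
qed

lemma diam_pow_finite: "diam_pow D t U < \<infinity>"
  by (simp add: diam_pow_def)

text \<open>A parametrization by the unit interval with Hoelder continuous inverse carries Lebesgue
  measure to a set, which replaces the mass distribution principle.\<close>

lemma hausdorff_dim_ge: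
  fixes f :: "real \<Rightarrow> 'a"
  assumes D: "\<And>x y. D x y \<ge> 0" and s: "s > 0" and K: "K > 0"
    and f: "\<And>x. x \<in> {0..<1} \<Longrightarrow> f x \<in> A"
    and hoelder: "\<And>x y. x \<in> {0..<1} \<Longrightarrow> y \<in> {0..<1} \<Longrightarrow> \<bar>x - y\<bar> \<le> K * D (f x) (f y) powr s"
  shows "hausdorff_dim M D A \<ge> ereal s"
  unfolding hausdorff_dim_def
proof (rule Inf_greatest, clarify)
  fix t :: real
  assume t: "t \<ge> 0" and null: "hausdorff_measure M D t A = 0"
  show "ereal s \<le> ereal t"
  proof (rule ccontr)
    assume "\<not> ereal s \<le> ereal t"
    then have ts: "t \<le> s" by simp
    \<comment> \<open>With a total cost below this number the intervals \<open>J i\<close> have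
      total length below 1, although they cover the unit interval.\<close>
    have "ennreal (1 / (2 * K)) > 0" using K by simp
    then obtain U :: "nat \<Rightarrow> 'a set" where
      U1: "\<And>i x y. x \<in> U i \<Longrightarrow> y \<in> U i \<Longrightarrow> D x y \<le> 1" and U2: "A \<subseteq> (\<Union>i. U i)"
      and U3: "(\<Sum>i. diam_pow D t (U i)) < ennreal (1 / (2 * K))"
      using null unfolding hausdorff_measure_eq_0_iff by (metis zero_less_one)
    define V where "V i = {x\<in>{0..<1}. f x \<in> U i}" for i
    define c where "c i = enn2real (diam_pow D t (U i))" for i
    have c: "diam_pow D t (U i) = ennreal (c i)" for i
      using diam_pow_finite[of D t "U i"] by (simp add: c_def)
    \<comment> \<open>The set \<open>V i\<close> may fail to be measurable, so it is enclosed in an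
      interval around one of its own points; the Hoelder bound provides the radius. An empty
      \<open>V i\<close> has no such centre and gets the empty set.\<close>
    define J where "J i = (if V i = {} then {} else
        {(SOME x. x \<in> V i) - K * c i .. (SOME x. x \<in> V i) + K * c i})" for i
    have VJ: "V i \<subseteq> J i" for i
    proof
      fix x assume x: "x \<in> V i"
      define z where "z = (SOME x. x \<in> V i)"
      have z: "z \<in> V i" unfolding z_def using x by (rule someI)
      have "ennreal (D (f x) (f z) powr s) \<le> ennreal (c i)"
        unfolding c[symmetric] using x z D t ts U1 by (intro diam_pow_ge) (auto simp: V_def)
      then have "D (f x) (f z) powr s \<le> c i"
        by (simp add: c_def)
      then have "\<bar>x - z\<bar> \<le> K * c i"
        using hoelder[of x z] x z K by (auto simp: V_def intro: order_trans mult_left_mono)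
      then show "x \<in> J i" using x by (auto simp: J_def z_def[symmetric])
    qed
    have "x \<in> (\<Union>i. V i)" if "x \<in> {0..<1}" for x
      using f[OF that] U2 that unfolding V_def by blast
    then have "{0..<1} \<subseteq> (\<Union>i. V i)" by blast
    also have "\<dots> \<subseteq> (\<Union>i. J i)" using VJ by blast
    finally have "emeasure lborel {0..<1::real} \<le> emeasure lborel (\<Union>i. J i)"
      by (rule emeasure_mono) (auto simp: J_def)
    also have "\<dots> \<le> (\<Sum>i. emeasure lborel (J i))"
      by (rule emeasure_subadditive_countably) (auto simp: J_def)
    also have "\<dots> \<le> (\<Sum>i. ennreal (2 * K) * diam_pow D t (U i))"
    proof (rule suminf_le)
      fix i
      have "emeasure lborel (J i) \<le> ennreal (2 * K * c i)"
        using K by (auto simp: J_def c_def)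
      also have "\<dots> = ennreal (2 * K) * diam_pow D t (U i)"
        using K unfolding c by (intro ennreal_mult) (auto simp: c_def)
      finally show "emeasure lborel (J i) \<le> ennreal (2 * K) * diam_pow D t (U i)" .
    qed auto
    also have "\<dots> = ennreal (2 * K) * (\<Sum>i. diam_pow D t (U i))"
      by (rule ennreal_suminf_cmult)
    also have "\<dots> < ennreal (2 * K) * ennreal (1 / (2 * K))"
      using U3 K by (intro ennreal_mult_strict_left_mono) auto
    also have "\<dots> = 1"
      using K by (simp flip: ennreal_mult)
    finally show False by simp
  qed
qed

section \<open>Words in a Schottky family\<close>

locale isometric_action = hyperbolic_at p C
  for p :: "'x::metric_space" and C +
  fixes G :: "('x \<Rightarrow> 'x) set"
  assumes subgroup: "subgroup G isom_group"
begin

abbreviation len :: "('x \<Rightarrow> 'x) \<Rightarrow> real" where "len g \<equiv> dist p (g p)"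
abbreviation ginv :: "('x \<Rightarrow> 'x) \<Rightarrow> 'x \<Rightarrow> 'x" where "ginv \<equiv> inv_into UNIV"

lemma G_bij: "g \<in> G \<Longrightarrow> bij g"
  and G_dist: "g \<in> G \<Longrightarrow> dist (g x) (g y) = dist x y"
  using subgroup.subset[OF subgroup] by (auto simp: isom_group_def)

lemma G_id: "id \<in> G"
  using subgroup.one_closed[OF subgroup] by (simp add: isom_group_def)

lemma G_comp: "g \<in> G \<Longrightarrow> h \<in> G \<Longrightarrow> g \<circ> h \<in> G"
  using subgroup.m_closed[OF subgroup] by (simp add: isom_group_def)

lemma ginv_ginv: "g \<in> G \<Longrightarrow> ginv (ginv g) = g"
  by (simp add: G_bij inv_inv_eq)

lemma ginv_left [simp]: "g \<in> G \<Longrightarrow> ginv g (g x) = x"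
  by (simp add: G_bij bij_is_inj)

lemma ginv_right [simp]: "g \<in> G \<Longrightarrow> g (ginv g x) = x"
  by (simp add: G_bij bij_is_surj surj_f_inv_f)

lemma isom_inv_eq:
  assumes "g \<in> carrier isom_group" shows "inv\<^bsub>isom_group\<^esub> g = ginv g"
proof (rule group.inv_equality[OF group_isom_group])
  have b: "bij g" and d: "\<And>x y. dist (g x) (g y) = dist x y"
    using assms by (auto simp: isom_group_def)
  show "ginv g \<otimes>\<^bsub>isom_group\<^esub> g = \<one>\<^bsub>isom_group\<^esub>"
    using b by (simp add: isom_group_def bij_is_inj)
  have "dist (ginv g x) (ginv g y) = dist x y" for x y
    using d[of "ginv g x" "ginv g y"] b by (simp add: bij_is_surj surj_f_inv_f)
  then show "ginv g \<in> carrier isom_group"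
    using b by (simp add: isom_group_def bij_imp_bij_inv)
qed (use assms in simp)

lemma G_inv: "g \<in> G \<Longrightarrow> ginv g \<in> G"
  using subgroup.m_inv_closed[OF subgroup] subgroup.subset[OF subgroup] isom_inv_eq
  by (metis subsetD)

lemma ginv_comp: "g \<in> G \<Longrightarrow> h \<in> G \<Longrightarrow> ginv (g \<circ> h) = ginv h \<circ> ginv g"
  by (simp add: G_bij o_inv_distrib)

lemma G_dist_swap: "g \<in> G \<Longrightarrow> dist (g x) y = dist x (ginv g y)"
  using G_dist[of g x "ginv g y"] by simp

lemma len_ginv: "g \<in> G \<Longrightarrow> len (ginv g) = len g"
  using G_dist_swap[of g p p] by (simp add: dist_commute)

lemma len_comp_le: "g \<in> G \<Longrightarrow> len (g \<circ> h) \<le> len g + len h"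
  using dist_triangle[of p "g (h p)" "g p"] G_dist[of g p "h p"] by simp

lemma gp_isom: "g \<in> G \<Longrightarrow> gp (g x) (g y) = gromov_prod (ginv g p) x y"
  by (simp add: gromov_prod_def G_dist_swap[of g _ p] G_dist)

lemma gp_isom_inv: "g \<in> G \<Longrightarrow> gp (ginv g x) (ginv g y) = gromov_prod (g p) x y"
  using gp_isom[of "ginv g" x y] G_inv ginv_ginv by simp

text \<open>The route to \<open>g y\<close> follows the route to \<open>g p\<close> except for the
  cancellation between \<open>g\<close> and \<open>y\<close>, which is the overlap of
  \<open>ginv g p\<close> with \<open>y\<close>. The no-cancellation arguments for words rest on
  this identity.\<close>

lemma gp_prefix: "g \<in> G \<Longrightarrow> gp (g p) (g y) = len g - gp (ginv g p) y"
  by (simp add: gp_isom gromov_prod_change_base[of "ginv g p" p y p] len_ginv)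
     (simp add: gromov_prod_def dist_commute)

lemma gp_prefix_inv: "g \<in> G \<Longrightarrow> gp (ginv g p) (ginv g y) = len g - gp (g p) y"
  using gp_prefix[of "ginv g" y] by (simp add: G_inv ginv_ginv len_ginv)

lemma gp_base_self [simp]: "gp p y = 0" "gp y p = 0"
  by (simp_all add: gromov_prod_def dist_commute)

lemma finite_len_le:
  assumes "strongly_discrete p G" shows "finite {g\<in>G. len g \<le> r}"
proof (rule finite_subset)
  have "max r 1 > 0" by simp
  then show "finite {g\<in>G. len g \<le> max r 1}"
    using assms unfolding strongly_discrete_def by blast
qed auto

section \<open>Products of finite words and prefixes of infinite words\<close>

definition wd :: "('x \<Rightarrow> 'x) list \<Rightarrow> 'x \<Rightarrow> 'x" where "wd w = foldr (\<circ>) w id"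

lemma wd_simps [simp]: "wd [] = id" "wd (a # w) = a \<circ> wd w"
  by (simp_all add: wd_def)

lemma wd_append: "wd (v @ w) = wd v \<circ> wd w"
  by (induction v) auto

lemma wd_in_G: "set w \<subseteq> G \<Longrightarrow> wd w \<in> G"
  by (induction w) (auto simp: G_id G_comp)

definition pre :: "(nat \<Rightarrow> 'x \<Rightarrow> 'x) \<Rightarrow> nat \<Rightarrow> ('x \<Rightarrow> 'x) list" where
  "pre \<omega> j = map \<omega> [0..<j]"

lemma pre_Suc: "pre \<omega> (Suc j) = pre \<omega> j @ [\<omega> j]"
  by (simp add: pre_def)

lemma pre_split: "i \<le> j \<Longrightarrow> pre \<omega> j = pre \<omega> i @ map \<omega> [i..<j]"
  using upt_add_eq_append[of 0 i "j - i"] by (simp add: pre_def flip: map_append)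

end

text \<open>Letters generate a semigroup, so overlap is restricted only between inverses of letters
  and letters. The length bound exceeds twice the overlap \<open>K2\<close> of two words by
  \<open>C + 1\<close>. The separation \<open>8 * K + 20 * C\<close> equals
  \<open>8 * K2 + 4 * C\<close>, the total error in comparing two letters through a sequence that
  follows both.\<close>

locale schottky = isometric_action p C G
  for p :: "'x::metric_space" and C G +
  fixes S :: "('x \<Rightarrow> 'x) set" and K Lm :: real
  assumes S_sub: "S \<subseteq> G" and K_nonneg: "K \<ge> 0"
    and gp_S: "a \<in> S \<Longrightarrow> b \<in> S \<Longrightarrow> gp (ginv a p) (b p) \<le> K"
    and len_S: "a \<in> S \<Longrightarrow> len a \<ge> 2 * K + 5 * C + 1"
    and len_S_le: "a \<in> S \<Longrightarrow> len a \<le> Lm"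
    and apart: "a \<in> S \<Longrightarrow> b \<in> S \<Longrightarrow> a \<noteq> b \<Longrightarrow>
      dist (a p) (b p) > \<bar>len a - len b\<bar> + 8 * K + 20 * C"
begin

lemma word_G: "set w \<subseteq> S \<Longrightarrow> wd w \<in> G"
  using S_sub wd_in_G by blast

text \<open>The inverse of a word starts with the inverse of its last letter, hence the induction
  from the right. Letters are so long that the inverse word agrees with \<open>ginv a p\<close>
  beyond \<open>K + C\<close>; so the bound \<open>K\<close> for letters is weakened by
  \<open>C\<close> once and not at every step.\<close>

lemma gp_word_letter:
  assumes "set w \<subseteq> S" "s \<in> S"
  shows "gp (ginv (wd w) p) (s p) \<le> K + C"
  using assms
proof (induction w arbitrary: s rule: rev_induct)
  case Nil
  then show ?case using K_nonneg C_nonneg by simp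
next
  case (snoc a w)
  then have aG: "a \<in> G" and a: "a \<in> S" and wG: "wd w \<in> G" using S_sub word_G by auto
  let ?y = "ginv (wd w) p"
  have e: "ginv (wd (w @ [a])) p = ginv a ?y"
    using aG wG by (simp add: wd_append ginv_comp)
  have "gp (ginv a p) (ginv a ?y) = len a - gp (a p) ?y"
    by (rule gp_prefix_inv[OF aG])
  moreover have "gp ?y (a p) \<le> K + C" using snoc a by simp
  ultimately have "gp (ginv a ?y) (ginv a p) > K + C"
    using len_S[OF a] C_nonneg K_nonneg
    by (simp add: gromov_prod_commute[of p "ginv a p"] gromov_prod_commute[of p "a p"])
  moreover have "gp (ginv a p) (s p) \<le> K" using gp_S a snoc by blast
  moreover note hyp[of "ginv a p" "ginv a ?y" "s p"]
  ultimately show ?case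
    unfolding e by (simp add: gromov_prod_commute[of p "ginv a ?y"] min_def split: if_splits)
qed

lemma gp_letter_word:
  assumes "set v \<subseteq> S" "s \<in> S"
  shows "gp (ginv s p) (wd v p) \<le> K + C"
  using assms
proof (induction v arbitrary: s)
  case Nil
  then show ?case using K_nonneg C_nonneg by simp
next
  case (Cons a v)
  then have a: "a \<in> S" and aG: "a \<in> G" using S_sub by auto
  have "gp (a p) (a (wd v p)) = len a - gp (ginv a p) (wd v p)"
    by (rule gp_prefix[OF aG])
  moreover have "gp (ginv a p) (wd v p) \<le> K + C" using Cons a by simp
  ultimately have "gp (wd (a # v) p) (a p) > K + C"
    using len_S[OF a] C_nonneg K_nonneg by (simp add: gromov_prod_commute[of p "a p"])
  moreover have "gp (ginv s p) (a p) \<le> K" using gp_S a Cons by blast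
  moreover note hyp[of "ginv s p" "wd (a # v) p" "a p"]
  ultimately show ?case
    by (simp add: min_def split: if_splits)
qed

definition "K2 = K + 2 * C"

lemma K2_nonneg: "K2 \<ge> 0"
  using K_nonneg C_nonneg by (simp add: K2_def)

lemma gp_words:
  assumes "set w \<subseteq> S" "set v \<subseteq> S"
  shows "gp (ginv (wd w) p) (wd v p) \<le> K2"
proof (cases v)
  case Nil
  then show ?thesis using K2_nonneg by simp
next
  case (Cons s v')
  then have s: "s \<in> S" and sG: "s \<in> G" and v': "set v' \<subseteq> S" using assms S_sub by auto
  have "gp (s p) (wd v p) = len s - gp (ginv s p) (wd v' p)"
    using gp_prefix[OF sG, of "wd v' p"] Cons by simp
  moreover have "gp (ginv s p) (wd v' p) \<le> K + C" using gp_letter_word v' s by blast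
  ultimately have "gp (wd v p) (s p) > K + 2 * C"
    using len_S[OF s] C_nonneg K_nonneg by (simp add: gromov_prod_commute[of p "s p"])
  moreover have "gp (ginv (wd w) p) (s p) \<le> K + C" using gp_word_letter assms s by blast
  moreover note hyp[of "ginv (wd w) p" "wd v p" "s p"]
  ultimately show ?thesis
    by (simp add: K2_def min_def split: if_splits)
qed

lemma len_append:
  assumes "set w \<subseteq> S" "set v \<subseteq> S"
  shows "len (wd (w @ v)) \<ge> len (wd w) + len (wd v) - 2 * K2"
    and "len (wd (w @ v)) \<le> len (wd w) + len (wd v)"
proof -
  have wG: "wd w \<in> G" using assms word_G by blast
  have "len (wd (w @ v)) = dist (wd v p) (ginv (wd w) p)"
    using G_dist_swap[OF wG, of "wd v p" p] by (simp add: wd_append dist_commute)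
  also have "\<dots> = len (wd v) + len (wd w) - 2 * gp (ginv (wd w) p) (wd v p)"
    using wG by (subst dist_gromov_prod[of _ _ p]) (simp add: len_ginv gromov_prod_commute)
  finally show "len (wd (w @ v)) \<ge> len (wd w) + len (wd v) - 2 * K2"
    "len (wd (w @ v)) \<le> len (wd w) + len (wd v)"
    using gp_words[OF assms] gromov_prod_nonneg[of p "ginv (wd w) p" "wd v p"] by auto
qed

text \<open>The gain \<open>C\<close> pays for one use of hyperbolicity when a hit is passed to a
  shorter prefix; the gain 1 makes lengths tend to infinity even for \<open>C = 0\<close>.\<close>

lemma len_snoc:
  assumes "set w \<subseteq> S" "s \<in> S"
  shows "len (wd (w @ [s])) \<ge> len (wd w) + (C + 1)"
  using len_append[OF assms(1), of "[s]"] len_S[OF assms(2)] assms(2)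
  by (simp add: K2_def)

lemma len_append_ge:
  assumes "set w \<subseteq> S" "set v \<subseteq> S"
  shows "len (wd (w @ v)) \<ge> len (wd w) + (C + 1) * length v"
  using assms(2)
proof (induction v rule: rev_induct)
  case (snoc s v)
  then show ?case using len_snoc[of "w @ v" s] assms(1) by (simp add: algebra_simps)
qed simp

lemma len_word_le:
  assumes "set w \<subseteq> S" shows "len (wd w) \<le> length w * Lm"
  using assms
proof (induction w)
  case (Cons a w)
  then show ?case
    using len_append(2)[of "[a]" w] len_S_le[of a] by (simp add: algebra_simps)
qed simp

lemma gp_word_append:
  assumes "set w \<subseteq> S" "set v \<subseteq> S"
  shows "gp (wd w p) (wd (w @ v) p) \<ge> len (wd w) - K2"
  using gp_prefix[of "wd w" "wd v p"] word_G[of w] gp_words[OF assms] assms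
  by (simp add: wd_append)

text \<open>The sequence \<open>y\<close> follows the word \<open>v\<close> to its end. The
  tolerance is the error made in \<open>close_approach\<close>: \<open>2 * K2\<close> from the
  additivity of lengths and \<open>K2 + C\<close> from following the infinite path.\<close>

definition hit :: "(nat \<Rightarrow> 'x) \<Rightarrow> ('x \<Rightarrow> 'x) list \<Rightarrow> bool" where
  "hit y v \<longleftrightarrow> (\<forall>\<^sub>F n in sequentially. gp (y n) (wd v p) \<ge> len (wd v) - 3 * K2 - C)"

text \<open>Dropping a letter costs \<open>C\<close> through hyperbolicity but shortens the word by
  at least \<open>C + 1\<close>, so the tolerance does not grow with the number of letters
  dropped.\<close>

lemma hit_prefix:
  assumes "hit y (v @ u)" "set v \<subseteq> S" "set u \<subseteq> S"
  shows "hit y v"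
  using assms(1,3)
proof (induction u rule: rev_induct)
  case (snoc s u)
  let ?v = "v @ u"
  have v: "set ?v \<subseteq> S" and s: "s \<in> S" using snoc assms by auto
  have "hit y ?v"
    unfolding hit_def
  proof (rule eventually_mono)
    show "\<forall>\<^sub>F n in sequentially. gp (y n) (wd (?v @ [s]) p) \<ge> len (wd (?v @ [s])) - 3 * K2 - C"
      using snoc(2) by (simp add: hit_def)
  next
    fix n assume *: "gp (y n) (wd (?v @ [s]) p) \<ge> len (wd (?v @ [s])) - 3 * K2 - C"
    have "gp (wd (?v @ [s]) p) (wd ?v p) \<ge> len (wd ?v) - K2"
      using gp_word_append[OF v, of "[s]"] s by (simp add: gromov_prod_commute)
    then show "gp (y n) (wd ?v p) \<ge> len (wd ?v) - 3 * K2 - C"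
      using * hyp[of "y n" "wd (?v @ [s]) p" "wd ?v p"] len_snoc[OF v s] C_nonneg K2_nonneg
      by (auto simp: min_def split: if_splits)
  qed
  then show ?case using snoc by simp
qed simp

text \<open>By prefix closure both words can be cut just after their first difference. A sequence
  that follows both \<open>w @ [a]\<close> and \<open>w @ [b]\<close> would force \<open>a p\<close>
  and \<open>b p\<close> as near to each other as their lengths permit, up to a bounded error,
  against \<open>apart\<close>.\<close>

lemma hit_unique:
  assumes "hit y u" "hit y v" "set u \<subseteq> S" "set v \<subseteq> S" "length u = length v"
  shows "u = v"
proof (rule ccontr)
  assume "u \<noteq> v"
  then obtain w a u' b v' where ab: "a \<noteq> b" and u: "u = w @ [a] @ u'" and v: "v = w @ [b] @ v'"
    using same_length_different[OF _ assms(5)] by blast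
  have w: "set w \<subseteq> S" and a: "a \<in> S" and b: "b \<in> S" using u v assms by auto
  have wG: "wd w \<in> G" using w word_G by blast
  have ha: "hit y (w @ [a])" and hb: "hit y (w @ [b])"
    using hit_prefix[of y "w @ [a]" u'] hit_prefix[of y "w @ [b]" v'] assms u v by auto
  then have "\<forall>\<^sub>F n in sequentially. gp (y n) (wd (w @ [a]) p) \<ge> len (wd (w @ [a])) - 3 * K2 - C \<and>
      gp (y n) (wd (w @ [b]) p) \<ge> len (wd (w @ [b])) - 3 * K2 - C"
    unfolding hit_def by (rule eventually_conj)
  then obtain n where n: "gp (y n) (wd (w @ [a]) p) \<ge> len (wd (w @ [a])) - 3 * K2 - C"
      "gp (y n) (wd (w @ [b]) p) \<ge> len (wd (w @ [b])) - 3 * K2 - C"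
    using eventually_happens'[OF sequentially_bot] by blast
  have "dist (a p) (b p) = dist (wd (w @ [a]) p) (wd (w @ [b]) p)"
    using G_dist[OF wG] by (simp add: wd_append)
  also have "\<dots> = len (wd (w @ [a])) + len (wd (w @ [b])) -
      2 * gp (wd (w @ [a]) p) (wd (w @ [b]) p)"
    by (rule dist_gromov_prod)
  also have "\<dots> \<le> \<bar>len (wd (w @ [a])) - len (wd (w @ [b]))\<bar> + 6 * K2 + 4 * C"
    using hyp[of "wd (w @ [a]) p" "y n" "wd (w @ [b]) p"] n
    by (auto simp: min_def gromov_prod_commute[of p "y n"] abs_if split: if_splits)
  also have "\<dots> \<le> \<bar>len a - len b\<bar> + 8 * K2 + 4 * C"
    using len_append[OF w, of "[a]"] len_append[OF w, of "[b]"] a b by auto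
  finally show False
    using apart[OF a b ab] by (simp add: K2_def)
qed

text \<open>If the product of the two tails exceeded \<open>Lm\<close>, it would exceed the lengths
  of both first letters; these would then point the same way, against \<open>apart\<close>.
  Translation by \<open>wd w\<close> adds at most the length of that word.\<close>

lemma gp_branch:
  assumes "set w \<subseteq> S" "a \<in> S" "b \<in> S" "a \<noteq> b" "set u \<subseteq> S" "set v \<subseteq> S"
  shows "gp (wd (w @ a # u) p) (wd (w @ b # v) p) \<le> len (wd w) + Lm"
proof -
  have wG: "wd w \<in> G" using assms word_G by blast
  have "gp (wd (a # u) p) (wd (b # v) p) \<le> Lm"
  proof (rule ccontr)
    assume n: "\<not> ?thesis"
    have 1: "gp (a p) (wd (a # u) p) \<ge> len a - K2"
      using gp_word_append[of "[a]" u] assms by simp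
    have 2: "gp (wd (b # v) p) (b p) \<ge> len b - K2"
      using gp_word_append[of "[b]" v] assms by (simp add: gromov_prod_commute)
    have "gp (a p) (b p) \<ge> min (len a) (len b) - K2 - 2 * C"
      using hyp2[of "a p" "wd (a # u) p" "wd (b # v) p" "b p"] 1 2 n K2_nonneg
        len_S_le[OF assms(2)] len_S_le[OF assms(3)]
      by (auto simp: min_def split: if_splits)
    then have "dist (a p) (b p) \<le> \<bar>len a - len b\<bar> + 2 * K2 + 4 * C"
      by (auto simp: dist_gromov_prod[of "a p" "b p" p] min_def abs_if split: if_splits)
    then show False
      using apart[OF assms(2,3,4)] K_nonneg C_nonneg by (simp add: K2_def)
  qed
  then show ?thesis
    using gp_isom[OF wG] gromov_prod_base_le[of "ginv (wd w) p" "wd (a # u) p" "wd (b # v) p" p]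
      len_ginv[OF wG]
    by (simp add: wd_append)
qed

section \<open>Boundary points of infinite words\<close>

definition path :: "(nat \<Rightarrow> 'x \<Rightarrow> 'x) \<Rightarrow> nat \<Rightarrow> 'x" where
  "path \<omega> n = wd (pre \<omega> n) p"

definition endpoint :: "(nat \<Rightarrow> 'x \<Rightarrow> 'x) \<Rightarrow> 'x bdry" where
  "endpoint \<omega> = gromov_seq_rel p `` {path \<omega>}"

context
  fixes \<omega> :: "nat \<Rightarrow> 'x \<Rightarrow> 'x"
  assumes \<omega>: "range \<omega> \<subseteq> S"
begin

lemma set_pre: "set (pre \<omega> j) \<subseteq> S" and set_seg: "set (map \<omega> [i..<j]) \<subseteq> S"
  using \<omega> by (auto simp: pre_def)

lemma len_pre_ge: "len (wd (pre \<omega> j)) \<ge> (C + 1) * j"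
  using len_append_ge[of "[]" "pre \<omega> j"] set_pre by (simp add: pre_def)

lemma gp_path: "i \<le> j \<Longrightarrow> gp (path \<omega> i) (path \<omega> j) \<ge> len (wd (pre \<omega> i)) - K2"
  using gp_word_append[OF set_pre[of i] set_seg[of i j]] pre_split[of i j \<omega>]
  by (simp add: path_def)

lemma gromov_seq_path: "gromov_seq p (path \<omega>)"
  unfolding gromov_seq_iff
proof
  fix T
  obtain N :: nat where N: "real N \<ge> T + K2" using real_arch_simple by blast
  have *: "gp (path \<omega> n) (path \<omega> m) \<ge> T" if "N \<le> n" "n \<le> m" for n m
  proof -
    have "real N \<le> real n" using that by simp
    moreover have "real n \<le> (C + 1) * real n"
      using C_nonneg by (simp add: algebra_simps)
    ultimately show ?thesis using gp_path[OF that(2)] len_pre_ge[of n] N by linarith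
  qed
  then show "\<exists>N. \<forall>n\<ge>N. \<forall>m\<ge>N. gp (path \<omega> n) (path \<omega> m) \<ge> T"
    by (metis gromov_prod_commute nat_le_linear)
qed

lemma path_in_endpoint: "path \<omega> \<in> endpoint \<omega>"
  and endpoint_in_boundary: "endpoint \<omega> \<in> gromov_boundary p"
  using gromov_seq_path bdry_class_mem bdry_class_in by (auto simp: endpoint_def)

lemma endpoint_uniformly_radial: "endpoint \<omega> \<in> uniformly_radial_limit_set p G"
proof -
  \<comment> \<open>\<open>Lm\<close> bounds the steps between consecutive prefixes and
    \<open>K2\<close> their defect from the ray; the summand 1 only secures positivity.\<close>
  define \<sigma> where "\<sigma> = max (K2 + 1) Lm"
  have \<sigma>: "\<sigma> > 0" using K2_nonneg by (simp add: \<sigma>_def)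
  let ?g = "\<lambda>n. wd (pre \<omega> n)"
  have ev: "\<forall>\<^sub>F k in sequentially. gp (path \<omega> k) (?g n p) \<ge> len (?g n) - K2" for n
    using eventually_ge_at_top[of n]
  proof eventually_elim
    case (elim k)
    then show ?case using gp_path[OF elim] by (simp add: path_def gromov_prod_commute)
  qed
  have "tendsto_bdry p (\<lambda>n. ?g n p) (endpoint \<omega>)"
    unfolding tendsto_bdry_def tendsto_PInfty
  proof
    fix r :: real
    obtain N :: nat where N: "real N > r + K2 + C" using reals_Archimedean2 by blast
    have "ereal r < gromov_prod_pb p (?g n p) (endpoint \<omega>)" if "n \<ge> N" for n
    proof -
      have "gromov_prod_pb p (?g n p) (endpoint \<omega>) \<ge> ereal (len (?g n) - K2 - C)"
        by (rule gromov_prod_pb_ge[OF endpoint_in_boundary path_in_endpoint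
              eventually_frequently[OF sequentially_bot ev]])
      moreover have "real N \<le> real n" using that by simp
      then have "r < len (?g n) - K2 - C"
        using len_pre_ge[of n] N C_nonneg mult_nonneg_nonneg[OF C_nonneg of_nat_0_le_iff[of n]]
        by (simp only: distrib_right)
      ultimately show ?thesis by (meson less_ereal.simps(1) order_less_le_trans)
    qed
    then show "\<forall>\<^sub>F n in sequentially. ereal r < gromov_prod_pb p (?g n p) (endpoint \<omega>)"
      unfolding eventually_sequentially by blast
  qed
  moreover have "gromov_prod_pb (?g n p) p (endpoint \<omega>) \<le> ereal \<sigma>" for n
  proof (rule gromov_prod_pb_leI[OF path_in_endpoint])
    show "\<forall>\<^sub>F k in sequentially. gromov_prod (?g n p) (path \<omega> k) p \<le> \<sigma>"
      using ev[of n]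
      by (rule eventually_mono)
         (simp add: gromov_prod_change_base[of "wd (pre \<omega> n) p" _ p p] \<sigma>_def)
  qed
  moreover have "dist (?g n p) (?g (Suc n) p) \<le> \<sigma>" for n
    using G_dist[of "?g n" p "\<omega> n p"] word_G[OF set_pre[of n]]
      len_S_le[OF subsetD[OF \<omega> rangeI], of n]
    by (auto simp: pre_Suc wd_append \<sigma>_def max_def)
  moreover have "?g 0 p = p" by (simp add: pre_def)
  moreover have "?g n \<in> G" for n using word_G[OF set_pre] .
  ultimately have "endpoint \<omega> \<in> uniformly_radial_limit_set_at p G \<sigma>"
    unfolding uniformly_radial_limit_set_at_def
    by (intro CollectI conjI endpoint_in_boundary exI[of _ ?g] allI)
  then show ?thesis
    unfolding uniformly_radial_limit_set_def using \<sigma> by blast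
qed

end

text \<open>The error by which \<open>h\<close> is seen to be returning in
  \<open>close_approach\<close>: \<open>Lm\<close> for overshooting the branch point by one letter,
  \<open>K2 + 2 * C\<close> and \<open>K2 + C\<close> for the two products with the prefix at the
  branch point.\<close>

definition "Lc = Lm + 2 * K2 + 3 * C"

text \<open>The ray from \<open>h p\<close> to the limit of \<open>h \<circ> x\<close> passes within
  bounded distance of \<open>p\<close>; seen after applying the inverse, \<open>ginv h p\<close>
  lies near the ray from \<open>p\<close> to the limit of \<open>x\<close>.\<close>

definition returning :: "(nat \<Rightarrow> 'x) \<Rightarrow> ('x \<Rightarrow> 'x) set" where
  "returning x = {h\<in>G. \<forall>\<^sub>F n in sequentially. gp (h p) (h (x n)) \<le> Lc}"

lemma close_approach:
  assumes \<omega>: "range \<omega> \<subseteq> S" and g: "g \<in> G" and M: "M \<ge> 0"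
    and close: "\<forall>\<^sub>F n in sequentially. gp (g (x n)) (path \<omega> n) > len g + M"
  obtains i j h where "h \<in> returning x" "i \<le> j" "hit (\<lambda>n. h (x n)) (map \<omega> [i..<j])"
    "real (Suc j - i) * Lm > len h + M - 2 * K2 - 4 * C"
proof -
  let ?W = "\<lambda>j. wd (pre \<omega> j)"
  let ?f = "\<lambda>j. len (?W j)"
  note preS = set_pre[OF \<omega>]
  have WG: "?W j \<in> G" for j using word_G[OF preS] .
  have f_ge: "?f j \<ge> real j" for j
    using len_pre_ge[OF \<omega>, of j] mult_nonneg_nonneg[OF C_nonneg of_nat_0_le_iff[of j]]
    by (simp add: distrib_right)
  have fin: "finite {j. ?f j \<le> t}" for t
  proof (rule finite_subset)
    show "{j. ?f j \<le> t} \<subseteq> {j. j \<le> nat \<lfloor>t\<rfloor>}"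
    proof clarify
      fix j assume "?f j \<le> t"
      then have "real j \<le> t" using f_ge[of j] by linarith
      then show "j \<le> nat \<lfloor>t\<rfloor>" by linarith
    qed
  qed simp
  \<comment> \<open>A prefix that is not longer than the guaranteed overlap of
    \<open>g (x n)\<close> with the path is itself followed by \<open>g (x n)\<close>.\<close>
  have shadow: "\<forall>\<^sub>F n in sequentially. gp (g (x n)) (?W j p) \<ge> ?f j - K2 - C"
    if "?f j \<le> len g + M" for j
    using close eventually_ge_at_top[of j]
  proof eventually_elim
    case (elim n)
    have "gp (path \<omega> n) (?W j p) \<ge> ?f j - K2"
      using gp_path[OF \<omega> elim(2)] by (simp add: path_def gromov_prod_commute)
    then show ?case
      using elim hyp[of "g (x n)" "path \<omega> n" "?W j p"] that K2_nonneg
      by (auto simp: min_def split: if_splits)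
  qed
  \<comment> \<open>The last prefix not longer than the product of \<open>g p\<close> and
    \<open>g (x n)\<close> replaces the branch point. As this product may oscillate with
    \<open>n\<close>, the comparison is asked infinitely often; beyond the last such prefix the
    opposite strict inequality then holds eventually.\<close>
  define P where "P j \<longleftrightarrow> (\<exists>\<^sub>F n in sequentially. gp (g p) (g (x n)) \<ge> ?f j)" for j
  have P_le: "?f j \<le> len g" if Pj: "P j" for j
  proof -
    obtain n where "gp (g p) (g (x n)) \<ge> ?f j"
      using frequently_ex[OF Pj[unfolded P_def]] by blast
    then show ?thesis using gromov_prod_le(1)[of p "g p" "g (x n)"] by linarith
  qed
  have finP: "finite {j. P j}"
    using P_le by (intro finite_subset[OF _ fin[of "len g"]]) blast
  have P0: "P 0"
    unfolding P_def
    by (intro eventually_frequently always_eventually) (auto simp: pre_def gromov_prod_nonneg)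
  define i where "i = Max {j. P j}"
  have i: "P i" using Max_in[OF finP] P0 by (auto simp: i_def)
  have "\<not> P (Suc i)" using Max_ge[OF finP, of "Suc i"] by (auto simp: i_def)
  then have up: "\<forall>\<^sub>F n in sequentially. gp (g p) (g (x n)) < ?f (Suc i)"
    by (simp add: P_def frequently_def not_le)
  have fSuc: "?f (Suc i) \<le> ?f i + Lm"
    using len_append(2)[OF preS[of i], of "[\<omega> i]"] subsetD[OF \<omega> rangeI, of i]
      len_S_le[OF subsetD[OF \<omega> rangeI], of i] by (simp add: pre_Suc)
  have fi: "?f i \<le> len g" using P_le[OF i] .
  have sh_i: "\<forall>\<^sub>F n in sequentially. gp (g (x n)) (?W i p) \<ge> ?f i - K2 - C"
    using shadow[of i] fi M by simp
  have gi: "gp (g p) (?W i p) \<ge> ?f i - K2 - 2 * C"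
  proof -
    have "\<exists>\<^sub>F n in sequentially. gp (g p) (g (x n)) \<ge> ?f i \<and> gp (g (x n)) (?W i p) \<ge> ?f i - K2 - C"
      using i sh_i unfolding P_def by (rule frequently_eventually_frequently)
    then obtain n where "gp (g p) (g (x n)) \<ge> ?f i" "gp (g (x n)) (?W i p) \<ge> ?f i - K2 - C"
      by (auto dest: frequently_ex)
    then show ?thesis
      using hyp[of "g p" "g (x n)" "?W i p"] K2_nonneg C_nonneg
      by (auto simp: min_def split: if_splits)
  qed
  define h where "h = ginv (?W i) \<circ> g"
  have hG: "h \<in> G" unfolding h_def using WG g by (intro G_comp G_inv)
  have "\<forall>\<^sub>F n in sequentially. gp (h p) (h (x n)) \<le> Lc"
    using up sh_i
  proof eventually_elim
    case (elim n)
    have "gp (h p) (h (x n)) = gromov_prod (?W i p) (g p) (g (x n))"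
      unfolding h_def using gp_isom_inv[OF WG[of i]] by simp
    also have "\<dots> = ?f i - gp (g p) (?W i p) - gp (g (x n)) (?W i p) + gp (g p) (g (x n))"
      by (rule gromov_prod_change_base)
    finally show ?case using elim gi fSuc unfolding Lc_def by linarith
  qed
  then have returning: "h \<in> returning x" using hG by (simp add: returning_def)
  have len_h: "len h \<le> len g - ?f i + 2 * K2 + 4 * C"
  proof -
    have "len h = dist (?W i p) (g p)"
      using G_dist_swap[OF G_inv[OF WG[of i]], of "g p" p] ginv_ginv[OF WG[of i]]
      by (simp add: h_def dist_commute)
    also have "\<dots> = ?f i + len g - 2 * gp (g p) (?W i p)"
      using dist_gromov_prod[of "?W i p" "g p" p] by (simp add: gromov_prod_commute)
    finally show ?thesis using gi by linarith
  qed
  \<comment> \<open>By maximality one more letter leads past \<open>len g + M\<close>. This is why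
    the conclusion counts \<open>Suc j - i\<close> letters although only \<open>j - i\<close> of
    them form the hit.\<close>
  define j where "j = Max {j. ?f j \<le> len g + M}"
  have ij: "i \<le> j" unfolding j_def using fi M by (intro Max_ge fin) auto
  have fj: "?f j \<le> len g + M"
  proof -
    have "i \<in> {j. ?f j \<le> len g + M}" using fi M by simp
    then have "Max {j. ?f j \<le> len g + M} \<in> {j. ?f j \<le> len g + M}"
      by (intro Max_in fin) blast
    then show ?thesis by (simp add: j_def)
  qed
  have "\<not> ?f (Suc j) \<le> len g + M"
    using Max_ge[OF fin[of "len g + M"], of "Suc j"] by (auto simp: j_def)
  then have fSj: "?f (Suc j) > len g + M" by simp
  note seg = set_seg[OF \<omega>]
  have "?f (Suc j) \<le> ?f i + len (wd (map \<omega> [i..<Suc j]))"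
    using len_append(2)[OF preS[of i] seg[of i "Suc j"]] pre_split[of i "Suc j" \<omega>] ij by simp
  also have "\<dots> \<le> ?f i + real (Suc j - i) * Lm"
    using len_word_le[OF seg[of i "Suc j"]] by (simp add: Suc_diff_le[OF ij] del: upt_Suc)
  finally have 1: "real (Suc j - i) * Lm > len h + M - 2 * K2 - 4 * C"
    using len_h fSj by linarith
  let ?v = "map \<omega> [i..<j]"
  have Wj: "?W j p = ?W i (wd ?v p)" using pre_split[OF ij, of \<omega>] by (simp add: wd_append)
  have hit: "hit (\<lambda>n. h (x n)) ?v"
    unfolding hit_def using shadow[OF fj]
  proof eventually_elim
    case (elim n)
    have "wd ?v p = ginv (?W i) (?W j p)" using WG[of i] by (simp add: Wj)
    then have "gp (h (x n)) (wd ?v p) = gromov_prod (?W i p) (g (x n)) (?W j p)"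
      unfolding h_def using gp_isom_inv[OF WG[of i]] by simp
    also have "\<dots> = ?f i - gp (g (x n)) (?W i p) - gp (?W j p) (?W i p) + gp (g (x n)) (?W j p)"
      by (rule gromov_prod_change_base)
    also have "\<dots> \<ge> ?f j - ?f i - K2 - C"
      using elim gromov_prod_le(2)[of p "g (x n)" "?W i p"] gromov_prod_le(2)[of p "?W j p" "?W i p"]
      by linarith
    moreover have "?f j \<ge> ?f i + len (wd ?v) - 2 * K2"
      using len_append(1)[OF preS[of i] seg[of i j]] pre_split[OF ij, of \<omega>] by simp
    ultimately show ?case by linarith
  qed
  show thesis using that[OF returning ij hit 1] .
qed

text \<open>Points near one ray and at almost equal distance from \<open>p\<close> lie in a ball of
  fixed radius. Composing with the inverse of one chosen element \<open>h0\<close> embeds the others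
  into the elements of bounded length, uniformly in \<open>x\<close> and \<open>m\<close>.\<close>

lemma card_returning:
  assumes sd: "strongly_discrete p G"
  shows "finite {h\<in>returning x. m \<le> len h \<and> len h < m + 1}" (is "finite ?A")
    and "card {h\<in>returning x. m \<le> len h \<and> len h < m + 1} \<le> card {g\<in>G. len g \<le> 2 + 2 * Lc + 2 * C}"
proof -
  let ?B = "{g\<in>G. len g \<le> 2 + 2 * Lc + 2 * C}"
  have *: "finite ?A \<and> card ?A \<le> card ?B"
  proof (cases "?A = {}")
    case False
    then obtain h0 where h0: "h0 \<in> ?A" by blast
    have G0: "h0 \<in> G" using h0 by (simp add: returning_def)
    define F where "F h = h \<circ> ginv h0" for h :: "'x \<Rightarrow> 'x"
    have inj: "inj_on F ?A"
    proof (rule inj_onI)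
      fix h k assume "F h = F k"
      then have "F h \<circ> h0 = F k \<circ> h0" by simp
      then show "h = k" using G0 by (simp add: F_def fun_eq_iff)
    qed
    have sub: "F ` ?A \<subseteq> ?B"
    proof clarify
      fix h assume h: "h \<in> returning x" "m \<le> len h" "len h < m + 1"
      have hG: "h \<in> G" using h by (simp add: returning_def)
      have "\<forall>\<^sub>F n in sequentially. gp (h p) (h (x n)) \<le> Lc \<and> gp (h0 p) (h0 (x n)) \<le> Lc"
        using h h0 unfolding returning_def by (auto intro: eventually_conj)
      then obtain n where n: "gp (h p) (h (x n)) \<le> Lc" "gp (h0 p) (h0 (x n)) \<le> Lc"
        using eventually_happens'[OF sequentially_bot] by blast
      have "gp (ginv h p) (x n) \<ge> m - Lc"
        using gp_prefix[OF hG, of "x n"] n h by linarith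
      moreover have "gp (x n) (ginv h0 p) \<ge> m - Lc"
        using gp_prefix[OF G0, of "x n"] n h0 by (simp add: gromov_prod_commute)
      ultimately have "gp (ginv h p) (ginv h0 p) \<ge> m - Lc - C"
        using hyp[of "ginv h p" "x n" "ginv h0 p"] by (auto simp: min_def split: if_splits)
      moreover have "len (F h) = dist (ginv h p) (ginv h0 p)"
        using G_dist_swap[OF hG, of "ginv h0 p" p] by (simp add: F_def dist_commute)
      ultimately have "len (F h) \<le> 2 + 2 * Lc + 2 * C"
        using h h0 hG G0 by (auto simp: dist_gromov_prod[of "ginv h p" _ p] len_ginv)
      then show "F h \<in> G \<and> len (F h) \<le> 2 + 2 * Lc + 2 * C"
        using hG G0 by (simp add: F_def G_comp G_inv del: o_apply)
    qed
    have "finite ?B" using sd by (rule finite_len_le)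
    then show ?thesis
      using card_inj_on_le[OF inj sub] inj_on_finite[OF inj sub] by blast
  next
    case True
    show ?thesis unfolding True by simp
  qed
  show "finite ?A" using * by (rule conjunct1)
  show "card ?A \<le> card ?B" using * by (rule conjunct2)
qed

end

section \<open>Loxodromic isometries\<close>

context isometric_action
begin

section \<open>The action of isometries on the boundary\<close>

lemma gromov_seq_isom:
  assumes g: "g \<in> G" and x: "gromov_seq p x"
  shows "gromov_seq p (g \<circ> x)"
  unfolding gromov_seq_iff
proof
  fix T
  obtain N where N: "\<And>n m. n \<ge> N \<Longrightarrow> m \<ge> N \<Longrightarrow> gp (x n) (x m) \<ge> T + len g"
    using spec[OF x[unfolded gromov_seq_iff], of "T + len g"] by blast
  have "gp ((g \<circ> x) n) ((g \<circ> x) m) \<ge> T" if "n \<ge> N" "m \<ge> N" for n m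
    using N[OF that] gp_isom[OF g, of "x n" "x m"]
      gromov_prod_base_ge[of p "x n" "x m" "ginv g p"] len_ginv[OF g] by simp
  then show "\<exists>N. \<forall>n\<ge>N. \<forall>m\<ge>N. gp ((g \<circ> x) n) ((g \<circ> x) m) \<ge> T" by blast
qed

lemma seq_rel_isom:
  assumes g: "g \<in> G" and xy: "(x, y) \<in> gromov_seq_rel p"
  shows "(g \<circ> x, g \<circ> y) \<in> gromov_seq_rel p"
  unfolding seq_rel_iff
proof (intro conjI allI)
  show "gromov_seq p (g \<circ> x)" "gromov_seq p (g \<circ> y)"
    using xy g by (auto simp: seq_rel_iff intro: gromov_seq_isom)
  fix T
  have "\<exists>N. \<forall>n\<ge>N. gp (x n) (y n) \<ge> T + len g"
    using xy unfolding seq_rel_iff by simp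
  then obtain N where N: "\<And>n. n \<ge> N \<Longrightarrow> gp (x n) (y n) \<ge> T + len g"
    by blast
  have "gp ((g \<circ> x) n) ((g \<circ> y) n) \<ge> T" if "n \<ge> N" for n
    using N[OF that] gp_isom[OF g, of "x n" "y n"]
      gromov_prod_base_ge[of p "x n" "y n" "ginv g p"] len_ginv[OF g] by simp
  then show "\<exists>N. \<forall>n\<ge>N. gp ((g \<circ> x) n) ((g \<circ> y) n) \<ge> T" by blast
qed

lemma bdry_act_mem: "x \<in> \<xi> \<Longrightarrow> g \<circ> x \<in> bdry_act g \<xi>"
  by (auto simp: bdry_act_def)

text \<open>A boundary point is a full equivalence class, so the image has to be shown to be
  saturated; the inverse isometry supplies that inclusion.\<close>

lemma bdry_act_in:
  assumes g: "g \<in> G" and "\<xi> \<in> gromov_boundary p"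
  shows "bdry_act g \<xi> \<in> gromov_boundary p"
proof -
  obtain x where x: "gromov_seq p x" "\<xi> = gromov_seq_rel p `` {x}"
    using assms(2) by (rule bdryE)
  have "bdry_act g \<xi> = gromov_seq_rel p `` {g \<circ> x}"
  proof
    show "bdry_act g \<xi> \<subseteq> gromov_seq_rel p `` {g \<circ> x}"
      using seq_rel_isom[OF g] by (auto simp: bdry_act_def x)
    show "gromov_seq_rel p `` {g \<circ> x} \<subseteq> bdry_act g \<xi>"
    proof
      fix z assume "z \<in> gromov_seq_rel p `` {g \<circ> x}"
      then have "(ginv g \<circ> (g \<circ> x), ginv g \<circ> z) \<in> gromov_seq_rel p"
        using seq_rel_isom[OF G_inv[OF g]] by blast
      moreover have "ginv g \<circ> (g \<circ> x) = x" "g \<circ> (ginv g \<circ> z) = z"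
        using g by (auto simp: fun_eq_iff)
      ultimately show "z \<in> bdry_act g \<xi>"
        unfolding bdry_act_def x by (metis Image_singleton_iff imageI)
    qed
  qed
  then show ?thesis using bdry_class_in gromov_seq_isom[OF g x(1)] by simp
qed

lemma G_funpow: "g \<in> G \<Longrightarrow> g ^^ n \<in> G"
  by (induction n) (auto simp: G_id G_comp)

lemma ginv_funpow: "g \<in> G \<Longrightarrow> ginv (g ^^ n) = ginv g ^^ n"
  by (simp add: G_bij inv_fn)

lemma bdry_act_funpow:
  assumes "bdry_act g \<xi> = \<xi>" shows "bdry_act (g ^^ n) \<xi> = \<xi>"
proof (induction n)
  case (Suc n)
  have "bdry_act (g ^^ Suc n) \<xi> = bdry_act g (bdry_act (g ^^ n) \<xi>)"
    by (simp add: bdry_act_def image_image comp_assoc)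
  then show ?case by (simp only: Suc.IH assms)
qed (simp add: bdry_act_def o_def)

lemma bdry_act_ginv:
  assumes "g \<in> G" "bdry_act g \<xi> = \<xi>" shows "bdry_act (ginv g) \<xi> = \<xi>"
proof -
  have "bdry_act (ginv g) \<xi> = bdry_act (ginv g) (bdry_act g \<xi>)" using assms by simp
  also have "\<dots> = \<xi>"
    using assms(1) by (simp add: bdry_act_def image_image comp_def)
  finally show ?thesis .
qed

lemma bdry_act_inj:
  assumes "g \<in> G" "bdry_act g \<xi> = bdry_act g \<eta>" shows "\<xi> = \<eta>"
proof -
  have "inj (\<lambda>x::nat \<Rightarrow> 'x. g \<circ> x)"
    using G_bij[OF assms(1)] by (auto simp: inj_def fun_eq_iff bij_def)
  then show ?thesis using assms(2) unfolding bdry_act_def by (simp add: inj_image_eq_iff)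
qed

end

section \<open>The visual metric compared with products along representatives\<close>

lemma neg_pow_less_iff:
  "b > 1 \<Longrightarrow> t \<ge> 0 \<Longrightarrow> neg_pow b t < b powr (- r) \<longleftrightarrow> ereal r < t"
  by (cases t) (auto simp: neg_pow_def)

lemma neg_pow_le:
  "b > 1 \<Longrightarrow> t \<ge> 0 \<Longrightarrow> ereal r \<le> t \<Longrightarrow> neg_pow b t \<le> b powr (- r)"
  by (cases t) (auto simp: neg_pow_def)

locale visual_action = isometric_action p C G
  for p :: "'x::metric_space" and C G +
  fixes b :: real and D :: "'x bdry \<Rightarrow> 'x bdry \<Rightarrow> real"
  assumes b: "b > 1" and visual: "visual_metric p b D"
begin

sublocale bdry: Metric_space "gromov_boundary p" D
  using visual by (simp add: visual_metric_def)

text \<open>Replaces the infimum over all representatives by arbitrary ones along the diagonal. The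
  extra factor \<open>b powr (2 * C)\<close> in the constant absorbs the loss in
  \<open>gromov_prod_bb_ge\<close>.\<close>

lemma visual_comparison:
  "\<exists>Q\<ge>1. \<forall>\<xi>\<in>gromov_boundary p. \<forall>\<eta>\<in>gromov_boundary p. \<forall>x\<in>\<xi>. \<forall>y\<in>\<eta>. \<forall>T.
     ((\<exists>\<^sub>F k in sequentially. gp (x k) (y k) \<ge> T) \<longrightarrow> D \<xi> \<eta> \<le> Q * b powr (- T)) \<and>
     (D \<xi> \<eta> < b powr (- T) / Q \<longrightarrow> (\<forall>\<^sub>F k in sequentially. gp (x k) (y k) > T))"
proof -
  obtain Q where Q: "Q \<ge> 1" and lo: "\<And>\<xi> \<eta>. \<xi> \<in> gromov_boundary p \<Longrightarrow> \<eta> \<in> gromov_boundary p \<Longrightarrow>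
        neg_pow b (gromov_prod_bb p \<xi> \<eta>) / Q \<le> D \<xi> \<eta>"
    and hi: "\<And>\<xi> \<eta>. \<xi> \<in> gromov_boundary p \<Longrightarrow> \<eta> \<in> gromov_boundary p \<Longrightarrow>
        D \<xi> \<eta> \<le> Q * neg_pow b (gromov_prod_bb p \<xi> \<eta>)"
    using visual unfolding visual_metric_def by blast
  define Q' where "Q' = Q * b powr (2 * C)"
  have "b powr (2 * C) \<ge> 1" using b C_nonneg by (simp add: ge_one_powr_ge_zero)
  then have "Q' \<ge> Q" using Q mult_left_mono[of 1 "b powr (2 * C)" Q] unfolding Q'_def by auto
  then have Q': "Q' \<ge> Q" "Q' \<ge> 1" using Q by auto
  show ?thesis
  proof (intro exI[of _ Q'] conjI Q' ballI allI impI)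
    fix \<xi> \<eta> x y T
    assume \<xi>: "\<xi> \<in> gromov_boundary p" and \<eta>: "\<eta> \<in> gromov_boundary p" and x: "x \<in> \<xi>" and y: "y \<in> \<eta>"
    {
      assume "\<exists>\<^sub>F k in sequentially. gp (x k) (y k) \<ge> T"
      then have "gromov_prod_bb p \<xi> \<eta> \<ge> ereal (T - 2 * C)"
        by (rule gromov_prod_bb_ge[OF \<xi> \<eta> x y])
      then have "neg_pow b (gromov_prod_bb p \<xi> \<eta>) \<le> b powr (- (T - 2 * C))"
        by (intro neg_pow_le b gromov_prod_bb_nonneg)
      then have "Q * neg_pow b (gromov_prod_bb p \<xi> \<eta>) \<le> Q * b powr (- (T - 2 * C))"
        using Q by (intro mult_left_mono) auto
      also have "\<dots> = Q' * b powr (- T)"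
        by (simp add: Q'_def flip: powr_add)
      finally show "D \<xi> \<eta> \<le> Q' * b powr (- T)" using hi[OF \<xi> \<eta>] by linarith
    }
    {
      assume "D \<xi> \<eta> < b powr (- T) / Q'"
      also have "\<dots> \<le> b powr (- T) / Q" using Q Q' by (intro divide_left_mono) auto
      finally have "neg_pow b (gromov_prod_bb p \<xi> \<eta>) / Q < b powr (- T) / Q"
        using lo[OF \<xi> \<eta>] by linarith
      then have "neg_pow b (gromov_prod_bb p \<xi> \<eta>) < b powr (- T)"
        using Q by (simp add: divide_less_cancel)
      then have "gromov_prod_bb p \<xi> \<eta> > ereal T"
        using neg_pow_less_iff[OF b gromov_prod_bb_nonneg] by blast
      then show "\<forall>\<^sub>F k in sequentially. gp (x k) (y k) > T"
        using x y by (rule gromov_prod_bb_gtD)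
    }
  qed
qed

definition "Q = (SOME Q. Q \<ge> 1 \<and> (\<forall>\<xi>\<in>gromov_boundary p. \<forall>\<eta>\<in>gromov_boundary p. \<forall>x\<in>\<xi>. \<forall>y\<in>\<eta>. \<forall>T.
     ((\<exists>\<^sub>F k in sequentially. gp (x k) (y k) \<ge> T) \<longrightarrow> D \<xi> \<eta> \<le> Q * b powr (- T)) \<and>
     (D \<xi> \<eta> < b powr (- T) / Q \<longrightarrow> (\<forall>\<^sub>F k in sequentially. gp (x k) (y k) > T))))"

lemma Q_props: "Q \<ge> 1 \<and> (\<forall>\<xi>\<in>gromov_boundary p. \<forall>\<eta>\<in>gromov_boundary p. \<forall>x\<in>\<xi>. \<forall>y\<in>\<eta>. \<forall>T.
     ((\<exists>\<^sub>F k in sequentially. gp (x k) (y k) \<ge> T) \<longrightarrow> D \<xi> \<eta> \<le> Q * b powr (- T)) \<and>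
     (D \<xi> \<eta> < b powr (- T) / Q \<longrightarrow> (\<forall>\<^sub>F k in sequentially. gp (x k) (y k) > T)))"
  unfolding Q_def by (rule someI_ex) (rule visual_comparison)

lemma Q_ge_1: "Q \<ge> 1"
  using Q_props by (rule conjunct1)

lemma D_le:
  assumes "\<xi> \<in> gromov_boundary p" "\<eta> \<in> gromov_boundary p" "x \<in> \<xi>" "y \<in> \<eta>"
    "\<exists>\<^sub>F k in sequentially. gp (x k) (y k) \<ge> T"
  shows "D \<xi> \<eta> \<le> Q * b powr (- T)"
  using Q_props[THEN conjunct2, THEN bspec, OF assms(1), THEN bspec, OF assms(2), THEN bspec,
      OF assms(3), THEN bspec, OF assms(4)] assms(5) by blast

lemma D_less:
  assumes "\<xi> \<in> gromov_boundary p" "\<eta> \<in> gromov_boundary p" "x \<in> \<xi>" "y \<in> \<eta>"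
    "D \<xi> \<eta> < b powr (- T) / Q"
  shows "\<forall>\<^sub>F k in sequentially. gp (x k) (y k) > T"
  using Q_props[THEN conjunct2, THEN bspec, OF assms(1), THEN bspec, OF assms(2), THEN bspec,
      OF assms(3), THEN bspec, OF assms(4)] assms(5) by blast

lemma powr_less_ex:
  assumes "e > 0" shows "\<exists>T\<ge>0. Q * b powr (- T) < e"
proof -
  define T where "T = max 0 (log b (2 * Q / e))"
  have "b powr T \<ge> 2 * Q / e"
    using b assms Q_ge_1 powr_mono[of "log b (2 * Q / e)" T b] by (simp add: T_def)
  then have "b powr (- T) \<le> e / (2 * Q)"
    using assms Q_ge_1 b by (simp add: powr_minus field_simps)
  then have "Q * b powr (- T) \<le> e / 2"
    using Q_ge_1 by (simp add: field_simps)
  then show ?thesis using assms by (intro exI[of _ T]) (auto simp: T_def)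
qed

lemma distinct_bounded:
  assumes "\<xi> \<in> gromov_boundary p" "\<eta> \<in> gromov_boundary p" "\<xi> \<noteq> \<eta>"
  shows "\<exists>K\<ge>0. \<forall>x\<in>\<xi>. \<forall>y\<in>\<eta>. \<forall>\<^sub>F k in sequentially. gp (x k) (y k) \<le> K"
proof -
  have "D \<xi> \<eta> > 0" using assms bdry.mdist_pos_less by blast
  then obtain T where T: "T \<ge> 0" "Q * b powr (- T) < D \<xi> \<eta>"
    using powr_less_ex by blast
  have "\<forall>\<^sub>F k in sequentially. gp (x k) (y k) \<le> T" if xy: "x \<in> \<xi>" "y \<in> \<eta>" for x y
  proof -
    have "\<not> (\<exists>\<^sub>F k in sequentially. gp (x k) (y k) \<ge> T)"
      using D_le[OF assms(1,2) xy, of T] T by auto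
    then show ?thesis
      by (auto simp: frequently_def not_le elim: eventually_mono)
  qed
  with T show ?thesis by blast
qed

section \<open>Orbits of loxodromic isometries\<close>

lemma attract_eventually:
  assumes att: "iterates_attract p D g \<alpha> \<beta>"
    and bd: "\<beta> \<in> gromov_boundary p" "\<gamma> \<in> gromov_boundary p" "\<gamma> \<noteq> \<beta>" and e: "e > 0"
  shows "\<forall>\<^sub>F n in sequentially. D (bdry_act (g ^^ n) \<gamma>) \<alpha> < e"
proof -
  let ?V = "bdry.mball \<beta> (D \<beta> \<gamma>)"
  have "D \<beta> \<gamma> > 0" using bd bdry.mdist_pos_less by metis
  then have "openin bdry.mtopology ?V \<and> \<beta> \<in> ?V \<and> ?V \<subseteq> ?V"
    using bd by simp
  then have "\<forall>\<^sub>F n in sequentially. \<forall>\<eta>\<in>gromov_boundary p - ?V. D (bdry_act (g ^^ n) \<eta>) \<alpha> < e"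
    using att e unfolding iterates_attract_def by blast
  then show ?thesis
    by (rule eventually_mono) (use bd in auto)
qed

text \<open>Let \<open>y\<close> be the image of \<open>p\<close> under the inverse of
  \<open>g ^^ n\<close>. Since both ends are fixed and have bounded product, the products of
  \<open>y\<close> with the two ends add up to almost \<open>len (g ^^ n)\<close>, while
  hyperbolicity keeps one of them small. So \<open>y\<close> points to one of the ends, and the
  third point \<gamma> decides which: as \<gamma> is carried close to \<alpha>, the product of
  \<open>y\<close> with \<alpha> stays away from the full length. The value of \<open>T\<close> is
  just large enough to exclude that case.\<close>

lemma attract_direction:
  assumes g: "g \<in> G" and att: "iterates_attract p D g \<alpha> \<beta>"
    and fp: "\<alpha> \<in> bdry_fixed_points p g" "\<beta> \<in> bdry_fixed_points p g" and neq: "\<alpha> \<noteq> \<beta>"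
    and \<gamma>: "\<gamma> \<in> gromov_boundary p" "\<gamma> \<noteq> \<alpha>" "\<gamma> \<noteq> \<beta>" and c: "c \<in> \<beta>"
  shows "\<exists>K. \<forall>\<^sub>F n in sequentially. \<forall>\<^sub>F k in sequentially.
           gp (c k) (ginv (g ^^ n) p) \<ge> len (g ^^ n) - K"
proof -
  have \<alpha>: "\<alpha> \<in> gromov_boundary p" "bdry_act g \<alpha> = \<alpha>" and \<beta>: "\<beta> \<in> gromov_boundary p" "bdry_act g \<beta> = \<beta>"
    using fp by (auto simp: bdry_fixed_points_def)
  obtain a where a: "a \<in> \<alpha>" using \<alpha>(1) by (rule bdryE)
  obtain e where e: "e \<in> \<gamma>" using \<gamma>(1) by (rule bdryE)
  obtain K0 where K0: "\<And>x y. x \<in> \<alpha> \<Longrightarrow> y \<in> \<beta> \<Longrightarrow> \<forall>\<^sub>F k in sequentially. gp (x k) (y k) \<le> K0"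
    using distinct_bounded[OF \<alpha>(1) \<beta>(1) neq] by metis
  obtain K1 where K1: "\<And>x y. x \<in> \<gamma> \<Longrightarrow> y \<in> \<alpha> \<Longrightarrow> \<forall>\<^sub>F k in sequentially. gp (x k) (y k) \<le> K1"
    using distinct_bounded[OF \<gamma>(1) \<alpha>(1) \<gamma>(2)] by metis
  define T where "T = 2 * K0 + C + K1"
  have "b powr (- T) / Q > 0" using b Q_ge_1 by simp
  from attract_eventually[OF att \<beta>(1) \<gamma>(1) \<gamma>(3) this]
  have "\<forall>\<^sub>F n in sequentially. \<forall>\<^sub>F k in sequentially.
           gp (c k) (ginv (g ^^ n) p) \<ge> len (g ^^ n) - (2 * K0 + C)"
  proof (rule eventually_mono)
    fix n assume close: "D (bdry_act (g ^^ n) \<gamma>) \<alpha> < b powr (- T) / Q"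
    let ?h = "g ^^ n" and ?y = "ginv (g ^^ n) p"
    have hG: "?h \<in> G" using g by (rule G_funpow)
    have ha: "?h \<circ> a \<in> \<alpha>" and hc: "?h \<circ> c \<in> \<beta>"
      using bdry_act_mem[OF a, of ?h] bdry_act_mem[OF c, of ?h] bdry_act_funpow \<alpha>(2) \<beta>(2) by metis+
    have "\<forall>\<^sub>F k in sequentially. gp ((?h \<circ> e) k) ((?h \<circ> a) k) > T"
      using close by (intro D_less[OF bdry_act_in[OF hG \<gamma>(1)] \<alpha>(1) bdry_act_mem[OF e] ha])
    moreover note K0[OF ha hc] K0[OF a c] K1[OF e a]
    ultimately show "\<forall>\<^sub>F k in sequentially. gp (c k) ?y \<ge> len ?h - (2 * K0 + C)"
    proof eventually_elim
      case (elim k)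
      have 1: "gp (?h (x)) (?h z) = len ?h - gp x ?y - gp z ?y + gp x z" for x z
        using gp_isom[OF hG, of x z] gromov_prod_change_base[of ?y x z p] len_ginv[OF hG] by simp
      have 2: "gp (a k) ?y + gp (c k) ?y \<ge> len ?h - K0"
        using 1[of "a k" "c k"] elim gromov_prod_nonneg[of p "a k" "c k"] unfolding o_apply by linarith
      have 3: "gp (a k) ?y \<le> K0 + C \<or> gp (c k) ?y \<le> K0 + C"
        using hyp[of "a k" ?y "c k"] elim by (auto simp: min_def gromov_prod_commute[of p ?y] split: if_splits)
      have 4: "T < len ?h - gp (a k) ?y + K1"
        using 1[of "e k" "a k"] elim gromov_prod_nonneg[of p "e k" ?y] unfolding o_apply by linarith
      show ?case using 2 3 4 unfolding T_def by linarith
    qed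
  qed
  then show ?thesis by blast
qed

text \<open>Otherwise strong discreteness makes one power \<open>g ^^ n0\<close> equal to infinitely
  many others. The attraction then puts \<open>bdry_act (g ^^ n0) \<gamma>\<close> at distance 0
  from \<alpha>, so that \<gamma> and the fixed point \<alpha> have the same image.\<close>

lemma attract_len:
  assumes g: "g \<in> G" and sd: "strongly_discrete p G" and att: "iterates_attract p D g \<alpha> \<beta>"
    and fp: "\<alpha> \<in> bdry_fixed_points p g" "\<beta> \<in> bdry_fixed_points p g"
    and \<gamma>: "\<gamma> \<in> gromov_boundary p" "\<gamma> \<noteq> \<alpha>" "\<gamma> \<noteq> \<beta>"
  shows "\<forall>\<^sub>F n in sequentially. len (g ^^ n) > R"
proof (rule ccontr)
  assume "\<not> ?thesis"
  then have fr: "\<exists>\<^sub>F n in sequentially. len (g ^^ n) \<le> max R 1"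
    by (auto simp: not_eventually not_less elim: frequently_elim1)
  define A where "A = {n. len (g ^^ n) \<le> max R 1}"
  have inf: "infinite A"
    using fr unfolding A_def by (simp add: frequently_cofinite flip: cofinite_eq_sequentially)
  have "finite {h\<in>G. len h \<le> max R 1}"
    by (rule finite_len_le[OF sd])
  then have "finite ((\<lambda>n. g ^^ n) ` A)"
    by (rule finite_subset[rotated]) (use G_funpow[OF g] in \<open>auto simp: A_def\<close>)
  then obtain n0 where n0: "infinite {n\<in>A. g ^^ n = g ^^ n0}"
    using pigeonhole_infinite[OF inf] by blast
  have \<alpha>: "\<alpha> \<in> gromov_boundary p" "bdry_act g \<alpha> = \<alpha>" and \<beta>: "\<beta> \<in> gromov_boundary p"
    using fp by (auto simp: bdry_fixed_points_def)
  let ?z = "bdry_act (g ^^ n0) \<gamma>"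
  have z: "?z \<in> gromov_boundary p" using bdry_act_in[OF G_funpow[OF g] \<gamma>(1)] .
  have "D ?z \<alpha> < e" if "e > 0" for e
  proof -
    have "\<forall>\<^sub>F n in sequentially. D (bdry_act (g ^^ n) \<gamma>) \<alpha> < e"
      by (rule attract_eventually[OF att \<beta> \<gamma>(1) \<gamma>(3) that])
    then obtain N where N: "\<And>n. n \<ge> N \<Longrightarrow> D (bdry_act (g ^^ n) \<gamma>) \<alpha> < e"
      unfolding eventually_sequentially by blast
    obtain n where "n \<ge> N" "g ^^ n = g ^^ n0"
      using n0 unfolding infinite_nat_iff_unbounded_le by blast
    then show ?thesis using N[of n] by simp
  qed
  from this[of "D ?z \<alpha>"] have "?z = \<alpha>"
    using bdry.mdist_pos_less[OF _ z \<alpha>(1)] by blast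
  then have "?z = bdry_act (g ^^ n0) \<alpha>" using bdry_act_funpow[OF \<alpha>(2)] by simp
  then show False using bdry_act_inj[OF G_funpow[OF g]] \<gamma>(2) by blast
qed

definition points_to :: "(nat \<Rightarrow> 'x) \<Rightarrow> real \<Rightarrow> 'x \<Rightarrow> bool" where
  "points_to x K y \<longleftrightarrow> (\<forall>\<^sub>F k in sequentially. gp (x k) y \<ge> dist p y - K)"

lemma points_to_mono: "points_to x K y \<Longrightarrow> K \<le> K' \<Longrightarrow> points_to x K' y"
  unfolding points_to_def by (auto elim: eventually_mono)

lemma points_to_gp:
  assumes "points_to x K y" "points_to x' K y'" "\<forall>\<^sub>F k in sequentially. gp (x k) (x' k) \<le> L"
    and "dist p y > K + L + 2 * C" "dist p y' > K + L + 2 * C"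
  shows "gp y y' \<le> L + 2 * C"
proof -
  have "\<forall>\<^sub>F k in sequentially. gp y y' \<le> L + 2 * C"
    using assms(1,2,3) unfolding points_to_def
  proof eventually_elim
    case (elim k)
    then show ?case
      using hyp2[of "x k" y y' "x' k"] assms(4,5)
      by (auto simp: min_def gromov_prod_commute[of p y'] split: if_splits)
  qed
  then show ?thesis using eventually_happens'[OF sequentially_bot] by blast
qed

text \<open>The definition of a loxodromic isometry only speaks of the boundary; here it becomes
  information on the orbit of \<open>p\<close>. The point \<gamma> that is not fixed serves as the
  third boundary point which tells the two ends apart.\<close>

lemma loxodromic_ends:
  assumes g: "g \<in> G" and sd: "strongly_discrete p G" and lox: "loxodromic p D g"
    and h: "\<gamma> \<in> gromov_boundary p" "\<gamma> \<notin> bdry_fixed_points p g"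
  shows "\<exists>\<alpha>\<in>bdry_fixed_points p g. \<exists>\<beta>\<in>bdry_fixed_points p g. \<exists>x\<in>\<alpha>. \<exists>y\<in>\<beta>. \<exists>K. \<alpha> \<noteq> \<beta> \<and>
    (\<forall>R. \<forall>\<^sub>F n in sequentially. len (g ^^ n) > R \<and> points_to x K ((g ^^ n) p) \<and>
       points_to y K (ginv (g ^^ n) p))"
proof -
  obtain \<alpha> \<beta> where fp: "\<alpha> \<in> bdry_fixed_points p g" "\<beta> \<in> bdry_fixed_points p g" and neq: "\<alpha> \<noteq> \<beta>"
    and att: "iterates_attract p D g \<alpha> \<beta>" and att': "iterates_attract p D (inv\<^bsub>isom_group\<^esub> g) \<beta> \<alpha>"
    and gI: "g \<in> carrier isom_group"
    using lox unfolding loxodromic_def by blast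
  have att2: "iterates_attract p D (ginv g) \<beta> \<alpha>" using att' isom_inv_eq[OF gI] by simp
  have fp': "\<alpha> \<in> bdry_fixed_points p (ginv g)" "\<beta> \<in> bdry_fixed_points p (ginv g)"
    using fp bdry_act_ginv[OF g] by (auto simp: bdry_fixed_points_def)
  have \<gamma>: "\<gamma> \<noteq> \<alpha>" "\<gamma> \<noteq> \<beta>" using h fp by auto
  obtain x where x: "x \<in> \<alpha>" using fp(1) bdryE unfolding bdry_fixed_points_def by blast
  obtain y where y: "y \<in> \<beta>" using fp(2) bdryE unfolding bdry_fixed_points_def by blast
  obtain K1 where K1: "\<forall>\<^sub>F n in sequentially. \<forall>\<^sub>F k in sequentially.
      gp (y k) (ginv (g ^^ n) p) \<ge> len (g ^^ n) - K1"
    using attract_direction[OF g att fp neq h(1) \<gamma> y] by blast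
  obtain K2 where "\<forall>\<^sub>F n in sequentially. \<forall>\<^sub>F k in sequentially.
      gp (x k) (ginv (ginv g ^^ n) p) \<ge> len (ginv g ^^ n) - K2"
    using attract_direction[OF G_inv[OF g] att2 fp'(2,1) neq[symmetric] h(1) \<gamma>(2,1) x] by blast
  then have K2: "\<forall>\<^sub>F n in sequentially. \<forall>\<^sub>F k in sequentially.
      gp (x k) ((g ^^ n) p) \<ge> len (g ^^ n) - K2"
    using G_funpow[OF g] by (simp add: ginv_funpow[OF g, symmetric] ginv_ginv len_ginv)
  define K where "K = max K1 K2"
  have "\<forall>\<^sub>F n in sequentially. len (g ^^ n) > R \<and> points_to x K ((g ^^ n) p) \<and>
       points_to y K (ginv (g ^^ n) p)" for R
    using attract_len[OF g sd att fp h(1) \<gamma>, of R] K1 K2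
  proof eventually_elim
    case (elim n)
    have "points_to x K2 ((g ^^ n) p)" "points_to y K1 (ginv (g ^^ n) p)"
      using elim len_ginv[OF G_funpow[OF g, of n]] by (simp_all add: points_to_def)
    then show ?case using elim by (auto simp: K_def intro: points_to_mono)
  qed
  then show ?thesis using fp x y neq by blast
qed

text \<open>\<open>K\<close> is fixed before \<open>R\<close>, so the two elements can be made long
  in comparison with all their overlaps. Each overlap is controlled by the product of two of the
  four distinct ends, and high powers of both isometries point to these ends.\<close>

lemma general_type_independent:
  assumes sd: "strongly_discrete p G" and gt: "general_type p D G"
  shows "\<exists>K\<ge>0. \<forall>R. \<exists>u\<in>G. \<exists>v\<in>G. len u > R \<and> len v > R \<and>
    gp (u p) (ginv u p) \<le> K \<and> gp (v p) (ginv v p) \<le> K \<and> gp (u p) (v p) \<le> K \<and>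
    gp (ginv u p) (ginv v p) \<le> K \<and> gp (u p) (ginv v p) \<le> K \<and> gp (v p) (ginv u p) \<le> K"
proof -
  obtain g h where g: "g \<in> G" "loxodromic p D g" and h: "h \<in> G" "loxodromic p D h"
    and disj: "bdry_fixed_points p g \<inter> bdry_fixed_points p h = {}"
    using gt unfolding general_type_def by blast
  obtain \<gamma> where \<gamma>: "\<gamma> \<in> bdry_fixed_points p h" using h(2) unfolding loxodromic_def by blast
  obtain \<gamma>' where \<gamma>': "\<gamma>' \<in> bdry_fixed_points p g" using g(2) unfolding loxodromic_def by blast
  have \<gamma>1: "\<gamma> \<in> gromov_boundary p" "\<gamma> \<notin> bdry_fixed_points p g"
    and \<gamma>2: "\<gamma>' \<in> gromov_boundary p" "\<gamma>' \<notin> bdry_fixed_points p h"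
    using \<gamma> \<gamma>' disj unfolding bdry_fixed_points_def by auto
  obtain \<alpha>1 \<beta>1 x1 y1 Kg where 1: "\<alpha>1 \<in> bdry_fixed_points p g" "\<beta>1 \<in> bdry_fixed_points p g"
      "x1 \<in> \<alpha>1" "y1 \<in> \<beta>1" "\<alpha>1 \<noteq> \<beta>1"
    and ev1: "\<And>R. \<forall>\<^sub>F n in sequentially. len (g ^^ n) > R \<and> points_to x1 Kg ((g ^^ n) p) \<and>
       points_to y1 Kg (ginv (g ^^ n) p)"
    using loxodromic_ends[OF g(1) sd g(2) \<gamma>1] by blast
  obtain \<alpha>2 \<beta>2 x2 y2 Kh where 2: "\<alpha>2 \<in> bdry_fixed_points p h" "\<beta>2 \<in> bdry_fixed_points p h"
      "x2 \<in> \<alpha>2" "y2 \<in> \<beta>2" "\<alpha>2 \<noteq> \<beta>2"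
    and ev2: "\<And>R. \<forall>\<^sub>F n in sequentially. len (h ^^ n) > R \<and> points_to x2 Kh ((h ^^ n) p) \<and>
       points_to y2 Kh (ginv (h ^^ n) p)"
    using loxodromic_ends[OF h(1) sd h(2) \<gamma>2] by blast
  have bd: "\<alpha>1 \<in> gromov_boundary p" "\<beta>1 \<in> gromov_boundary p" "\<alpha>2 \<in> gromov_boundary p" "\<beta>2 \<in> gromov_boundary p"
    using 1 2 by (auto simp: bdry_fixed_points_def)
  have neq: "\<alpha>1 \<noteq> \<alpha>2" "\<alpha>1 \<noteq> \<beta>2" "\<beta>1 \<noteq> \<beta>2" "\<alpha>2 \<noteq> \<beta>1"
    using 1 2 disj by auto
  have bounded: "\<exists>L\<ge>0. \<forall>\<^sub>F k in sequentially. gp (x k) (y k) \<le> L"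
    if "\<xi> \<in> gromov_boundary p" "\<eta> \<in> gromov_boundary p" "\<xi> \<noteq> \<eta>" "x \<in> \<xi>" "y \<in> \<eta>" for \<xi> \<eta> x y
    using distinct_bounded[OF that(1-3)] that(4,5) by blast
  obtain L1 where L1: "L1 \<ge> 0" "\<forall>\<^sub>F k in sequentially. gp (x1 k) (y1 k) \<le> L1"
    using bounded[OF bd(1,2) 1(5,3,4)] by blast
  obtain L2 where L2: "L2 \<ge> 0" "\<forall>\<^sub>F k in sequentially. gp (x2 k) (y2 k) \<le> L2"
    using bounded[OF bd(3,4) 2(5,3,4)] by blast
  obtain L3 where L3: "L3 \<ge> 0" "\<forall>\<^sub>F k in sequentially. gp (x1 k) (x2 k) \<le> L3"
    using bounded[OF bd(1,3) neq(1) 1(3) 2(3)] by blast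
  obtain L4 where L4: "L4 \<ge> 0" "\<forall>\<^sub>F k in sequentially. gp (y1 k) (y2 k) \<le> L4"
    using bounded[OF bd(2,4) neq(3) 1(4) 2(4)] by blast
  obtain L5 where L5: "L5 \<ge> 0" "\<forall>\<^sub>F k in sequentially. gp (x1 k) (y2 k) \<le> L5"
    using bounded[OF bd(1,4) neq(2) 1(3) 2(4)] by blast
  obtain L6 where L6: "L6 \<ge> 0" "\<forall>\<^sub>F k in sequentially. gp (x2 k) (y1 k) \<le> L6"
    using bounded[OF bd(3,2) neq(4) 2(3) 1(4)] by blast
  define L where "L = L1 + L2 + L3 + L4 + L5 + L6"
  define K where "K = max Kg Kh"
  have mono: "\<forall>\<^sub>F k in sequentially. f k \<le> L"
    if "\<forall>\<^sub>F k in sequentially. f k \<le> L'" "L' \<le> L" for f :: "nat \<Rightarrow> real" and L'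
    using that(1) by (rule eventually_mono) (use that(2) in simp)
  have "L1 \<le> L" "L2 \<le> L" "L3 \<le> L" "L4 \<le> L" "L5 \<le> L" "L6 \<le> L"
    using L1(1) L2(1) L3(1) L4(1) L5(1) L6(1) by (simp_all add: L_def)
  note L = mono[OF L1(2) this(1)] mono[OF L2(2) this(2)] mono[OF L3(2) this(3)]
    mono[OF L4(2) this(4)] mono[OF L5(2) this(5)] mono[OF L6(2) this(6)]
  show ?thesis
  proof (intro exI[of _ "L + 2 * C"] conjI allI)
    show "0 \<le> L + 2 * C" using L1 L2 L3 L4 L5 L6 C_nonneg by (simp add: L_def)
    fix R
    define R' where "R' = max R (K + L + 2 * C)"
    have "\<forall>\<^sub>F n in sequentially. (len (g ^^ n) > R' \<and> points_to x1 Kg ((g ^^ n) p) \<and>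
       points_to y1 Kg (ginv (g ^^ n) p)) \<and> (len (h ^^ n) > R' \<and> points_to x2 Kh ((h ^^ n) p) \<and>
       points_to y2 Kh (ginv (h ^^ n) p))"
      by (rule eventually_conj[OF ev1 ev2])
    then obtain n where n: "len (g ^^ n) > R'" "points_to x1 Kg ((g ^^ n) p)"
        "points_to y1 Kg (ginv (g ^^ n) p)" "len (h ^^ n) > R'" "points_to x2 Kh ((h ^^ n) p)"
        "points_to y2 Kh (ginv (h ^^ n) p)"
      using eventually_happens'[OF sequentially_bot] by blast
    define u where "u = g ^^ n"
    define v where "v = h ^^ n"
    have uG: "u \<in> G" and vG: "v \<in> G" using g h G_funpow by (auto simp: u_def v_def)
    have pt: "points_to x1 K (u p)" "points_to y1 K (ginv u p)" "points_to x2 K (v p)"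
        "points_to y2 K (ginv v p)"
      using n by (auto simp: u_def v_def K_def intro: points_to_mono)
    have len: "len u > R" "len u > K + L + 2 * C" "len v > R" "len v > K + L + 2 * C"
      using n by (auto simp: u_def v_def R'_def)
    have len': "len (ginv u) > K + L + 2 * C" "len (ginv v) > K + L + 2 * C"
      using len len_ginv uG vG by auto
    show "\<exists>u\<in>G. \<exists>v\<in>G. len u > R \<and> len v > R \<and>
        gp (u p) (ginv u p) \<le> L + 2 * C \<and> gp (v p) (ginv v p) \<le> L + 2 * C \<and> gp (u p) (v p) \<le> L + 2 * C \<and>
        gp (ginv u p) (ginv v p) \<le> L + 2 * C \<and> gp (u p) (ginv v p) \<le> L + 2 * C \<and> gp (v p) (ginv u p) \<le> L + 2 * C"
      by (rule bexI[OF _ uG], rule bexI[OF _ vG])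
         (intro conjI len points_to_gp[OF pt(1,2) L(1) len(2) len'(1)]
           points_to_gp[OF pt(3,4) L(2) len(4) len'(2)] points_to_gp[OF pt(1,3) L(3) len(2,4)]
           points_to_gp[OF pt(2,4) L(4) len'] points_to_gp[OF pt(1,4) L(5) len(2) len'(2)]
           points_to_gp[OF pt(3,2) L(6) len(4) len'(1)])
  qed
qed

end

section \<open>Avoiding obstacles in a tree\<close>

lemma sum_of_bool_le_1:
  assumes "finite A" "\<And>x y. x \<in> A \<Longrightarrow> y \<in> A \<Longrightarrow> P x \<Longrightarrow> P y \<Longrightarrow> x = y"
  shows "(\<Sum>x\<in>A. of_bool (P x) :: ennreal) \<le> of_bool (\<exists>x\<in>A. P x)"
proof (cases "\<exists>x\<in>A. P x")
  case True
  then obtain z where z: "z \<in> A" "P z" by blast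
  have "P x \<longleftrightarrow> x = z" if "x \<in> A" for x
    using assms(2)[OF that z(1) _ z(2)] z by blast
  then have "(\<Sum>x\<in>A. of_bool (P x) :: ennreal) = (\<Sum>x\<in>A. if x = z then 1 else 0)"
    by (intro sum.cong) simp_all
  also have "\<dots> = 1" using assms(1) z by simp
  finally show ?thesis using True by simp
next
  case False
  then have "(\<Sum>x\<in>A. of_bool (P x) :: ennreal) = 0" by (intro sum.neutral) auto
  then show ?thesis by simp
qed

text \<open>An obstacle is started anew at each prefix of a word and its weight grows by a factor \<open>\<theta>\<close> with
  each letter for which it is followed. Since it is followed into at most one child of a vertex,
  the weights inherited by the children add up to at most \<open>\<theta>\<close> times the potential of the vertex;
  as \<open>\<theta>\<close> is small compared with the number of children, most of them have a small potential.\<close>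

locale obstacles =
  fixes S :: "'s set" and I :: "'q set" and hit :: "'q \<Rightarrow> 's list \<Rightarrow> bool"
    and c :: "'q \<Rightarrow> ennreal" and \<theta> :: ennreal
  assumes finite_S: "finite S"
    and hit_unique: "\<And>q u v. q \<in> I \<Longrightarrow> hit q u \<Longrightarrow> hit q v \<Longrightarrow> set u \<subseteq> S \<Longrightarrow> set v \<subseteq> S \<Longrightarrow>
          length u = length v \<Longrightarrow> u = v"
    and hit_butlast: "\<And>q v s. q \<in> I \<Longrightarrow> hit q (v @ [s]) \<Longrightarrow> set v \<subseteq> S \<Longrightarrow> s \<in> S \<Longrightarrow> hit q v"
    and cost: "(\<integral>\<^sup>+q. c q \<partial>count_space I) \<le> ennreal (1 / 2)"
begin

definition weight :: "'q \<Rightarrow> 's list \<Rightarrow> ennreal" where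
  "weight q w = (\<Sum>i\<le>length w. \<theta> ^ (length w - i) * of_bool (hit q (drop i w)))"

definition potential :: "'s list \<Rightarrow> ennreal" where
  "potential w = (\<integral>\<^sup>+q. c q * weight q w \<partial>count_space I)"

definition next_weight :: "'q \<Rightarrow> 's list \<Rightarrow> 's \<Rightarrow> ennreal" where
  "next_weight q w s = (\<Sum>i\<le>length w. \<theta> ^ (length w - i) * of_bool (hit q (drop i w @ [s])))"

text \<open>The summand 1 accounts for the obstacle started anew at the new vertex; every earlier
  start gains one factor \<theta>.\<close>

lemma weight_snoc: "weight q (w @ [s]) \<le> 1 + \<theta> * next_weight q w s"
proof -
  have "weight q (w @ [s]) = (\<Sum>i\<le>length w. \<theta> ^ (Suc (length w) - i) * of_bool (hit q (drop i w @ [s])))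
      + of_bool (hit q [])"
    by (simp add: weight_def)
  also have "(\<Sum>i\<le>length w. \<theta> ^ (Suc (length w) - i) * of_bool (hit q (drop i w @ [s])))
      = \<theta> * next_weight q w s"
    unfolding next_weight_def sum_distrib_left
    by (intro sum.cong) (auto simp: Suc_diff_le mult.assoc)
  also have "\<theta> * next_weight q w s + of_bool (hit q []) \<le> \<theta> * next_weight q w s + 1"
    by (intro add_left_mono) auto
  finally show ?thesis by (simp add: add.commute)
qed

lemma sum_next_weight:
  assumes "q \<in> I" "set w \<subseteq> S" shows "(\<Sum>s\<in>S. next_weight q w s) \<le> weight q w"
proof -
  have "(\<Sum>s\<in>S. next_weight q w s) =
      (\<Sum>i\<le>length w. \<theta> ^ (length w - i) * (\<Sum>s\<in>S. of_bool (hit q (drop i w @ [s]))))"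
    unfolding next_weight_def by (subst sum.swap) (simp add: sum_distrib_left)
  also have "\<dots> \<le> weight q w"
    unfolding weight_def
  proof (intro sum_mono mult_left_mono)
    fix i
    have sub: "set (drop i w) \<subseteq> S" using assms(2) set_drop_subset[of i w] by blast
    have "(\<Sum>s\<in>S. of_bool (hit q (drop i w @ [s])) :: ennreal) \<le> of_bool (\<exists>s\<in>S. hit q (drop i w @ [s]))"
      using hit_unique[OF assms(1)] sub by (intro sum_of_bool_le_1 finite_S) force
    also have "\<dots> \<le> of_bool (hit q (drop i w))"
      using hit_butlast[OF assms(1)] sub by auto
    finally show "(\<Sum>s\<in>S. of_bool (hit q (drop i w @ [s])) :: ennreal) \<le> of_bool (hit q (drop i w))" .
  qed simp
  finally show ?thesis .
qed

lemma potential_Nil: "potential [] \<le> 1"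
proof -
  have "potential [] \<le> (\<integral>\<^sup>+q. c q \<partial>count_space I)"
    unfolding potential_def weight_def by (intro nn_integral_mono) (auto simp: of_bool_def)
  also have "\<dots> \<le> ennreal 1" using cost by (rule order_trans) (rule ennreal_leI, simp)
  finally show ?thesis by (simp only: ennreal_1)
qed

text \<open>Fresh starts contribute at most 1/2, so a child is lost only if its inherited share
  \<open>\<theta> * \<psi> s\<close> is at least 1/2. The \<open>\<psi> s\<close> add up to at most
  1, and with \<theta> equal to \<open>m / 2\<close> this can happen for at most \<open>m\<close>
  children.\<close>

lemma card_small_potential:
  assumes w: "set w \<subseteq> S" "potential w \<le> 1" and \<theta>: "\<theta> = ennreal (real m / 2)"
    and card: "card S \<ge> 2 * m"
  shows "card {s\<in>S. potential (w @ [s]) \<le> 1} \<ge> m"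
proof -
  define \<psi> where "\<psi> s = (\<integral>\<^sup>+q. c q * next_weight q w s \<partial>count_space I)" for s
  have "(\<Sum>s\<in>S. \<psi> s) = (\<integral>\<^sup>+q. (\<Sum>s\<in>S. c q * next_weight q w s) \<partial>count_space I)"
    unfolding \<psi>_def by (subst nn_integral_sum) auto
  also have "\<dots> \<le> potential w"
    unfolding potential_def
    by (intro nn_integral_mono)
       (auto simp flip: sum_distrib_left intro!: mult_left_mono sum_next_weight w)
  finally have sum_\<psi>: "(\<Sum>s\<in>S. \<psi> s) \<le> 1" using w(2) by simp
  have pot: "potential (w @ [s]) \<le> ennreal (1 / 2) + \<theta> * \<psi> s" for s
  proof -
    have "potential (w @ [s]) \<le> (\<integral>\<^sup>+q. c q + \<theta> * (c q * next_weight q w s) \<partial>count_space I)"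
      unfolding potential_def
    proof (rule nn_integral_mono)
      fix q
      have "c q * weight q (w @ [s]) \<le> c q * (1 + \<theta> * next_weight q w s)"
        by (intro mult_left_mono weight_snoc) auto
      then show "c q * weight q (w @ [s]) \<le> c q + \<theta> * (c q * next_weight q w s)"
        by (simp add: distrib_left mult.left_commute)
    qed
    also have "\<dots> = (\<integral>\<^sup>+q. c q \<partial>count_space I) + \<theta> * \<psi> s"
      unfolding \<psi>_def by (subst nn_integral_add) (auto simp: nn_integral_cmult)
    finally show ?thesis using cost by (meson add_right_mono order_trans)
  qed
  define B where "B = {s\<in>S. \<not> potential (w @ [s]) \<le> 1}"
  have finB: "finite B" using finite_S by (simp add: B_def)
  have "ennreal (1 / 2) \<le> \<theta> * \<psi> s" if "s \<in> B" for s
  proof (rule ccontr)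
    assume "\<not> ?thesis"
    then have "ennreal (1 / 2) + \<theta> * \<psi> s \<le> ennreal (1 / 2) + ennreal (1 / 2)"
      by (intro add_left_mono) auto
    also have "\<dots> = 1" by (subst ennreal_plus[symmetric]) simp_all
    finally show False using pot[of s] that by (auto simp: B_def)
  qed
  then have "(\<Sum>s\<in>B. ennreal (1 / 2)) \<le> (\<Sum>s\<in>B. \<theta> * \<psi> s)" by (rule sum_mono)
  also have "\<dots> \<le> (\<Sum>s\<in>S. \<theta> * \<psi> s)"
    using finite_S by (intro sum_mono2) (auto simp: B_def)
  also have "\<dots> = \<theta> * (\<Sum>s\<in>S. \<psi> s)" by (simp add: sum_distrib_left)
  also have "\<dots> \<le> \<theta>" using sum_\<psi> mult_left_mono[OF sum_\<psi>, of \<theta>] by simp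
  also have "(\<Sum>s\<in>B. ennreal (1 / 2)) = ennreal (real (card B) / 2)"
    by (subst sum_ennreal) simp_all
  finally have "card B \<le> m" by (simp add: \<theta>)
  moreover have "card S = card {s\<in>S. potential (w @ [s]) \<le> 1} + card B"
    unfolding B_def using finite_S by (subst card_Un_disjoint[symmetric]) (auto intro: arg_cong[of _ _ card])
  ultimately show ?thesis using card by linarith
qed

text \<open>One term cannot exceed the whole potential. On surviving words this limits how long any
  obstacle is followed, wherever it was started.\<close>

lemma cost_bound:
  assumes "potential w \<le> 1" "q \<in> I" "i \<le> length w" "hit q (drop i w)"
  shows "c q * \<theta> ^ (length w - i) \<le> 1"
proof -
  have "\<theta> ^ (length w - i) = \<theta> ^ (length w - i) * of_bool (hit q (drop i w))"
    using assms(4) by simp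
  also have "\<dots> \<le> weight q w"
    unfolding weight_def
    by (rule member_le_sum[of i "{..length w}" "\<lambda>i. \<theta> ^ (length w - i) * of_bool (hit q (drop i w))"])
       (use assms(3) in auto)
  finally have "c q * \<theta> ^ (length w - i) \<le> c q * weight q w" by (rule mult_left_mono) simp
  also have "\<dots> \<le> potential w"
    unfolding potential_def using assms(2) by (rule nn_integral_ge_point)
  finally show ?thesis using assms(1) by simp
qed

end

section \<open>Branches of a tree indexed by expansions in base \<open>m\<close>\<close>

context
  fixes m :: nat and ch :: "'s list \<Rightarrow> nat \<Rightarrow> 's"
begin

definition digit :: "real \<Rightarrow> nat \<Rightarrow> nat" where
  "digit x j = nat (\<lfloor>real m ^ Suc j * x\<rfloor> mod int m)"

fun digit_word :: "real \<Rightarrow> nat \<Rightarrow> 's list" where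
  "digit_word x 0 = []"
| "digit_word x (Suc j) = digit_word x j @ [ch (digit_word x j) (digit x j)]"

lemma length_digit_word [simp]: "length (digit_word x j) = j"
  by (induction j) auto

lemma digit_less: "m > 0 \<Longrightarrow> digit x j < m"
  by (simp add: digit_def nat_less_iff)

lemma digit_floor:
  assumes "m > 0"
  shows "\<lfloor>real m ^ Suc j * x\<rfloor> = int m * \<lfloor>real m ^ j * x\<rfloor> + int (digit x j)"
proof -
  have "\<lfloor>real m ^ Suc j * x\<rfloor> div int m = \<lfloor>real m ^ Suc j * x / real_of_int (int m)\<rfloor>"
    by (subst floor_divide_real_eq_div) auto
  also have "real m ^ Suc j * x / real_of_int (int m) = real m ^ j * x"
    using assms by simp
  finally have "\<lfloor>real m ^ Suc j * x\<rfloor> = int m * \<lfloor>real m ^ j * x\<rfloor> + \<lfloor>real m ^ Suc j * x\<rfloor> mod int m"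
    by (metis mult_div_mod_eq)
  then show ?thesis using assms by (simp add: digit_def)
qed

lemma digit_word_eqD:
  assumes m: "m > 0" and x: "x \<in> {0..<1}" and y: "y \<in> {0..<1}"
    and inj: "\<And>i. inj_on (ch (digit_word x i)) {..<m}"
    and eq: "digit_word x j = digit_word y j"
  shows "\<lfloor>real m ^ j * x\<rfloor> = \<lfloor>real m ^ j * y\<rfloor>"
  using eq
proof (induction j)
  case 0
  have "\<lfloor>x\<rfloor> = 0" "\<lfloor>y\<rfloor> = 0" using x y by (auto simp: floor_eq_iff)
  then show ?case by simp
next
  case (Suc j)
  then have "digit_word x j = digit_word y j" "ch (digit_word x j) (digit x j) = ch (digit_word x j) (digit y j)"
    by auto
  moreover from this have "digit x j = digit y j"
    using inj_onD[OF inj] digit_less[OF m] by blast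
  ultimately show ?case using Suc.IH digit_floor[OF m] by metis
qed

text \<open>Since the selected children are distinct, a common word of length \<open>k\<close> puts
  both numbers into one interval of length m^-k. Distinct numbers must therefore branch, and the
  level of the last common vertex bounds their difference.\<close>

lemma digit_word_branch:
  assumes m: "m \<ge> 2" and x: "x \<in> {0..<1}" and y: "y \<in> {0..<1}" and neq: "x \<noteq> y"
    and inj: "\<And>i. inj_on (ch (digit_word x i)) {..<m}"
  obtains k where "digit_word x k = digit_word y k"
    "ch (digit_word x k) (digit x k) \<noteq> ch (digit_word y k) (digit y k)"
    "\<bar>x - y\<bar> \<le> 1 / real m ^ k"
proof -
  have m0: "m > 0" using m by simp
  have close: "\<bar>x - y\<bar> \<le> 1 / real m ^ k" if "digit_word x k = digit_word y k" for k
  proof -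
    have "\<lfloor>real m ^ k * x\<rfloor> = \<lfloor>real m ^ k * y\<rfloor>"
      by (rule digit_word_eqD[OF m0 x y inj that])
    then have "\<bar>real m ^ k * x - real m ^ k * y\<bar> \<le> 1" by linarith
    then have "real m ^ k * \<bar>x - y\<bar> \<le> 1"
      by (simp add: abs_mult flip: right_diff_distrib)
    then show ?thesis using m0 by (simp add: field_simps)
  qed
  have "\<exists>k. digit_word x k \<noteq> digit_word y k"
  proof (rule ccontr)
    assume "\<nexists>k. digit_word x k \<noteq> digit_word y k"
    then have le: "\<bar>x - y\<bar> \<le> 1 / real m ^ k" for k using close by blast
    obtain k where "1 / \<bar>x - y\<bar> < real m ^ k"
      using real_arch_pow[of "real m" "1 / \<bar>x - y\<bar>"] m by auto
    then have "1 / real m ^ k < \<bar>x - y\<bar>"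
      using neq m0 by (simp add: field_simps)
    then show False using le[of k] by simp
  qed
  then obtain k where k: "digit_word x k \<noteq> digit_word y k"
    "\<And>i. i < k \<Longrightarrow> digit_word x i = digit_word y i"
    using exists_least_iff[of "\<lambda>k. digit_word x k \<noteq> digit_word y k"] by auto
  then obtain k' where k': "k = Suc k'" by (cases k) auto
  have eq: "digit_word x k' = digit_word y k'" using k k' by simp
  show thesis
    by (rule that[OF eq _ close[OF eq]]) (use k k' eq in auto)
qed

end

section \<open>Sums over annuli\<close>

lemma nn_integral_layers:
  fixes f :: "'a \<Rightarrow> real" and u :: "nat \<Rightarrow> real"
  assumes r: "0 < r" "r < 1" and f: "\<And>a. a \<in> A \<Longrightarrow> f a \<ge> 0"
    and fin: "\<And>n. finite {a\<in>A. real n \<le> f a \<and> f a < real n + 1}"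
    and card: "\<And>n. real (card {a\<in>A. real n \<le> f a \<and> f a < real n + 1}) * r ^ n \<le> u n"
    and summ: "summable u"
  shows "(\<integral>\<^sup>+a. ennreal (r powr f a) \<partial>count_space A) \<le> ennreal (\<Sum>n. u n)"
proof -
  let ?L = "\<lambda>n. {a\<in>A. real n \<le> f a \<and> f a < real n + 1}"
  have "(\<integral>\<^sup>+a. ennreal (r powr f a) \<partial>count_space A) \<le>
      (\<integral>\<^sup>+a. (\<Sum>n. ennreal (r ^ n) * indicator (?L n) a) \<partial>count_space A)"
  proof (rule nn_integral_mono)
    fix a assume "a \<in> space (count_space A)"
    then have a: "a \<in> A" by simp
    define n where "n = nat \<lfloor>f a\<rfloor>"
    have n: "real n \<le> f a" "f a < real n + 1" using f[OF a] by (auto simp: n_def)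
    have "r powr f a \<le> r powr real n" using r n by (intro powr_mono') auto
    then have "ennreal (r powr f a) \<le> ennreal (r ^ n) * indicator (?L n) a"
      using r n a by (auto simp: powr_realpow intro!: ennreal_leI)
    moreover define g where "g n = ennreal (r ^ n) * indicator (?L n) a" for n
    ultimately have "ennreal (r powr f a) \<le> g n" by (simp only: g_def)
    also have "\<dots> = sum g {n}" by simp
    also have "\<dots> \<le> (\<Sum>n. g n)"
      by (rule sum_le_suminf) auto
    finally have "ennreal (r powr f a) \<le> (\<Sum>n. g n)" .
    then show "ennreal (r powr f a) \<le> (\<Sum>n. ennreal (r ^ n) * indicator (?L n) a)"
      by (simp add: g_def)
  qed
  also have "\<dots> = (\<Sum>n. \<integral>\<^sup>+a. ennreal (r ^ n) * indicator (?L n) a \<partial>count_space A)"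
    by (rule nn_integral_suminf) auto
  also have "\<dots> \<le> (\<Sum>n. ennreal (u n))"
  proof (rule suminf_le)
    fix n
    have "(\<integral>\<^sup>+a. ennreal (r ^ n) * indicator (?L n) a \<partial>count_space A)
        = ennreal (r ^ n) * emeasure (count_space A) (?L n)"
      by (rule nn_integral_cmult_indicator) auto
    also have "emeasure (count_space A) (?L n) = ennreal (real (card (?L n)))"
      using fin[of n] by (subst emeasure_count_space_finite) (auto simp: ennreal_of_nat_eq_real_of_nat)
    also have "ennreal (r ^ n) * \<dots> = ennreal (real (card (?L n)) * r ^ n)"
      using r by (simp add: ennreal_mult mult.commute)
    also have "\<dots> \<le> ennreal (u n)" using card by (rule ennreal_leI)
    finally show "(\<integral>\<^sup>+a. ennreal (r ^ n) * indicator (?L n) a \<partial>count_space A) \<le> ennreal (u n)" .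
  qed auto
  also have "\<dots> = ennreal (\<Sum>n. u n)"
  proof (rule suminf_ennreal2[OF _ summ])
    fix n
    have "0 \<le> real (card (?L n)) * r ^ n" using r by simp
    then show "0 \<le> u n" using card[of n] by linarith
  qed
  finally show ?thesis .
qed

lemma summable_on_layers:
  fixes f :: "'a \<Rightarrow> real" and u :: "nat \<Rightarrow> real"
  assumes "0 < r" "r < 1" "\<And>a. a \<in> A \<Longrightarrow> f a \<ge> 0"
    "\<And>n. finite {a\<in>A. real n \<le> f a \<and> f a < real n + 1}"
    "\<And>n. real (card {a\<in>A. real n \<le> f a \<and> f a < real n + 1}) * r ^ n \<le> u n" "summable u"
  shows "(\<lambda>a. r powr f a) summable_on A"
proof (rule nonneg_bdd_above_summable_on)
  have "0 \<le> u n" for n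
    using assms(1) assms(5)[of n] by (meson less_imp_le mult_nonneg_nonneg of_nat_0_le_iff order_trans zero_le_power)
  then have u: "0 \<le> (\<Sum>n. u n)" using assms(6) by (intro suminf_nonneg)
  show "bdd_above (sum (\<lambda>a. r powr f a) ` {F. F \<subseteq> A \<and> finite F})"
  proof (rule bdd_aboveI2)
    fix F assume "F \<in> {F. F \<subseteq> A \<and> finite F}"
    then have F: "F \<subseteq> A" "finite F" by auto
    have "ennreal (\<Sum>a\<in>F. r powr f a) = (\<Sum>a\<in>F. ennreal (r powr f a))" by simp
    also have "\<dots> = (\<integral>\<^sup>+a. ennreal (r powr f a) \<partial>count_space F)"
      using F by (simp add: nn_integral_count_space_finite)
    also have "\<dots> = (\<integral>\<^sup>+a. ennreal (r powr f a) * indicator F a \<partial>count_space UNIV)"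
      by (rule nn_integral_count_space_indicator) simp
    also have "\<dots> \<le> (\<integral>\<^sup>+a. ennreal (r powr f a) * indicator A a \<partial>count_space UNIV)"
      using F(1) by (intro nn_integral_mono) (auto split: split_indicator)
    also have "\<dots> = (\<integral>\<^sup>+a. ennreal (r powr f a) \<partial>count_space A)"
      by (rule nn_integral_count_space_indicator[symmetric]) simp
    also have "\<dots> \<le> ennreal (\<Sum>n. u n)"
      by (rule nn_integral_layers[OF assms])
    finally show "(\<Sum>a\<in>F. r powr f a) \<le> (\<Sum>n. u n)" using u by (simp add: ennreal_le_iff)
  qed
qed simp

lemma nn_integral_Sigma_le:
  fixes J :: "nat set" and R :: "nat \<Rightarrow> 'a set" and c :: "nat \<times> 'a \<Rightarrow> ennreal"
  assumes "\<And>k. k \<in> J \<Longrightarrow> (\<integral>\<^sup>+h. c (k, h) \<partial>count_space (R k)) \<le> v k"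
  shows "(\<integral>\<^sup>+q. c q \<partial>count_space (Sigma J R)) \<le> (\<Sum>k. v k)"
proof -
  have "(\<integral>\<^sup>+q. c q \<partial>count_space (Sigma J R)) =
      (\<integral>\<^sup>+q. c q * indicator (Sigma J R) q \<partial>count_space UNIV)"
    by (simp add: nn_integral_count_space_indicator)
  also have "\<dots> = (\<integral>\<^sup>+k. \<integral>\<^sup>+h. c (k, h) * indicator (Sigma J R) (k, h) \<partial>count_space UNIV \<partial>count_space UNIV)"
    by (rule nn_integral_fst_count_space[symmetric])
  also have "\<dots> \<le> (\<integral>\<^sup>+k. v k \<partial>count_space UNIV)"
  proof (rule nn_integral_mono)
    fix k
    show "(\<integral>\<^sup>+h. c (k, h) * indicator (Sigma J R) (k, h) \<partial>count_space UNIV) \<le> v k"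
    proof (cases "k \<in> J")
      case True
      then have "(\<integral>\<^sup>+h. c (k, h) * indicator (Sigma J R) (k, h) \<partial>count_space UNIV)
          = (\<integral>\<^sup>+h. c (k, h) * indicator (R k) h \<partial>count_space UNIV)"
        by (intro nn_integral_cong) (auto split: split_indicator)
      also have "\<dots> = (\<integral>\<^sup>+h. c (k, h) \<partial>count_space (R k))"
        by (simp add: nn_integral_count_space_indicator)
      finally show ?thesis using assms[OF True] by simp
    qed simp
  qed
  also have "\<dots> = (\<Sum>k. v k)" by (rule nn_integral_count_space_nat)
  finally show ?thesis .
qed

section \<open>Badly approximable points of a Schottky family\<close>

lemma uniformly_radial_subset: "uniformly_radial_limit_set p G \<subseteq> radial_limit_set p G"
  unfolding uniformly_radial_limit_set_def radial_limit_set_def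
    uniformly_radial_limit_set_at_def radial_limit_set_at_def by blast

locale schottky_visual = schottky p C G S K Lm + visual_action p C G b D
  for p :: "'x::metric_space" and C G S K Lm b D +
  assumes sd: "strongly_discrete p G"
begin

text \<open>Boundedly many returning elements in each annulus give a geometric series of ratio
  \<open>th powr (- 1 / Lm)\<close>, with a bound that does not depend on \<open>x\<close>. Adding 1
  makes \<open>Z\<close> positive.\<close>

lemma cost_summable:
  assumes th: "th > 1" and Lm: "Lm > 0"
  obtains Z where "Z > 0"
    "\<And>x. (\<integral>\<^sup>+h. ennreal (th powr (- len h / Lm)) \<partial>count_space (returning x)) \<le> ennreal Z"
proof -
  define r where "r = th powr (- 1 / Lm)"
  have "th powr (- 1 / Lm) < th powr 0" using th Lm by (intro powr_less_mono) auto
  then have r: "0 < r" "r < 1" using th by (auto simp: r_def)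
  have rp: "th powr (- len h / Lm) = r powr len h" for h :: "'x \<Rightarrow> 'x"
    by (simp add: r_def powr_powr)
  define N where "N = card {g\<in>G. len g \<le> 2 + 2 * Lc + 2 * C}"
  let ?u = "\<lambda>n. real N * r ^ n"
  have summ: "summable ?u" using r by (intro summable_mult summable_geometric) auto
  have nonneg: "0 \<le> (\<Sum>n. ?u n)" using r by (intro suminf_nonneg summ) auto
  show thesis
  proof (rule that[of "(\<Sum>n. ?u n) + 1"])
    fix x
    have "(\<integral>\<^sup>+h. ennreal (r powr len h) \<partial>count_space (returning x)) \<le> ennreal (\<Sum>n. ?u n)"
      using r card_returning[OF sd, where x = x] summ
      by (intro nn_integral_layers) (auto simp: N_def intro!: mult_right_mono)
    also have "\<dots> \<le> ennreal ((\<Sum>n. ?u n) + 1)" by (intro ennreal_leI) simp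
    finally show "(\<integral>\<^sup>+h. ennreal (th powr (- len h / Lm)) \<partial>count_space (returning x))
        \<le> ennreal ((\<Sum>n. ?u n) + 1)" unfolding rp .
  qed (use nonneg in simp)
qed

text \<open>The exponent is arranged so that \<open>cost_bound\<close> turns into the negation of
  the last inequality in \<open>close_approach\<close>, with \<open>e\<close> in the place of the
  error \<open>2 * K2 + 4 * C\<close>. The offset \<open>M k\<close> multiplies all weights
  belonging to index \<open>k\<close> by a common factor and is chosen before the sequences
  \<open>x k\<close>.\<close>

lemma offsets_exist:
  assumes th: "th > 1" and Lm: "Lm > 0"
  shows "\<exists>M :: nat \<Rightarrow> real. (\<forall>k. M k \<ge> 0) \<and>
    (\<forall>J x. (\<integral>\<^sup>+(k, h). ennreal (th powr (1 - (len h + M k - e) / Lm))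
       \<partial>count_space (Sigma J (\<lambda>k. returning (x k)))) \<le> ennreal (1 / 2))"
proof -
  obtain Z where Z: "Z > 0"
    "\<And>x. (\<integral>\<^sup>+h. ennreal (th powr (- len h / Lm)) \<partial>count_space (returning x)) \<le> ennreal Z"
    using cost_summable[OF th Lm] by blast
  \<comment> \<open>The factor by which the weights of index \<open>k\<close> have to shrink for
    their sum to be at most 2^-(k+2); these shares add up to 1/2 over all \<open>k\<close> from
    0.\<close>
  define z where "z k = th powr (1 + e / Lm) * Z * 2 ^ (k + 2)" for k :: nat
  have z: "z k > 0" for k using th Z by (simp add: z_def)
  define M where "M k = Lm * max 0 (log th (z k))" for k
  have "th powr (M k / Lm) \<ge> z k" for k
  proof -
    have "z k = th powr (log th (z k))" using th z by simp
    also have "\<dots> \<le> th powr (M k / Lm)" using th Lm by (intro powr_mono) (auto simp: M_def)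
    finally show ?thesis .
  qed
  then have M: "th powr (1 + e / Lm) * Z * th powr (- (M k / Lm)) \<le> (1 / 2) ^ (k + 2)" for k
    using th by (simp add: z_def powr_minus field_simps)
  show ?thesis
  proof (intro exI[of _ M] conjI allI)
    show "M k \<ge> 0" for k using Lm by (simp add: M_def)
    fix J and x :: "nat \<Rightarrow> nat \<Rightarrow> 'x"
    have 1: "(\<integral>\<^sup>+h. ennreal (th powr (1 - (len h + M k - e) / Lm)) \<partial>count_space (returning (x k)))
        \<le> ennreal ((1 / 2) ^ (k + 2))" for k
    proof -
      let ?a = "th powr (1 + e / Lm) * th powr (- (M k / Lm))"
      have "1 - (len h + M k - e) / Lm = (1 + e / Lm) + (- (M k / Lm)) + (- len h / Lm)" for h :: "'x \<Rightarrow> 'x"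
        using Lm by (simp add: field_simps)
      then have "th powr (1 - (len h + M k - e) / Lm) = ?a * th powr (- len h / Lm)" for h :: "'x \<Rightarrow> 'x"
        by (simp only: powr_add)
      then have "(\<integral>\<^sup>+h. ennreal (th powr (1 - (len h + M k - e) / Lm)) \<partial>count_space (returning (x k)))
        = (\<integral>\<^sup>+h. ennreal ?a * ennreal (th powr (- len h / Lm)) \<partial>count_space (returning (x k)))"
        by (simp only: ennreal_mult powr_ge_zero mult_nonneg_nonneg)
      also have "\<dots> = ennreal ?a * (\<integral>\<^sup>+h. ennreal (th powr (- len h / Lm)) \<partial>count_space (returning (x k)))"
        by (rule nn_integral_cmult) simp
      also have "\<dots> \<le> ennreal ?a * ennreal Z" by (intro mult_left_mono Z(2)) simp
      also have "\<dots> = ennreal (?a * Z)" using Z(1) by (intro ennreal_mult[symmetric]) auto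
      also have "\<dots> \<le> ennreal ((1 / 2) ^ (k + 2))"
        using M[of k] by (intro ennreal_leI) (simp add: mult_ac)
      finally show ?thesis .
    qed
    have "(\<integral>\<^sup>+(k, h). ennreal (th powr (1 - (len h + M k - e) / Lm))
        \<partial>count_space (Sigma J (\<lambda>k. returning (x k)))) \<le> (\<Sum>k. ennreal ((1 / 2) ^ (k + 2)))"
      by (rule nn_integral_Sigma_le) (use 1 in simp)
    also have "\<dots> = ennreal (1 / 2)"
    proof (rule suminf_ennreal_eq)
      have "(\<lambda>k. (1/2) * (1/2 :: real) ^ Suc k) sums ((1/2) * 1)"
        by (intro sums_mult power_half_series)
      then show "(\<lambda>k. (1/2 :: real) ^ (k + 2)) sums (1 / 2)" by (simp add: power2_eq_square)
    qed simp
    finally show "(\<integral>\<^sup>+(k, h). ennreal (th powr (1 - (len h + M k - e) / Lm))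
        \<partial>count_space (Sigma J (\<lambda>k. returning (x k)))) \<le> ennreal (1 / 2)" .
  qed
qed

text \<open>An approximation closer than the constant \<open>b powr (- M) / Q\<close> permits would,
  by \<open>close_approach\<close>, yield a hit that is too long. A larger \<open>M\<close> thus
  only makes the constant worse.\<close>

lemma badly_approximable_endpoint:
  assumes \<omega>: "range \<omega> \<subseteq> S" and \<xi>: "\<xi> \<in> gromov_boundary p" and x: "x \<in> \<xi>" and M: "M \<ge> 0"
    and avoid: "\<And>i j h. h \<in> returning x \<Longrightarrow> i \<le> j \<Longrightarrow> hit (\<lambda>n. h (x n)) (map \<omega> [i..<j]) \<Longrightarrow>
        real (Suc j - i) * Lm \<le> len h + M - 2 * K2 - 4 * C"
  shows "endpoint \<omega> \<in> badly_approximable p b D G \<xi>"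
proof -
  have "D (bdry_act g \<xi>) (endpoint \<omega>) \<ge> b powr (- M) / Q * b powr (- len g)" if g: "g \<in> G" for g
  proof (rule ccontr)
    assume "\<not> ?thesis"
    then have "D (bdry_act g \<xi>) (endpoint \<omega>) < b powr (- (len g + M)) / Q"
      by (simp add: powr_add[symmetric] add.commute)
    from D_less[OF bdry_act_in[OF g \<xi>] endpoint_in_boundary[OF \<omega>] bdry_act_mem[OF x]
        path_in_endpoint[OF \<omega>] this]
    have "\<forall>\<^sub>F n in sequentially. gp (g (x n)) (path \<omega> n) > len g + M" by simp
    from close_approach[OF \<omega> g M this] avoid show False by (metis not_less)
  qed
  moreover have "b powr (- M) / Q > 0" using b Q_ge_1 by simp
  moreover have "endpoint \<omega> \<in> radial_limit_set p G"
    using endpoint_uniformly_radial[OF \<omega>] uniformly_radial_subset by blast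
  ultimately show ?thesis
    unfolding badly_approximable_def by blast
qed

lemma D_branch:
  assumes \<omega>: "range \<omega> \<subseteq> S" "range \<omega>' \<subseteq> S" and eq: "pre \<omega> k = pre \<omega>' k" and neq: "\<omega> k \<noteq> \<omega>' k"
  shows "D (endpoint \<omega>) (endpoint \<omega>') \<ge> b powr (- (real (Suc k) * Lm)) / Q"
proof (rule ccontr)
  assume "\<not> ?thesis"
  then have "\<forall>\<^sub>F n in sequentially. gp (path \<omega> n) (path \<omega>' n) > real (Suc k) * Lm"
    by (intro D_less[OF endpoint_in_boundary[OF \<omega>(1)] endpoint_in_boundary[OF \<omega>(2)]
        path_in_endpoint[OF \<omega>(1)] path_in_endpoint[OF \<omega>(2)]]) simp
  moreover have "\<forall>\<^sub>F n in sequentially. n \<ge> Suc k" by (rule eventually_ge_at_top)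
  ultimately have "\<forall>\<^sub>F n in sequentially. gp (path \<omega> n) (path \<omega>' n) > real (Suc k) * Lm \<and> n \<ge> Suc k"
    by (rule eventually_conj)
  then obtain n where n: "gp (path \<omega> n) (path \<omega>' n) > real (Suc k) * Lm" "n \<ge> Suc k"
    using eventually_happens'[OF sequentially_bot] by blast
  let ?w = "pre \<omega> k"
  have split: "pre \<upsilon> n = pre \<upsilon> k @ \<upsilon> k # map \<upsilon> [Suc k..<n]" for \<upsilon> :: "nat \<Rightarrow> 'x \<Rightarrow> 'x"
    using pre_split[of k n \<upsilon>] n(2) by (simp add: upt_conv_Cons)
  have "gp (wd (?w @ \<omega> k # map \<omega> [Suc k..<n]) p) (wd (?w @ \<omega>' k # map \<omega>' [Suc k..<n]) p)
      \<le> len (wd ?w) + Lm"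
    using \<omega> neq by (intro gp_branch set_pre set_seg) auto
  also have "len (wd ?w) \<le> real k * Lm"
    using len_word_le[OF set_pre[OF \<omega>(1), of k]] by (simp add: pre_def)
  finally have "gp (path \<omega> n) (path \<omega>' n) \<le> real k * Lm + Lm"
    unfolding path_def split[of \<omega>] split[of \<omega>'] eq by simp
  then show False using n(1) by (simp add: algebra_simps)
qed

text \<open>A letter has length at most \<open>Lm\<close>, hence shrinks distances by a factor no
  smaller than \<open>b powr (- Lm)\<close> in the estimate, while \<open>m\<close> children survive
  at each vertex. The assumption \<open>ms\<close> says that this ratio of branching to shrinking is
  worth dimension \<open>s\<close>.\<close>

lemma full_dimension:
  fixes J :: "nat set" and \<xi> :: "nat \<Rightarrow> 'x bdry"
  assumes \<xi>: "\<And>k. k \<in> J \<Longrightarrow> \<xi> k \<in> gromov_boundary p"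
    and m: "m \<ge> 4" and fin: "finite S" and card: "card S \<ge> 2 * m"
    and s: "s > 0" and ms: "real m \<ge> b powr (s * Lm)"
  defines "A \<equiv> (\<Inter>k\<in>J. badly_approximable p b D G (\<xi> k)) \<inter> uniformly_radial_limit_set p G"
  shows "A \<noteq> {} \<and> hausdorff_dim (gromov_boundary p) D A \<ge> ereal s"
proof -
  obtain a where a: "a \<in> S" using card m by fastforce
  have Lm: "Lm > 0" using len_S[OF a] len_S_le[OF a] K_nonneg C_nonneg by linarith
  define th where "th = real m / 2"
  have th: "th > 1" using m by (simp add: th_def)
  define e where "e = 2 * K2 + 4 * C"
  obtain M :: "nat \<Rightarrow> real" where M: "\<forall>k. M k \<ge> 0" and
    Mc: "\<forall>J x. (\<integral>\<^sup>+(k, h). ennreal (th powr (1 - (len h + M k - e) / Lm))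
       \<partial>count_space (Sigma J (\<lambda>k. returning (x k)))) \<le> ennreal (1 / 2)"
    using offsets_exist[OF th Lm, of e] by (elim exE conjE) (rule that)
  have "\<exists>x. x \<in> \<xi> k" if "k \<in> J" for k using bdryE[OF \<xi>[OF that]] by metis
  then obtain x where x: "\<And>k. k \<in> J \<Longrightarrow> x k \<in> \<xi> k" by metis
  define I where "I = Sigma J (\<lambda>k. returning (x k))"
  define c where "c = (\<lambda>(k, h). ennreal (th powr (1 - (len h + M k - e) / Lm)))"
  define ob where "ob = (\<lambda>(k, h). hit (\<lambda>n. h (x k n)))"
  interpret obstacles S I ob c "ennreal th"
  proof
    show "u = v" if "q \<in> I" "ob q u" "ob q v" "set u \<subseteq> S" "set v \<subseteq> S" "length u = length v" for q u v
      using that hit_unique by (auto simp: ob_def split: prod.splits)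
    show "ob q v" if "q \<in> I" "ob q (v @ [t])" "set v \<subseteq> S" "t \<in> S" for q v t
      using that hit_prefix[of _ v "[t]"] by (auto simp: ob_def split: prod.splits)
    show "(\<integral>\<^sup>+q. c q \<partial>count_space I) \<le> ennreal (1 / 2)"
      unfolding c_def I_def by (rule Mc[rule_format])
  qed (rule fin)
  let ?good = "\<lambda>w. set w \<subseteq> S \<and> potential w \<le> 1"
  let ?child = "\<lambda>w. {t\<in>S. potential (w @ [t]) \<le> 1}"
  have "\<exists>f. ?good w \<longrightarrow> inj_on f {..<m} \<and> f ` {..<m} \<subseteq> ?child w" for w
  proof (cases "?good w")
    case True
    then have "card {..<m} \<le> card (?child w)"
      using card_small_potential[of w m, OF _ _ _ card] by (simp add: th_def)
    then show ?thesis
      using card_le_inj[of "{..<m}" "?child w"] fin by auto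
  next
    case False
    then show ?thesis by blast
  qed
  then have "\<exists>ch. \<forall>w. ?good w \<longrightarrow> inj_on (ch w) {..<m} \<and> ch w ` {..<m} \<subseteq> ?child w"
    by (intro choice allI)
  then obtain ch where ch: "\<And>w. ?good w \<Longrightarrow> inj_on (ch w) {..<m} \<and> ch w ` {..<m} \<subseteq> ?child w"
    by blast
  let ?w = "digit_word m ch"
  have good: "set (?w y j) \<subseteq> S \<and> potential (?w y j) \<le> 1" for y j
  proof (induction j)
    case (Suc j)
    have "digit m y j < m" using m by (intro digit_less) simp
    then have "ch (?w y j) (digit m y j) \<in> {t\<in>S. potential (?w y j @ [t]) \<le> 1}"
      using ch[of "?w y j"] Suc by blast
    then show ?case using Suc by simp
  qed (simp add: potential_Nil)
  define \<omega> where "\<omega> y j = ch (?w y j) (digit m y j)" for y j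
  have \<omega>: "range (\<omega> y) \<subseteq> S" for y
  proof clarify
    fix j show "\<omega> y j \<in> S" using good[of y "Suc j"] by (simp add: \<omega>_def)
  qed
  have pre: "pre (\<omega> y) j = ?w y j" for y j
    by (induction j) (simp_all add: pre_Suc \<omega>_def, simp add: pre_def)
  have inj: "inj_on (ch (?w y i)) {..<m}" for y i using ch[OF good] by (rule conjunct1)
  have BA: "endpoint (\<omega> y) \<in> badly_approximable p b D G (\<xi> k)" if k: "k \<in> J" for y k
  proof (rule badly_approximable_endpoint[OF \<omega> \<xi>[OF k] x[OF k] M[rule_format]])
    fix i j h
    assume h: "h \<in> returning (x k)" and ij: "i \<le> j" and hit: "hit (\<lambda>n. h (x k n)) (map (\<omega> y) [i..<j])"
    let ?t = "(len h + M k - e) / Lm"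
    have seg: "map (\<omega> y) [i..<j] = drop i (?w y j)"
      unfolding pre[symmetric] pre_def by (simp add: drop_map)
    have "c (k, h) * ennreal th ^ (j - i) \<le> 1"
      using cost_bound[of "?w y j" "(k, h)" i] good[of y j] k h ij hit
      by (simp add: I_def ob_def seg)
    moreover have "ennreal th ^ (j - i) = ennreal (th powr real (j - i))"
      using th by (simp add: powr_realpow ennreal_power)
    ultimately have "ennreal (th powr (1 - ?t) * th powr real (j - i)) \<le> 1"
      by (simp add: c_def ennreal_mult)
    then have "th powr (1 - ?t + real (j - i)) \<le> th powr 0"
      using th by (simp add: powr_add ennreal_le_1)
    then have "1 - ?t + real (j - i) \<le> 0" using th powr_le_cancel_iff by blast
    then have "real (Suc j - i) \<le> ?t" using ij by (simp add: Suc_diff_le)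
    then show "real (Suc j - i) * Lm \<le> len h + M k - 2 * K2 - 4 * C"
      using Lm by (simp add: e_def field_simps)
  qed
  have inA: "endpoint (\<omega> y) \<in> A" for y
    unfolding A_def using BA endpoint_uniformly_radial[OF \<omega>] by blast
  have "hausdorff_dim (gromov_boundary p) D A \<ge> ereal s"
  proof (rule hausdorff_dim_ge[where K = "real m * Q powr s" and f = "\<lambda>y. endpoint (\<omega> y)"])
    \<comment> \<open>Numbers whose words branch after \<open>k\<close> letters differ by at most
      m^-k, but their endpoints are separated only on the scale of \<open>k + 1\<close> letters: the
      factor \<open>m\<close> compensates for this letter, and \<open>Q powr s\<close> for the
      constant of the visual metric.\<close>
    show "real m * Q powr s > 0" using m Q_ge_1 by simp
    fix y z :: real
    assume yz: "y \<in> {0..<1}" "z \<in> {0..<1}"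
    show "\<bar>y - z\<bar> \<le> real m * Q powr s * D (endpoint (\<omega> y)) (endpoint (\<omega> z)) powr s"
    proof (cases "y = z")
      case False
      have m2: "m \<ge> 2" using m by simp
      obtain k where k: "?w y k = ?w z k" "\<omega> y k \<noteq> \<omega> z k" "\<bar>y - z\<bar> \<le> 1 / real m ^ k"
        unfolding \<omega>_def
        using digit_word_branch[where ch = ch and m = m and x = y and y = z, OF m2 yz False inj] by blast
      have "b powr (- (real (Suc k) * Lm)) / Q \<le> D (endpoint (\<omega> y)) (endpoint (\<omega> z))"
        using k by (intro D_branch \<omega>) (simp_all add: pre)
      then have "(b powr (- (real (Suc k) * Lm)) / Q) powr s \<le> D (endpoint (\<omega> y)) (endpoint (\<omega> z)) powr s"
        using s Q_ge_1 by (intro powr_mono2) auto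
      moreover have "(b powr (- (real (Suc k) * Lm)) / Q) powr s = 1 / ((b powr (s * Lm)) ^ Suc k * Q powr s)"
      proof -
        have "b powr (s * Lm * real (Suc k)) = (b powr (s * Lm)) powr real (Suc k)"
          by (simp only: powr_powr)
        also have "\<dots> = (b powr (s * Lm)) ^ Suc k" by (rule powr_realpow) (use b in simp)
        finally have pow: "b powr (s * Lm * real (Suc k)) = (b powr (s * Lm)) ^ Suc k" .
        have "(b powr (- (real (Suc k) * Lm)) / Q) powr s = (b powr (- (real (Suc k) * Lm))) powr s / Q powr s"
          using Q_ge_1 by (simp add: powr_divide)
        also have "(b powr (- (real (Suc k) * Lm))) powr s = b powr (- (s * Lm * real (Suc k)))"
          by (simp only: powr_powr) (simp add: algebra_simps)
        also have "\<dots> = 1 / (b powr (s * Lm)) ^ Suc k" by (simp only: powr_minus_divide pow)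
        finally show ?thesis by simp
      qed
      moreover have "1 / (real m ^ Suc k * Q powr s) \<le> 1 / ((b powr (s * Lm)) ^ Suc k * Q powr s)"
        using ms b Q_ge_1 m by (intro divide_left_mono mult_right_mono power_mono mult_pos_pos zero_less_power) auto
      ultimately have "1 / (real m ^ Suc k * Q powr s) \<le> D (endpoint (\<omega> y)) (endpoint (\<omega> z)) powr s"
        by linarith
      then have "real m * Q powr s * (1 / (real m ^ Suc k * Q powr s)) \<le>
          real m * Q powr s * D (endpoint (\<omega> y)) (endpoint (\<omega> z)) powr s"
        by (intro mult_left_mono) auto
      moreover have "real m * Q powr s * (1 / (real m ^ Suc k * Q powr s)) = 1 / real m ^ k"
        using m Q_ge_1 by simp
      ultimately show ?thesis using k(3) by linarith
    qed simp
  qed (use s inA in auto)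
  then show ?thesis using inA by blast
qed

end

section \<open>Covering the radial limit set by shadows\<close>

context isometric_action
begin

lemma countable_G:
  assumes "strongly_discrete p G" shows "countable G"
proof -
  have "G = (\<Union>n::nat. {g\<in>G. len g \<le> real n})"
    using real_arch_simple by auto
  moreover have "countable (\<Union>n::nat. {g\<in>G. len g \<le> real n})"
    by (rule countable_UN[OF countableI_type countable_finite[OF finite_len_le[OF assms]]])
  ultimately show ?thesis by simp
qed

text \<open>The infimum supplies a representative with infinitely many good terms, at a loss of 1;
  the Gromov property carries the estimate to all late terms, at a loss of \<open>C\<close>.\<close>

lemma shadow_eventually:
  assumes \<eta>: "\<eta> \<in> gromov_boundary p" and le: "gromov_prod_pb z p \<eta> \<le> ereal \<sigma>"
  obtains x where "x \<in> \<eta>" "\<forall>\<^sub>F n in sequentially. gp (x n) z \<ge> dist p z - \<sigma> - 1 - C"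
proof -
  obtain x where x: "x \<in> \<eta>" and fr: "\<exists>\<^sub>F k in sequentially. gromov_prod z (x k) p < \<sigma> + 1"
    using gromov_prod_pb_leD[OF le, of "\<sigma> + 1"] by auto
  obtain N where N: "\<And>n m. n \<ge> N \<Longrightarrow> m \<ge> N \<Longrightarrow> gp (x n) (x m) \<ge> dist p z - \<sigma> - 1"
    using bdry_close[OF \<eta> x x] by blast
  obtain k where k: "k \<ge> N" "gromov_prod z (x k) p < \<sigma> + 1"
    using fr unfolding frequently_sequentially by blast
  have kz: "gp (x k) z \<ge> dist p z - \<sigma> - 1"
    using k(2) gromov_prod_change_base[of z "x k" p p] by simp
  have "gp (x n) z \<ge> dist p z - \<sigma> - 1 - C" if "n \<ge> N" for n
    using hyp[of "x n" "x k" z] kz N[OF that k(1)] by (auto simp: min_def split: if_splits)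
  then have "\<forall>\<^sub>F n in sequentially. gp (x n) z \<ge> dist p z - \<sigma> - 1 - C"
    unfolding eventually_sequentially by blast
  with x show thesis by (rule that)
qed

end

context visual_action
begin

lemma shadow_diameter:
  assumes "\<eta> \<in> gromov_boundary p" "\<zeta> \<in> gromov_boundary p"
    and "gromov_prod_pb z p \<eta> \<le> ereal \<sigma>" "gromov_prod_pb z p \<zeta> \<le> ereal \<sigma>"
  shows "D \<eta> \<zeta> \<le> Q * b powr (\<sigma> + 1 + 2 * C) * b powr (- dist p z)"
proof -
  obtain x where x: "x \<in> \<eta>" "\<forall>\<^sub>F n in sequentially. gp (x n) z \<ge> dist p z - \<sigma> - 1 - C"
    using shadow_eventually[OF assms(1,3)] by blast
  obtain y where y: "y \<in> \<zeta>" "\<forall>\<^sub>F n in sequentially. gp (y n) z \<ge> dist p z - \<sigma> - 1 - C"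
    using shadow_eventually[OF assms(2,4)] by blast
  have "\<forall>\<^sub>F n in sequentially. gp (x n) (y n) \<ge> dist p z - \<sigma> - 1 - 2 * C"
    using x(2) y(2)
  proof eventually_elim
    case (elim n)
    then show ?case using hyp[of "x n" z "y n"]
      by (auto simp: min_def gromov_prod_commute[of p z] split: if_splits)
  qed
  then have "D \<eta> \<zeta> \<le> Q * b powr (- (dist p z - \<sigma> - 1 - 2 * C))"
    by (intro D_le[OF assms(1,2) x(1) y(1)] eventually_frequently) auto
  also have "\<dots> = Q * b powr (\<sigma> + 1 + 2 * C) * b powr (- dist p z)"
    by (simp add: powr_add[symmetric] mult.assoc algebra_simps)
  finally show ?thesis .
qed

lemma radial_at_null:
  assumes sd: "strongly_discrete p G" and inf: "infinite G" and t: "0 \<le> t" "t < s"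
    and summ: "(\<lambda>g. b powr (- t * len g)) summable_on G"
  shows "hausdorff_measure (gromov_boundary p) D s (radial_limit_set_at p G \<sigma>) = 0"
proof -
  define e where "e = from_nat_into G"
  have bij: "bij_betw e UNIV G"
    unfolding e_def using countable_G[OF sd] inf by (rule bij_betw_from_nat_into)
  have eG: "e i \<in> G" for i using bij by (auto simp: bij_betw_def)
  define V where "V g = {\<eta>\<in>gromov_boundary p. gromov_prod_pb (g p) p \<eta> \<le> ereal \<sigma>}" for g :: "'x \<Rightarrow> 'x"
  define d where "d i = Q * b powr (\<sigma> + 1 + 2 * C) * b powr (- len (e i))" for i
  have d0: "d i \<ge> 0" for i using Q_ge_1 by (simp add: d_def)
  have "(\<lambda>i. b powr (- t * len (e i))) summable_on UNIV"
    using summ summable_on_reindex_bij_betw[OF bij, of "\<lambda>g. b powr (- t * len g)"] by simp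
  then have "summable (\<lambda>i. b powr (- t * len (e i)))"
    by (subst (asm) summable_on_UNIV_nonneg_real_iff) auto
  then have summ': "summable (\<lambda>i. (Q * b powr (\<sigma> + 1 + 2 * C)) powr s * b powr (- t * len (e i)))"
    by (rule summable_mult)
  have dle: "d i powr s \<le> (Q * b powr (\<sigma> + 1 + 2 * C)) powr s * b powr (- t * len (e i))" for i
  proof -
    have "d i powr s = (Q * b powr (\<sigma> + 1 + 2 * C)) powr s * b powr (- (s * len (e i)))"
      using Q_ge_1 by (simp add: d_def powr_mult powr_powr mult.commute)
    also have "b powr (- (s * len (e i))) \<le> b powr (- t * len (e i))"
      using b t by (intro powr_mono) (auto intro: mult_right_mono)
    finally show ?thesis by (simp add: mult_left_mono)
  qed
  have "summable (\<lambda>i. d i powr s)"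
    by (rule summable_comparison_test'[OF summ', of 0]) (use dle in simp)
  then show ?thesis
  proof (rule hausdorff_measure_limsup_eq_0[where V = "\<lambda>i. V (e i)", rotated -2])
    fix \<eta> assume "\<eta> \<in> radial_limit_set_at p G \<sigma>"
    then obtain g :: "nat \<Rightarrow> 'x \<Rightarrow> 'x" where \<eta>: "\<eta> \<in> gromov_boundary p" and g: "\<And>n. g n \<in> G"
      and lim: "tendsto_bdry p (\<lambda>n. g n p) \<eta>" and le: "\<And>n. gromov_prod_pb (g n p) p \<eta> \<le> ereal \<sigma>"
      unfolding radial_limit_set_at_def by blast
    have ne: "\<eta> \<noteq> {}" using \<eta> bdryE by (metis empty_iff)
    show "infinite {i. \<eta> \<in> V (e i)}"
    proof
      assume fin: "finite {i. \<eta> \<in> V (e i)}"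
      \<comment> \<open>If only finitely many shadows contained the point, the approximating
        elements would have bounded length, whereas their convergence to the point forces lengths to
        infinity. Inserting 0 keeps the maximum meaningful when no shadow occurs.\<close>
      define B where "B = Max (insert 0 ((\<lambda>i. len (e i)) ` {i. \<eta> \<in> V (e i)}))"
      have "len (g n) \<le> B" for n
      proof -
        obtain i where i: "e i = g n" using g[of n] bij_betw_imp_surj_on[OF bij] by (metis imageE)
        then have "\<eta> \<in> V (e i)" using \<eta> le[of n] by (simp add: V_def)
        then have "len (e i) \<le> B" unfolding B_def using fin by (intro Max_ge) auto
        then show ?thesis using i by simp
      qed
      then have "gromov_prod_pb p (g n p) \<eta> \<le> ereal B" for n
        using gromov_prod_pb_le_dist[OF ne, of p "g n p"] by (meson ereal_less_eq(3) order_trans)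
      moreover have "\<forall>\<^sub>F n in sequentially. ereal B < gromov_prod_pb p (g n p) \<eta>"
        using lim unfolding tendsto_bdry_def tendsto_PInfty by blast
      ultimately show False
        using eventually_happens'[OF sequentially_bot] by (metis not_less)
    qed
  next
    show "V (e i) \<subseteq> gromov_boundary p" for i by (auto simp: V_def)
    show "D \<eta> \<zeta> \<le> d i" if "\<eta> \<in> V (e i)" "\<zeta> \<in> V (e i)" for \<eta> \<zeta> i
      using that shadow_diameter[of \<eta> \<zeta> "e i p" \<sigma>] by (simp add: V_def d_def)
  qed (use t d0 in auto)
qed

lemma radial_dim_le:
  assumes "strongly_discrete p G" "infinite G"
  shows "hausdorff_dim (gromov_boundary p) D (radial_limit_set p G) \<le> poincare_exponent p b G"
  unfolding poincare_exponent_def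
proof (rule Inf_greatest, clarify)
  fix t :: real
  assume t: "t \<ge> 0" "(\<lambda>g. b powr (- t * len g)) summable_on G"
  have mono: "radial_limit_set_at p G \<sigma> \<subseteq> radial_limit_set_at p G \<tau>" if "\<sigma> \<le> \<tau>" for \<sigma> \<tau>
    using that unfolding radial_limit_set_at_def by (auto, meson ereal_less_eq(3) order_trans)
  have eq: "radial_limit_set p G = (\<Union>k::nat. radial_limit_set_at p G (real (Suc k)))"
  proof
    show "radial_limit_set p G \<subseteq> (\<Union>k::nat. radial_limit_set_at p G (real (Suc k)))"
    proof
      fix \<eta> assume "\<eta> \<in> radial_limit_set p G"
      then obtain \<sigma> where \<sigma>: "\<eta> \<in> radial_limit_set_at p G \<sigma>" unfolding radial_limit_set_def by blast
      obtain k :: nat where "\<sigma> \<le> real k" using real_arch_simple by blast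
      then have "\<sigma> \<le> real (Suc k)" by simp
      then show "\<eta> \<in> (\<Union>k::nat. radial_limit_set_at p G (real (Suc k)))" using \<sigma> mono by blast
    qed
    show "(\<Union>k::nat. radial_limit_set_at p G (real (Suc k))) \<subseteq> radial_limit_set p G"
      unfolding radial_limit_set_def by (rule UN_least, rule UN_upper) simp
  qed
  have le: "hausdorff_dim (gromov_boundary p) D (radial_limit_set p G) \<le> ereal s" if "t < s" for s
    unfolding eq using t that
    by (intro hausdorff_dim_le hausdorff_measure_UN_eq_0 radial_at_null[OF assms t(1) that t(2)]) auto
  show "hausdorff_dim (gromov_boundary p) D (radial_limit_set p G) \<le> ereal t"
  proof (rule ccontr)
    assume "\<not> ?thesis"
    then obtain s where "ereal t < ereal s" "ereal s < hausdorff_dim (gromov_boundary p) D (radial_limit_set p G)"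
      using ereal_dense2 by (metis not_le)
    then show False using le[of s] by (simp add: not_less[symmetric])
  qed
qed

end

section \<open>Existence of Schottky families\<close>

context isometric_action
begin

text \<open>Greedy selection: choosing \<open>a\<close> discards the elements whose orbit points lie
  within \<rho> of \<open>a p\<close>, and \<open>ginv a\<close> translates these injectively into
  the ball of radius \<rho>. Each choice therefore uses up a bounded number of elements.\<close>

lemma separated_subset:
  assumes sd: "strongly_discrete p G" and fin: "finite A" and A: "A \<subseteq> G" and \<rho>: "\<rho> \<ge> 0"
  shows "\<exists>B\<subseteq>A. (\<forall>a\<in>B. \<forall>c\<in>B. a \<noteq> c \<longrightarrow> dist (a p) (c p) > \<rho>) \<and>
    card A \<le> card B * card {g\<in>G. len g \<le> \<rho>}"
  using fin A
proof (induction A rule: finite_psubset_induct)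
  case (psubset A)
  let ?N = "card {g\<in>G. len g \<le> \<rho>}"
  show ?case
  proof (cases "A = {}")
    case False
    then obtain a where a: "a \<in> A" by blast
    then have aG: "a \<in> G" using psubset by blast
    define A' where "A' = {x\<in>A. dist (a p) (x p) > \<rho>}"
    define A'' where "A'' = {x\<in>A. dist (a p) (x p) \<le> \<rho>}"
    have AA: "A = A' \<union> A''" "A' \<inter> A'' = {}" by (auto simp: A'_def A''_def)
    have "inj_on (\<lambda>x. ginv a \<circ> x) A''"
    proof (rule inj_onI)
      fix x y assume "ginv a \<circ> x = ginv a \<circ> y"
      then have "a \<circ> (ginv a \<circ> x) = a \<circ> (ginv a \<circ> y)" by simp
      then show "x = y" using aG by (simp add: fun_eq_iff)
    qed
    moreover have "(\<lambda>x. ginv a \<circ> x) ` A'' \<subseteq> {g\<in>G. len g \<le> \<rho>}"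
    proof (rule image_subsetI)
      fix x assume x: "x \<in> A''"
      then have "x \<in> G" "dist (a p) (x p) \<le> \<rho>" using psubset.prems by (auto simp: A''_def)
      moreover have "len (ginv a \<circ> x) = dist (a p) (x p)"
        using G_dist_swap[OF aG, of p "x p"] by simp
      ultimately show "ginv a \<circ> x \<in> {g\<in>G. len g \<le> \<rho>}"
        using G_comp[OF G_inv[OF aG]] by simp
    qed
    ultimately have N: "card A'' \<le> ?N"
      by (rule card_inj_on_le[OF _ _ finite_len_le[OF sd]])
    have finA: "finite A'" "finite A''" using psubset by (auto simp: A'_def A''_def)
    have "a \<notin> A'" using \<rho> by (simp add: A'_def)
    moreover have "A' \<subseteq> A" by (auto simp: A'_def)
    ultimately have A': "A' \<subset> A" "A' \<subseteq> G" using a psubset.prems by blast+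
    obtain B where B: "B \<subseteq> A'" "\<forall>a\<in>B. \<forall>c\<in>B. a \<noteq> c \<longrightarrow> dist (a p) (c p) > \<rho>"
        "card A' \<le> card B * ?N"
      using psubset.IH[OF A'] by (elim exE conjE) (rule that)
    have aB: "a \<notin> B" "finite B" using B(1) \<rho> finA(1) finite_subset by (auto simp: A'_def)
    have "card A = card A' + card A''" using AA finA by (metis card_Un_disjoint)
    also have "\<dots> \<le> card (insert a B) * ?N" using aB B(3) N by simp
    finally have "card A \<le> card (insert a B) * ?N" .
    moreover have "insert a B \<subseteq> A" using B(1) a by (auto simp: A'_def)
    moreover have "\<forall>x\<in>insert a B. \<forall>c\<in>insert a B. x \<noteq> c \<longrightarrow> dist (x p) (c p) > \<rho>"
      using B(1,2) by (auto simp: A'_def dist_commute)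
    ultimately show ?thesis by blast
  qed simp
qed

text \<open>There is little cancellation on either side of \<open>g\<close>:
  \<open>g \<circ> f2\<close> still starts along \<open>g\<close> and so stays away from
  \<open>ginv f1\<close>, whence \<open>f1\<close> survives as the initial direction. Applied to the
  inverse product, the same statement controls the terminal direction.\<close>

lemma gp_conjugate:
  assumes G: "f1 \<in> G" "g \<in> G" "f2 \<in> G"
    and 1: "gp (g p) (ginv f1 p) \<le> K0 + C" and 2: "gp (ginv g p) (f2 p) \<le> K0 + C"
    and len: "len g > 2 * K0 + 3 * C"
  shows "gp ((f1 \<circ> g \<circ> f2) p) (f1 p) \<ge> len f1 - K0 - 2 * C"
proof -
  have "gp (g p) (g (f2 p)) = len g - gp (ginv g p) (f2 p)" by (rule gp_prefix[OF G(2)])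
  then have "gp (g (f2 p)) (ginv f1 p) \<le> K0 + 2 * C"
    using 1 2 len hyp[of "g p" "g (f2 p)" "ginv f1 p"] by (auto simp: min_def split: if_splits)
  moreover have "gp (f1 p) (f1 (g (f2 p))) = len f1 - gp (ginv f1 p) (g (f2 p))"
    by (rule gp_prefix[OF G(1)])
  ultimately show ?thesis by (simp add: gromov_prod_commute[of p "f1 p"] gromov_prod_commute[of p "ginv f1 p"])
qed

text \<open>If all late annuli were smaller, the series with exponent \<open>s1\<close> would be
  dominated by the geometric series of ratio \<open>b powr (s0 - s1)\<close>.\<close>

lemma annuli_large:
  assumes sd: "strongly_discrete p G" and b: "b > 1" and s: "0 < s0" "s0 < s1"
    and div: "\<not> (\<lambda>g. b powr (- s1 * len g)) summable_on G"
  shows "\<exists>n\<ge>R. real (card {g\<in>G. real n \<le> len g \<and> len g < real n + 1}) > b powr (s0 * real n)"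
proof (rule ccontr)
  assume "\<not> ?thesis"
  then have le: "\<And>n. n \<ge> R \<Longrightarrow> real (card {g\<in>G. real n \<le> len g \<and> len g < real n + 1}) \<le> b powr (s0 * real n)"
    by (meson not_less)
  define r where "r = b powr (- s1)"
  define q where "q = b powr (s0 - s1)"
  have "r < b powr 0" "q < b powr 0" unfolding r_def q_def using b s by (intro powr_less_mono; simp)+
  then have r: "0 < r" "r < 1" and q: "0 < q" "q < 1" using b by (auto simp: r_def q_def)
  let ?u = "\<lambda>n. real (card {g\<in>G. real n \<le> len g \<and> len g < real n + 1}) * r ^ n"
  have "norm (?u n) \<le> q ^ n" if "n \<ge> R" for n
  proof -
    have "?u n \<le> b powr (s0 * real n) * r ^ n" using le[OF that] r by (intro mult_right_mono) auto
    also have "\<dots> = q ^ n"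
      using b by (simp add: r_def q_def powr_powr algebra_simps flip: powr_realpow powr_add)
    finally show ?thesis using r by simp
  qed
  then have summ: "summable ?u"
    by (intro summable_comparison_test'[OF summable_geometric[of q]]) (use q in auto)
  have "(\<lambda>g. r powr len g) summable_on G"
  proof (rule summable_on_layers[OF r _ _ _ summ])
    show "finite {g\<in>G. real n \<le> len g \<and> len g < real n + 1}" for n
      by (rule finite_subset[OF _ finite_len_le[OF sd, of "real n + 1"]]) auto
  qed auto
  moreover have "r powr len g = b powr (- s1 * len g)" for g :: "'x \<Rightarrow> 'x"
    by (simp add: r_def powr_powr)
  ultimately show False using div by simp
qed

end

context visual_action
begin

section \<open>Orbit growth of groups of general type\<close>

lemma infinite_G:
  assumes "strongly_discrete p G" "general_type p D G" shows "infinite G"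
proof
  assume fin: "finite G"
  obtain u where "u \<in> G" "len u > Max (len ` G)"
    using general_type_independent[OF assms] by blast
  then show False using fin by (meson Max_ge finite_imageI image_eqI not_less)
qed

text \<open>Two long independent elements generate a free semigroup, whose words of length
  \<open>j\<close> number 2^j and move \<open>p\<close> by at most \<open>j * Lm\<close>. This makes
  the exponent positive and is what guarantees nonempty sets later.\<close>

lemma poincare_divergent:
  assumes sd: "strongly_discrete p G" and gt: "general_type p D G"
  shows "\<exists>s>0. \<not> (\<lambda>g. b powr (- s * len g)) summable_on G"
proof -
  obtain K0 where K0: "K0 \<ge> 0" and ind: "\<And>R. \<exists>u\<in>G. \<exists>v\<in>G. len u > R \<and> len v > R \<and>
    gp (u p) (ginv u p) \<le> K0 \<and> gp (v p) (ginv v p) \<le> K0 \<and> gp (u p) (v p) \<le> K0 \<and>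
    gp (ginv u p) (ginv v p) \<le> K0 \<and> gp (u p) (ginv v p) \<le> K0 \<and> gp (v p) (ginv u p) \<le> K0"
    using general_type_independent[OF assms] by blast
  obtain u v where G: "u \<in> G" "v \<in> G" and len: "len u > 6 * K0 + 10 * C + 1" "len v > 6 * K0 + 10 * C + 1"
    and gps: "gp (u p) (ginv u p) \<le> K0" "gp (v p) (ginv v p) \<le> K0" "gp (u p) (v p) \<le> K0"
      "gp (u p) (ginv v p) \<le> K0" "gp (v p) (ginv u p) \<le> K0"
    using ind[of "6 * K0 + 10 * C + 1"] by blast
  define Lm where "Lm = len u + len v"
  have Lm: "Lm > 0" using len K0 C_nonneg by (simp add: Lm_def)
  have ap: "dist (u p) (v p) > \<bar>len u - len v\<bar> + 8 * K0 + 20 * C"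
    using dist_gromov_prod[of "u p" "v p" p] gps len K0 C_nonneg by (auto simp: abs_if)
  interpret schottky p C G "{u, v}" K0 Lm
  proof
    show "gp (ginv a p) (c p) \<le> K0" if "a \<in> {u, v}" "c \<in> {u, v}" for a c
      using that gps by (auto simp: gromov_prod_commute[of p "ginv u p"] gromov_prod_commute[of p "ginv v p"])
    show "dist (a p) (c p) > \<bar>len a - len c\<bar> + 8 * K0 + 20 * C"
      if "a \<in> {u, v}" "c \<in> {u, v}" "a \<noteq> c" for a c
      using that ap by (auto simp: dist_commute abs_minus_commute)
  qed (use G K0 len C_nonneg in \<open>auto simp: Lm_def\<close>)
  have uv: "u \<noteq> v"
  proof
    assume "u = v"
    then show False using ap K0 C_nonneg by simp
  qed
  \<comment> \<open>With this value each word of length \<open>j\<close> contributes at least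
    (2/3)^j, so the words of length \<open>j\<close> together contribute at least (4/3)^j, which is
    unbounded.\<close>
  define s where "s = log b (3 / 2) / Lm"
  have s: "s > 0" using b Lm by (simp add: s_def)
  have bs: "b powr (- s * Lm) = 2 / 3" using b Lm by (simp add: s_def powr_minus)
  have "\<not> (\<lambda>g. b powr (- s * len g)) summable_on G"
  proof
    assume summ: "(\<lambda>g. b powr (- s * len g)) summable_on G"
    define T where "T = infsum (\<lambda>g. b powr (- s * len g)) G"
    obtain j where j: "T < (4 / 3) ^ j" using real_arch_pow[of "4/3 :: real" T] by auto
    define Wj where "Wj = {w. set w \<subseteq> {u, v} \<and> length w = j}"
    have fin: "finite Wj" unfolding Wj_def by (rule finite_lists_length_eq) simp
    have card: "card Wj = 2 ^ j"
      unfolding Wj_def using card_lists_length_eq[of "{u, v}" j] uv by (simp add: numeral_2_eq_2)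
    have inj: "inj_on wd Wj"
    proof (rule inj_onI)
      fix w w' assume w: "w \<in> Wj" "w' \<in> Wj" "wd w = wd w'"
      \<comment> \<open>Freeness comes from uniqueness of hits: the constant sequence at
        \<open>wd w p\<close> follows every word with the same product.\<close>
      have self: "hit (\<lambda>n. wd w p) w''" if "wd w'' = wd w" for w''
        unfolding hit_def that using K2_nonneg C_nonneg dist_gromov_prod[of "wd w p" "wd w p" p] by simp
      show "w = w'"
        by (rule hit_unique[OF self self]) (use w in \<open>auto simp: Wj_def\<close>)
    qed
    have "(4 / 3 :: real) ^ j = (\<Sum>w\<in>Wj. (2 / 3) ^ j)"
      by (simp add: card flip: power_mult_distrib)
    also have "\<dots> \<le> (\<Sum>w\<in>Wj. b powr (- s * len (wd w)))"
    proof (rule sum_mono)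
      fix w assume "w \<in> Wj"
      then have "len (wd w) \<le> real j * Lm" using len_word_le[of w] by (simp add: Wj_def)
      then have "s * len (wd w) \<le> s * (real j * Lm)" using s by (intro mult_left_mono) auto
      then have "b powr (- s * Lm * real j) \<le> b powr (- s * len (wd w))"
        using b by (intro powr_mono) (auto simp: mult_ac)
      moreover have "b powr (- s * Lm * real j) = (2 / 3) ^ j"
      proof -
        have "b powr (- s * Lm * real j) = (b powr (- s * Lm)) powr real j"
          by (simp only: powr_powr)
        then show ?thesis unfolding bs by (simp add: powr_realpow)
      qed
      ultimately show "(2 / 3) ^ j \<le> b powr (- s * len (wd w))" by simp
    qed
    also have "\<dots> = (\<Sum>g\<in>wd ` Wj. b powr (- s * len g))"
      using inj by (simp add: sum.reindex)
    also have "\<dots> \<le> T"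
      unfolding T_def using fin word_G by (intro finite_sum_le_infsum summ) (auto simp: Wj_def)
    finally show False using j by simp
  qed
  then show ?thesis using s by blast
qed

text \<open>Elements of an annulus may point anywhere. Framing them as
  \<open>f1 \<circ> g \<circ> f2\<close> with \<open>f1\<close> and \<open>f2\<close> from one pair
  makes all of them leave \<open>p\<close> along \<open>f1\<close> and all inverses along
  \<open>ginv f2\<close>; these directions have small overlap even when \<open>f1 = f2\<close>. The
  growth margin between \<open>s\<close> and \<open>s0\<close> pays for thinning out the annulus and
  for the longer letters.\<close>

lemma schottky_exists:
  assumes sd: "strongly_discrete p G" and gt: "general_type p D G" and s: "0 < s" "s < s0"
    and ann: "\<And>R. \<exists>n\<ge>R. real (card {g\<in>G. real n \<le> len g \<and> len g < real n + 1}) > b powr (s0 * real n)"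
  shows "\<exists>S K Lm m. schottky p C G S K Lm \<and> finite S \<and> m \<ge> 4 \<and> card S \<ge> 2 * m \<and> real m \<ge> b powr (s * Lm)"
proof -
  obtain K0 where K0: "K0 \<ge> 0" and ind: "\<And>R. \<exists>u\<in>G. \<exists>v\<in>G. len u > R \<and> len v > R \<and>
    gp (u p) (ginv u p) \<le> K0 \<and> gp (v p) (ginv v p) \<le> K0 \<and> gp (u p) (v p) \<le> K0 \<and>
    gp (ginv u p) (ginv v p) \<le> K0 \<and> gp (u p) (ginv v p) \<le> K0 \<and> gp (v p) (ginv u p) \<le> K0"
    using general_type_independent[OF sd gt] by blast
  obtain u v where uvG: "u \<in> G" "v \<in> G" and luv: "len u > 2 * K0 + 4 * C" "len v > 2 * K0 + 4 * C"
    and gps: "gp (u p) (ginv u p) \<le> K0" "gp (v p) (ginv v p) \<le> K0" "gp (u p) (v p) \<le> K0"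
      "gp (ginv u p) (ginv v p) \<le> K0" "gp (u p) (ginv v p) \<le> K0" "gp (v p) (ginv u p) \<le> K0"
    using ind[of "2 * K0 + 4 * C"] by blast
  define F where "F = {u, v}"
  have F: "f \<in> G" "len f > 2 * K0 + 4 * C" "len f \<le> len u + len v" if "f \<in> F" for f
    using that uvG luv by (auto simp: F_def)
  have gpF: "gp (f1 p) (ginv f2 p) \<le> K0" if "f1 \<in> F" "f2 \<in> F" for f1 f2
    using that gps by (auto simp: F_def)
  define W where "W = 2 * (len u + len v)"
  have W: "W \<ge> 0" by (simp add: W_def)
  define K where "K = K0 + 2 * C"
  \<comment> \<open>Framing lowers the distance of two orbit points by at most \<open>W\<close>, and
    framed lengths differ by at most \<open>1 + 2 * W\<close>; the remaining
    \<open>8 * K + 20 * C\<close> is the separation demanded of a Schottky family.\<close>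
  define \<rho> where "\<rho> = 1 + 3 * W + 8 * K + 20 * C"
  have \<rho>0: "\<rho> \<ge> 0" using W K0 C_nonneg by (simp add: \<rho>_def K_def)
  define N where "N = card {g\<in>G. len g \<le> \<rho>}"
  have N: "N \<ge> 1"
  proof -
    have "id \<in> {g\<in>G. len g \<le> \<rho>}" using G_id \<rho>0 by simp
    then have "{g\<in>G. len g \<le> \<rho>} \<noteq> {}" by blast
    then have "N > 0" unfolding N_def using finite_len_le[OF sd] card_gt_0_iff by blast
    then show ?thesis by simp
  qed
  \<comment> \<open>The factor 8 splits into 4 for the pigeonhole over pairs \<open>f1\<close>,
    \<open>f2\<close> and 2 for having \<open>2 * m\<close> letters; \<open>N\<close> is lost in
    separating the elements. The summand 5 leaves room for rounding and for
    \<open>m \<ge> 4\<close>.\<close>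
  define c where "c = 8 * real N * (b powr (s * (1 + W)) + 5)"
  have c: "c > 0" using N by (simp add: c_def add_pos_pos add_nonneg_pos)
  obtain R1 :: nat where R1: "real R1 > log b c / (s0 - s)" using reals_Archimedean2 by blast
  obtain R2 :: nat where R2: "real R2 > W + 2 * K + 5 * C + 1" using reals_Archimedean2 by blast
  obtain n where n: "n \<ge> max R1 R2"
    and big: "real (card {g\<in>G. real n \<le> len g \<and> len g < real n + 1}) > b powr (s0 * real n)"
    using ann by blast
  have n2: "real n > W + 2 * K + 5 * C + 1" using n R2 by linarith
  have bn: "b powr (s0 * real n) \<ge> 8 * real N * (b powr (s * (real n + 1 + W)) + 5)"
  proof -
    have "log b c < real n * (s0 - s)"
      using n R1 s by (simp add: pos_divide_less_eq) (smt (verit) mult_right_mono of_nat_mono max.bounded_iff)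
    then have "c \<le> b powr (real n * (s0 - s))" using b c by (simp add: log_less_iff less_imp_le)
    moreover have b1: "b powr (s * real n) \<ge> 1" using b s by (intro ge_one_powr_ge_zero) auto
    ultimately have "b powr (s * real n) * c \<le> b powr (s * real n) * b powr (real n * (s0 - s))"
      by (intro mult_left_mono) auto
    also have "\<dots> = b powr (s0 * real n)" by (simp add: algebra_simps flip: powr_add)
    finally have "b powr (s * real n) * c \<le> b powr (s0 * real n)" .
    moreover have "8 * real N * (b powr (s * (real n + 1 + W)) + 5) \<le> b powr (s * real n) * c"
    proof -
      have "b powr (s * (real n + 1 + W)) = b powr (s * real n) * b powr (s * (1 + W))"
        by (simp add: algebra_simps flip: powr_add)
      then have "b powr (s * (real n + 1 + W)) + 5 \<le> b powr (s * real n) * (b powr (s * (1 + W)) + 5)"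
        using b1 by (simp add: algebra_simps)
      then show ?thesis unfolding c_def
        by (simp add: mult.left_commute[of "b powr (s * real n)"] mult_left_mono)
    qed
    ultimately show ?thesis by linarith
  qed
  define A where "A = {g\<in>G. real n \<le> len g \<and> len g < real n + 1}"
  have finA: "finite A"
    unfolding A_def by (rule finite_subset[OF _ finite_len_le[OF sd, of "real n + 1"]]) auto
  have AG: "A \<subseteq> G" by (auto simp: A_def)
  obtain B where B: "B \<subseteq> A" "\<forall>a\<in>B. \<forall>c\<in>B. a \<noteq> c \<longrightarrow> dist (a p) (c p) > \<rho>"
      "card A \<le> card B * N"
    using separated_subset[OF sd finA AG \<rho>0] unfolding N_def[symmetric]
    by (elim exE conjE) (rule that)
  have finB: "finite B" using B(1) finA finite_subset by blast
  define P where "P f1 f2 g \<longleftrightarrow> gp (g p) (ginv f1 p) \<le> K0 + C \<and> gp (ginv g p) (f2 p) \<le> K0 + C" for f1 f2 g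
  \<comment> \<open>The points \<open>ginv u p\<close> and \<open>ginv v p\<close> have small
    product, so \<open>g p\<close> cannot overlap much with both of them; likewise
    \<open>ginv g p\<close> cannot overlap much with both \<open>u p\<close> and
    \<open>v p\<close>.\<close>
  have P_ex: "\<exists>f1\<in>F. \<exists>f2\<in>F. P f1 f2 g" for g
  proof -
    have "gp (g p) (ginv u p) \<le> K0 + C \<or> gp (g p) (ginv v p) \<le> K0 + C"
      using hyp[of "ginv u p" "g p" "ginv v p"] gps
      by (auto simp: min_def gromov_prod_commute[of p "g p"] split: if_splits)
    moreover have "gp (ginv g p) (u p) \<le> K0 + C \<or> gp (ginv g p) (v p) \<le> K0 + C"
      using hyp[of "u p" "ginv g p" "v p"] gps
      by (auto simp: min_def gromov_prod_commute[of p "ginv g p"] split: if_splits)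
    ultimately show ?thesis unfolding P_def F_def by blast
  qed
  have "\<exists>f1\<in>F. \<exists>f2\<in>F. card B \<le> 4 * card {g\<in>B. P f1 f2 g}"
  proof (rule ccontr)
    assume "\<not> ?thesis"
    then have l: "4 * card {g\<in>B. P f1 f2 g} < card B" if "f1 \<in> F" "f2 \<in> F" for f1 f2
      using that by (meson not_le)
    have "B \<subseteq> ({g\<in>B. P u u g} \<union> {g\<in>B. P u v g}) \<union> ({g\<in>B. P v u g} \<union> {g\<in>B. P v v g})"
      using P_ex unfolding F_def by blast
    then have "card B \<le> card (({g\<in>B. P u u g} \<union> {g\<in>B. P u v g}) \<union> ({g\<in>B. P v u g} \<union> {g\<in>B. P v v g}))"
      using finB by (intro card_mono) auto
    also have "\<dots> \<le> (card {g\<in>B. P u u g} + card {g\<in>B. P u v g}) + (card {g\<in>B. P v u g} + card {g\<in>B. P v v g})"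
      by (intro order_trans[OF card_Un_le] add_mono card_Un_le)
    finally show False using l[of u u] l[of u v] l[of v u] l[of v v] unfolding F_def by simp
  qed
  then obtain f1 f2 where f: "f1 \<in> F" "f2 \<in> F" and cardP: "card B \<le> 4 * card {g\<in>B. P f1 f2 g}" by blast
  have fG: "f1 \<in> G" "f2 \<in> G" using f F by auto
  define B' where "B' = {g\<in>B. P f1 f2 g}"
  have B': "g \<in> G" "real n \<le> len g" "len g < real n + 1" "P f1 f2 g" if "g \<in> B'" for g
    using that B(1) by (auto simp: B'_def A_def)
  define \<Phi> where "\<Phi> g = f1 \<circ> g \<circ> f2" for g
  define S where "S = \<Phi> ` B'"
  have inv_\<Phi>: "g = ginv f1 \<circ> \<Phi> g \<circ> ginv f2" if "g \<in> B'" for g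
    using fG by (simp add: \<Phi>_def fun_eq_iff)
  have inj: "inj_on \<Phi> B'" using inv_\<Phi> by (metis inj_onI)
  have \<Phi>G: "\<Phi> g \<in> G" if "g \<in> B'" for g using that B' fG by (simp add: \<Phi>_def G_comp)
  have lf: "len f1 + len f2 \<le> W" using F(3)[OF f(1)] F(3)[OF f(2)] by (simp add: W_def)
  have len\<Phi>: "\<bar>len (\<Phi> g) - len g\<bar> \<le> W" if "g \<in> B'" for g
  proof -
    have "len (\<Phi> g) \<le> len f1 + len g + len f2"
      using len_comp_le[OF G_comp[OF fG(1) B'(1)[OF that]], of f2] len_comp_le[OF fG(1), of g]
      unfolding \<Phi>_def by linarith
    moreover have "len g \<le> len f1 + len (\<Phi> g) + len f2"
      using len_comp_le[OF G_comp[OF G_inv[OF fG(1)] \<Phi>G[OF that]], of "ginv f2"]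
        len_comp_le[OF G_inv[OF fG(1)], of "\<Phi> g"] len_ginv[OF fG(1)] len_ginv[OF fG(2)]
        arg_cong[OF inv_\<Phi>[OF that], of "\<lambda>g. len g"] by linarith
    ultimately show ?thesis using lf by linarith
  qed
  define Lm where "Lm = real n + 1 + W"
  have schottky: "schottky p C G S K Lm"
  proof
    show "S \<subseteq> G" using \<Phi>G by (auto simp: S_def)
    show "K \<ge> 0" using K0 C_nonneg by (simp add: K_def)
    fix a assume "a \<in> S"
    then obtain g where g: "g \<in> B'" "a = \<Phi> g" by (auto simp: S_def)
    show "len a \<ge> 2 * K + 5 * C + 1" "len a \<le> Lm"
      using len\<Phi>[OF g(1)] B'[OF g(1)] n2 g(2) by (auto simp: Lm_def)
    fix d assume "d \<in> S"
    then obtain h where h: "h \<in> B'" "d = \<Phi> h" by (auto simp: S_def)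
    have lg: "len g > 2 * K0 + 3 * C" "len h > 2 * K0 + 3 * C"
      using n2 B'[OF g(1)] B'[OF h(1)] W C_nonneg K0 by (auto simp: K_def)
    have "gp ((ginv f2 \<circ> ginv g \<circ> ginv f1) p) (ginv f2 p) \<ge> len (ginv f2) - K0 - 2 * C"
      using B'[OF g(1)] lg fG
      by (intro gp_conjugate) (auto simp: P_def G_inv ginv_ginv len_ginv)
    moreover have "ginv a = ginv f2 \<circ> ginv g \<circ> ginv f1"
      using fG B'(1)[OF g(1)] by (simp add: g(2) \<Phi>_def ginv_comp G_comp comp_assoc)
    ultimately have 1: "gp (ginv a p) (ginv f2 p) \<ge> len f2 - K0 - 2 * C"
      using fG by (simp add: len_ginv)
    have 2: "gp (d p) (f1 p) \<ge> len f1 - K0 - 2 * C"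
      unfolding h(2) \<Phi>_def using B'[OF h(1)] lg fG by (intro gp_conjugate) (auto simp: P_def)
    have 3: "gp (f1 p) (ginv f2 p) \<le> K0" using gpF f by blast
    show "gp (ginv a p) (d p) \<le> K"
      using hyp2[of "ginv f2 p" "ginv a p" "d p" "f1 p"] 1 2 3 F(2)[OF f(1)] F(2)[OF f(2)]
      by (auto simp: K_def min_def gromov_prod_commute[of p "ginv f2 p"] split: if_splits)
    assume "a \<noteq> d"
    then have gh: "g \<noteq> h" using g h by auto
    have "dist (g p) (h p) > \<rho>" using B(2) g h gh by (auto simp: B'_def)
    moreover have "dist (g p) (h p) \<le> dist (a p) (d p) + 2 * len f2"
    proof -
      have "dist (a p) (d p) = dist (g (f2 p)) (h (f2 p))"
        using G_dist[OF fG(1)] by (simp add: g h \<Phi>_def)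
      moreover have "dist (g p) (g (f2 p)) = len f2" "dist (h p) (h (f2 p)) = len f2"
        using G_dist B'(1)[OF g(1)] B'(1)[OF h(1)] by auto
      moreover have "dist (g p) (h p) \<le> dist (g p) (g (f2 p)) + dist (g (f2 p)) (h (f2 p)) + dist (h p) (h (f2 p))"
        using dist_triangle[of "g p" "h p" "g (f2 p)"] dist_triangle[of "g (f2 p)" "h p" "h (f2 p)"]
        by (simp add: dist_commute)
      ultimately show ?thesis by linarith
    qed
    moreover have "2 * len f2 \<le> W" using F(3)[OF f(2)] by (simp add: W_def)
    moreover have "\<bar>len a - len d\<bar> \<le> 1 + 2 * W"
      using len\<Phi>[OF g(1)] len\<Phi>[OF h(1)] B'[OF g(1)] B'[OF h(1)] g(2) h(2) by (simp add: abs_le_iff)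
    ultimately show "dist (a p) (d p) > \<bar>len a - len d\<bar> + 8 * K + 20 * C"
      by (simp add: \<rho>_def)
  qed
  have cardS: "card S = card B'" unfolding S_def using inj by (rule card_image)
  have "b powr (s0 * real n) < real (card A)" using big by (simp add: A_def)
  also have "\<dots> \<le> real (card B * N)" using B(3) by (simp only: of_nat_le_iff)
  also have "\<dots> \<le> real (4 * card S * N)"
    using cardP unfolding cardS B'_def by (simp only: of_nat_le_iff mult_le_mono1)
  finally have up: "b powr (s0 * real n) < 4 * (real (card S) * real N)" by simp
  define X where "X = b powr (s * Lm) + 5"
  have low: "8 * (X * real N) \<le> b powr (s0 * real n)"
    using bn by (simp add: X_def Lm_def mult_ac)
  have cS: "2 * X < real (card S)"
  proof (rule ccontr)
    assume "\<not> ?thesis"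
    then have "real (card S) * real N \<le> 2 * X * real N" by (intro mult_right_mono) auto
    then show False using up low by linarith
  qed
  define m where "m = card S div 2"
  have "2 * m \<le> card S" "card S \<le> 2 * m + 1" by (auto simp: m_def)
  then have m1: "2 * m \<le> card S" and m2: "real (card S) \<le> 2 * real m + 1" by linarith+
  have "X \<ge> 5" by (simp add: X_def)
  then have "real m > 4" using cS m2 by linarith
  moreover have "real m \<ge> b powr (s * Lm)" using cS m2 \<open>X \<ge> 5\<close> X_def by linarith
  moreover have "finite S" using finB by (simp add: S_def B'_def)
  ultimately show ?thesis
    using schottky m1 by (intro exI[of _ S] exI[of _ K] exI[of _ Lm] exI[of _ m]) auto
qed

end

section \<open>Dimension of the badly approximable points\<close>

lemma (in visual_action) badly_approximable_dim_ge:
  fixes J :: "nat set" and \<xi> :: "nat \<Rightarrow> 'x bdry"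
  assumes sd: "strongly_discrete p G" and gt: "general_type p D G"
    and \<xi>: "\<And>k. k \<in> J \<Longrightarrow> \<xi> k \<in> gromov_boundary p"
    and s: "0 < s" "s < s1" and div: "\<not> (\<lambda>g. b powr (- s1 * len g)) summable_on G"
  defines "A \<equiv> (\<Inter>k\<in>J. badly_approximable p b D G (\<xi> k)) \<inter> uniformly_radial_limit_set p G"
  shows "A \<noteq> {} \<and> hausdorff_dim (gromov_boundary p) D A \<ge> ereal s"
proof -
  obtain s0 where s0: "s < s0" "s0 < s1" using dense[OF s(2)] by blast
  have s0_pos: "0 < s0" using s s0 by simp
  obtain S K Lm m where "schottky p C G S K Lm" and S: "finite S" "m \<ge> 4" "card S \<ge> 2 * m"
      "real m \<ge> b powr (s * Lm)"
    using schottky_exists[OF sd gt s(1) s0(1) annuli_large[OF sd b s0_pos s0(2) div]] by blast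
  then interpret S: schottky p C G S K Lm by simp
  interpret schottky_visual p C G S K Lm b D
    by unfold_locales (rule sd)
  show ?thesis
    unfolding A_def by (rule full_dimension[OF \<xi> S(2,1,3) s(1) S(4)])
qed

theorem theorem5p10:
  fixes p :: "'x::metric_space"
    and b :: real
    and D :: "'x bdry \<Rightarrow> 'x bdry \<Rightarrow> real"
    and G :: "('x \<Rightarrow> 'x) set"
    and l :: enat
    and \<xi> :: "nat \<Rightarrow> 'x bdry"
  assumes "gromov_hyperbolic TYPE('x)"
    and "b > 1"
    and "visual_metric p b D"
    and "subgroup G isom_group"
    and "strongly_discrete p G"
    and "general_type p D G"
    and "\<And>k. 1 \<le> k \<Longrightarrow> enat k \<le> l \<Longrightarrow> \<xi> k \<in> gromov_boundary p"
  shows "hausdorff_dim (gromov_boundary p) D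
           ((\<Inter>k\<in>{k. 1 \<le> k \<and> enat k \<le> l}. badly_approximable p b D G (\<xi> k))
             \<inter> uniformly_radial_limit_set p G)
         = poincare_exponent p b G
       \<and> poincare_exponent p b G
         = hausdorff_dim (gromov_boundary p) D (radial_limit_set p G)
       \<and> (\<forall>\<zeta>\<in>gromov_boundary p. badly_approximable p b D G \<zeta> \<noteq> {})
       \<and> (\<forall>\<zeta>\<in>gromov_boundary p.
            \<not> (\<exists>\<phi> :: real \<Rightarrow> real. (\<phi> \<longlongrightarrow> 0) at_top \<and>
                 (\<forall>\<eta>\<in>radial_limit_set p G. \<exists>C>0.
                    infinite {g\<in>G. D (bdry_act g \<zeta>) \<eta>
                      \<le> C * b powr (- dist p (g p)) * \<phi> (b powr dist p (g p))})))"
proof -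
  obtain C where C: "C \<ge> 0" "\<And>x y z w :: 'x.
      gromov_prod w x z \<ge> min (gromov_prod w x y) (gromov_prod w y z) - C"
    using assms(1) unfolding gromov_hyperbolic_def by blast
  interpret visual_action p C G b D
    by (intro visual_action.intro isometric_action.intro hyperbolic_at.intro
        isometric_action_axioms.intro visual_action_axioms.intro C assms)
  note sd = assms(5) and gt = assms(6)
  let ?\<delta> = "poincare_exponent p b G" and ?dim = "hausdorff_dim (gromov_boundary p) D"
  let ?J = "{k. 1 \<le> k \<and> enat k \<le> l}"
  define A where "A = (\<Inter>k\<in>?J. badly_approximable p b D G (\<xi> k)) \<inter> uniformly_radial_limit_set p G"
  have J: "\<xi> k \<in> gromov_boundary p" if "k \<in> ?J" for k using that assms(7) by simp
  have upper: "?dim (radial_limit_set p G) \<le> ?\<delta>"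
    by (rule radial_dim_le[OF sd infinite_G[OF sd gt]])
  have mono: "?dim A \<le> ?dim (radial_limit_set p G)"
    using uniformly_radial_subset[of p G] by (intro hausdorff_dim_mono) (auto simp: A_def)
  have lower: "?\<delta> \<le> ?dim A"
  proof (rule ccontr)
    assume "\<not> ?thesis"
    then obtain s where s: "?dim A < ereal s" "ereal s < ?\<delta>"
      using ereal_dense2[of "?dim A" ?\<delta>] by (auto simp: not_le)
    obtain s1 where s1: "ereal s < ereal s1" "ereal s1 < ?\<delta>"
      using ereal_dense2[OF s(2)] by blast
    \<comment> \<open>Positivity is automatic, since \<open>s\<close> lies strictly above a
      Hausdorff dimension. Working with a real number strictly in between also covers an infinite
      exponent.\<close>
    have s_pos: "s > 0"
      using order_le_less_trans[OF hausdorff_dim_nonneg s(1)] by simp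
    have div: "\<not> (\<lambda>g. b powr (- s1 * len g)) summable_on G"
    proof
      assume "(\<lambda>g. b powr (- s1 * len g)) summable_on G"
      then have "?\<delta> \<le> ereal s1"
        unfolding poincare_exponent_def using s_pos s1 by (intro Inf_lower) auto
      then show False using s1(2) by simp
    qed
    have ss: "s < s1" using s1(1) by simp
    have "ereal s \<le> ?dim A"
      unfolding A_def
      by (rule badly_approximable_dim_ge[where J = ?J and \<xi> = \<xi>, OF sd gt J s_pos ss div, THEN conjunct2])
    then show False using s(1) by simp
  qed
  have nonempty: "badly_approximable p b D G \<zeta> \<noteq> {}" if \<zeta>: "\<zeta> \<in> gromov_boundary p" for \<zeta>
  proof -
    \<comment> \<open>Divergence at a positive exponent is used here, because a dimension of 0 alone
      would not distinguish the set from the empty one.\<close>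
    obtain s where s: "s > 0" "\<not> (\<lambda>g. b powr (- s * len g)) summable_on G"
      using poincare_divergent[OF sd gt] by blast
    have half: "s / 2 > 0" "s / 2 < s" using s by auto
    have "(\<Inter>k\<in>{0::nat}. badly_approximable p b D G \<zeta>) \<inter> uniformly_radial_limit_set p G \<noteq> {}"
      by (rule badly_approximable_dim_ge[where J = "{0}" and \<xi> = "\<lambda>_. \<zeta>", OF sd gt _ half s(2),
            THEN conjunct1]) (rule \<zeta>)
    then show ?thesis by auto
  qed
  have no_rate: "\<not> (\<exists>\<phi> :: real \<Rightarrow> real. (\<phi> \<longlongrightarrow> 0) at_top \<and>
                 (\<forall>\<eta>\<in>radial_limit_set p G. \<exists>C>0.
                    infinite {g\<in>G. D (bdry_act g \<zeta>) \<eta>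
                      \<le> C * b powr (- dist p (g p)) * \<phi> (b powr dist p (g p))}))"
    if \<zeta>: "\<zeta> \<in> gromov_boundary p" for \<zeta>
  proof clarify
    fix \<phi> :: "real \<Rightarrow> real"
    assume \<phi>: "(\<phi> \<longlongrightarrow> 0) at_top" and all: "\<forall>\<eta>\<in>radial_limit_set p G. \<exists>C>0.
        infinite {g\<in>G. D (bdry_act g \<zeta>) \<eta> \<le> C * b powr (- dist p (g p)) * \<phi> (b powr dist p (g p))}"
    obtain \<eta> \<epsilon> where \<eta>: "\<eta> \<in> radial_limit_set p G" and \<epsilon>: "\<epsilon> > 0"
      and ba: "\<And>g. g \<in> G \<Longrightarrow> D (bdry_act g \<zeta>) \<eta> \<ge> \<epsilon> * b powr (- len g)"
      using nonempty[OF \<zeta>] unfolding badly_approximable_def by blast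
    obtain c where c: "c > 0"
      and inf: "infinite {g\<in>G. D (bdry_act g \<zeta>) \<eta> \<le> c * b powr (- len g) * \<phi> (b powr len g)}"
      using all \<eta> by blast
    have "\<forall>\<^sub>F t in at_top. \<phi> t < \<epsilon> / c" using \<phi> \<epsilon> c by (intro order_tendstoD) auto
    then obtain T where T: "\<And>t. t \<ge> T \<Longrightarrow> \<phi> t < \<epsilon> / c" unfolding eventually_at_top_linorder by blast
    \<comment> \<open>Beyond this length the argument of \<phi> exceeds \<open>T\<close>, so the
      assumed upper bound drops strictly below the lower bound of bad approximability. All solutions
      then lie in a ball, which strong discreteness makes finite.\<close>
    define R where "R = log b (max T 1)"
    have "{g\<in>G. D (bdry_act g \<zeta>) \<eta> \<le> c * b powr (- len g) * \<phi> (b powr len g)} \<subseteq> {g\<in>G. len g \<le> R}"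
    proof clarify
      fix g assume g: "g \<in> G" and le: "D (bdry_act g \<zeta>) \<eta> \<le> c * b powr (- len g) * \<phi> (b powr len g)"
      show "len g \<le> R"
      proof (rule ccontr)
        assume "\<not> len g \<le> R"
        then have "b powr R \<le> b powr len g" using b by (intro powr_mono) auto
        then have "T \<le> b powr len g" using b by (simp add: R_def)
        then have "c * \<phi> (b powr len g) < \<epsilon>" using T c by (simp add: pos_less_divide_eq mult.commute)
        then have "b powr (- len g) * (c * \<phi> (b powr len g)) < b powr (- len g) * \<epsilon>"
          using b by (intro mult_strict_left_mono) auto
        then show False using ba[OF g] le by (simp add: mult_ac)
      qed
    qed
    then show False using inf finite_len_le[OF sd, of R] finite_subset by blast
  qed
  have "?dim A = ?\<delta>" "?\<delta> = ?dim (radial_limit_set p G)"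
    using upper mono lower by auto
  then show ?thesis
    unfolding A_def using nonempty no_rate by (intro conjI ballI)
qed

end
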